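(* Let $N\geq1$. As functions of a non-framed link $L$ (classical or in the solid torus) with $N$ connected components, all the invariants $L\mapsto P_L^{\rho_d}$, for $d\geq1$ and $\{\rho_{d,n}\}_{n\geq1}$ any Markov trace on $\{\widehat{Y}_{d,n}\}_{n\geq1}$ in the span of the basic Markov traces $\{\rho_{d,n}^{S,\boldsymbol{\tau}}\}_{n\geq1}$, are (finite) linear combinations of the basic invariants $$P_L^{1,\{1\},\boldsymbol{\tau}}\,,\ P_L^{2,\{1,2\},\boldsymbol{\tau}}\,,\ \dots\,,\ P_L^{N,\{1,\dots,N\},\boldsymbol{\tau}}\ ,$$ where in $P_L^{k,\{1,\dots,k\},\boldsymbol{\tau}}$ the symbol $\boldsymbol{\tau}$ ranges over the choices of $k$ Markov traces on $\{\widehat{H}_n\}_{n\geq1}$. In particular, for a non-framed knot ($N=1$), it is enough to consider the invariants $P_L^{1,\{1\},\tau}$, obtained from the algebras $\widehat{H}_n=\widehat{Y}_{1,n}$.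
   Context: Let $u,v,\gamma$ be indeterminates, $R=\mathbb{C}[u^{\pm1},v^{\pm1},\gamma^{\pm1}]$; all algebras are over $R$. Spans and linear combinations of Markov traces and of invariants are with coefficients in $\mathbb{C}[u^{\pm1},v^{\pm1}]$. $s_i=(i,i+1)\in\mathfrak{S}_n$, $\ell$ is the length function. Affine Yokonuma--Hecke algebra: $\widehat{Y}_{d,n}$ is the unital associative algebra generated by $g_1,\dots,g_{n-1},X_1^{\pm1},t_1,\dots,t_n$ with relations: (1) $g_ig_j=g_jg_i$ for $|i-j|>1$; $g_ig_{i+1}g_i=g_{i+1}g_ig_{i+1}$; $X_1g_1X_1g_1=g_1X_1g_1X_1$; $X_1g_i=g_iX_1$ for $i\geq2$; (2) $t_it_j=t_jt_i$; $g_it_j=t_{s_i(j)}g_i$; $t_j^d=1$; $X_1t_j=t_jX_1$; (3) $g_i^2=u^2+v\,e_ig_i$, where $e_i=\frac1d\sum_{s=1}^{d}t_i^st_{i+1}^{-s}$. For $w$ with reduced expression $s_{i_1}\cdots s_{i_r}$, $g_w=g_{i_1}\cdots g_{i_r}$; $X_{i+1}=u^{-2}g_iX_ig_i$ (the $X_i$ commute with each other and with the $t_j$); $X^{\lambda}=X_1^{\lambda_1}\cdots X_n^{\lambda_n}$. $\widehat{Y}_{d,n}\subset\widehat{Y}_{d,n+1}$ via the generators with the same names. The affine Hecke algebra is $\widehat{H}_n=\widehat{Y}_{1,n}$ ($t_j=1$, $e_i=1$), with generators $\overline{g}_i,\overline{X}_1^{\pm1}$ and elements $\overline{X}_i,\overline{g}_w$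 defined likewise; $\widehat{H}_0$ is the ground ring. Markov traces: a Markov trace on $\{\widehat{Y}_{d,n}\}_{n\geq1}$ is a family of linear maps $\rho_{d,n}$ on $\widehat{Y}_{d,n}$ with values in $\mathbb{C}[u^{\pm1},v^{\pm1}]$ (extended $R$-linearly) such that $\rho_{d,n}(xy)=\rho_{d,n}(yx)$ for $x,y\in\widehat{Y}_{d,n}$, and $\rho_{d,n+1}(xg_n)=\rho_{d,n+1}(xg_n^{-1})=\rho_{d,n}(x)$ for $x\in\widehat{Y}_{d,n}$, $n\geq1$. A Markov trace on $\{\widehat{H}_n\}_{n\geq1}$ is the same notion with $d=1$. Isomorphism: a $d$-composition of $n$ is $\mu\in\mathbb{Z}_{\geq0}^d$ with $\sum_a\mu_a=n$. $\mathfrak{S}^{\mu}$ is the Young subgroup permuting the consecutive blocks of sizes $\mu_1,\dots,\mu_d$; $m_{\mu}=\frac{n!}{\mu_1!\cdots\mu_d!}$; $\widehat{H}^{\mu}=\widehat{H}_{\mu_1}\otimes\dots\otimes\widehat{H}_{\mu_d}$, identified with the subalgebra of $\widehat{H}_n$ generated by all $\overline{X}_j^{\pm1}$ and the $\overline{g}_i$ with $s_i\in\mathfrak{S}^{\mu}$. Let $\xi_1,\dots,\xi_d$ be the $d$-th roots of unity. $\mathcal{T}_{d,n}=\langle t_1,\dots,t_n\rangle$ is the group algebra of $(\mathbb{Z}/d\mathbb{Z})^n$, $\operatorname{Irr}(\mathcal{T}_{d,n})$ its set of characters ($\chi(t_j)\in\{\xi_1,\dots,\xi_d\}$), $E_{\chi}$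 the primitive idempotent of $\chi$, $\operatorname{Comp}(\chi)=\mu$ with $\mu_a=\#\{j:\chi(t_j)=\xi_a\}$. $\mathfrak{S}_n$ acts by $w(\chi)(t_i)=\chi(t_{w^{-1}(i)})$. $\chi_0^{\mu}$ takes the value $\xi_1$ on the first $\mu_1$ of the $t_j$, $\xi_2$ on the next $\mu_2$, etc.; $\pi_{\chi}$ is the element of minimal length with $\pi_{\chi}(\chi_0^{\mu})=\chi$, $\mu=\operatorname{Comp}(\chi)$. Matrices in $\operatorname{Mat}_{m_{\mu}}(\widehat{H}^{\mu})$ are indexed by the characters $\chi$ with $\operatorname{Comp}(\chi)=\mu$, with matrix units $\boldsymbol{1}_{\chi,\chi'}$. $\Psi_{d,n}:\widehat{Y}_{d,n}\to\bigoplus_{\mu}\operatorname{Mat}_{m_{\mu}}(\widehat{H}^{\mu})$ is the algebra isomorphism $$E_{\chi}X^{\lambda}g_{w^{-1}}\mapsto u^{\ell(w^{-1})-\ell(\pi_{\chi}^{-1}w^{-1}\pi_{w(\chi)})}\boldsymbol{1}_{\chi,w(\chi)}\Bigl(\prod_j\overline{X}_{\pi_{\chi}^{-1}(j)}^{\lambda_j}\Bigr)\overline{g}_{\pi_{\chi}^{-1}w^{-1}\pi_{w(\chi)}}.$$ Basic Markov traces: for a non-empty $S\subseteq\{1,\dots,d\}$ and a choice $\boldsymbol{\tau}$ of a Markov trace $\{\tau_n^a\}_{n\geq1}$ on $\{\widehat{H}_n\}_{n\geq1}$ for each $a\in S$, $\rho_{d,n}^{S,\boldsymbol{\tau}}(x)=\sum_{\mu}\bigl(\bigotimes_{a\in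 S}\tau^a_{\mu_a}\bigr)\bigl(\operatorname{Tr}(\Psi_{d,n}(x)_{\mu})\bigr)$, the sum being over the $d$-compositions $\mu$ of $n$ such that $\mu_a\neq0$ if and only if $a\in S$, where $\Psi_{d,n}(x)_{\mu}$ is the component in $\operatorname{Mat}_{m_{\mu}}(\widehat{H}^{\mu})$, $\operatorname{Tr}$ is the usual matrix trace with values in $\widehat{H}^{\mu}$, and factors $\widehat{H}_0$ are treated by the identity. These families are Markov traces on $\{\widehat{Y}_{d,n}\}_{n\geq1}$. Braids, links and invariants: the $\mathbb{Z}/d\mathbb{Z}$-framed affine braid group $\mathbb{Z}/d\mathbb{Z}\wr B_n^{\mathrm{aff}}$ is generated by $\sigma_1,\dots,\sigma_{n-1},\sigma_0,t_1,\dots,t_n$ with relations (1)--(2) in which $g_i$ is replaced by $\sigma_i$ and $X_1$ by $\sigma_0$; the affine braid group $B_n^{\mathrm{aff}}$ is its subgroup generated by $\sigma_0,\dots,\sigma_{n-1}$, and the classical braid group the one generated by $\sigma_1,\dots,\sigma_{n-1}$. Links in the solid torus (resp. classical links) are closures of affine (resp. classical) braids, $\sigma_0$ being the braid whose first strand winds once around the core axis. The number of components of the closure of a braid is the number of cycles (fixed points included) of its image in $\mathfrak{S}_n$ under $t_j\mapsto1$, $\sigma_0\mapsto1$, $\sigma_i\mapsto s_i$. A non-framed link is regarded as a $\mathbb{Z}/d\mathbb{Z}$-framed link with all framings $0$, thus as the closure of an element of $B_n^{\mathrm{aff}}$. Let $\delta_{d,n}:R[\mathbb{Z}/d\mathbb{Z}\wr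 B_n^{\mathrm{aff}}]\to\widehat{Y}_{d,n}$ be the algebra morphism $t_j\mapsto t_j$, $\sigma_0\mapsto X_1$, $\sigma_i\mapsto(\gamma+(1-\gamma)e_i)g_i$. For a Markov trace $\{\rho_{d,n}\}_{n\geq1}$ on $\{\widehat{Y}_{d,n}\}_{n\geq1}$, $P_L^{\rho_d}=\rho_{d,n}(\delta_{d,n}(\beta_L))\in R$, where $\beta_L$ is any braid closing to $L$; it does not depend on the choice of $\beta_L$. The basic invariant $P_L^{d,S,\boldsymbol{\tau}}$ is $P_L^{\rho_d}$ for $\rho_{d,n}=\rho_{d,n}^{S,\boldsymbol{\tau}}$. *)

theory Defs
  imports
    Complex_Main
    "HOL-Library.Poly_Mapping"
    "HOL-Library.Product_Plus"
    "HOL-Library.Function_Algebras"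
    "HOL-Combinatorics.Permutations"
    "HOL-Combinatorics.Orbits"
    "HOL-Algebra.QuotRing"
begin

section \<open>The ground ring\<close>

text \<open>The ring $R = C[u^{\pm1},v^{\pm1},\gamma^{\pm1}]$ is the group algebra of the group of
  exponents: the triple \<open>(i, j, k)\<close> stands for the monomial $u^i v^j \gamma^k$.\<close>

type_synonym laurent = "(int \<times> int \<times> int) \<Rightarrow>\<^sub>0 complex"

definition u_pow :: "int \<Rightarrow> laurent" where
  "u_pow k = Poly_Mapping.single (k, 0, 0) 1"

definition v_ind :: laurent where
  "v_ind = Poly_Mapping.single (0, 1, 0) 1"

definition gamma_ind :: laurent where
  "gamma_ind = Poly_Mapping.single (0, 0, 1) 1"

definition const_R :: "complex \<Rightarrow> laurent" where
  "const_R z = Poly_Mapping.single 0 z"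

definition uv_ring :: "laurent set" where
  "uv_ring = {p. \<forall>(i, j, k) \<in> Poly_Mapping.keys p. k = 0}"

text \<open>\<open>lin_comb_on D B f\<close>: on the domain \<open>D\<close>, the function \<open>f\<close> is a finite linear combination of
  members of the family of functions \<open>B\<close>, with coefficients in $C[u^{\pm1},v^{\pm1}]$.\<close>

definition lin_comb_on :: "'x set \<Rightarrow> ('x \<Rightarrow> laurent) set \<Rightarrow> ('x \<Rightarrow> laurent) \<Rightarrow> bool" where
  "lin_comb_on D B f \<longleftrightarrow>
     (\<exists>F c. finite F \<and> F \<subseteq> B \<and> (\<forall>b\<in>F. c b \<in> uv_ring) \<and> (\<forall>x\<in>D. f x = (\<Sum>b\<in>F. c b * b x)))"


section \<open>Algebras given by generators and relations\<close>

text \<open>Words form a monoid under concatenation, written additively, so that the convolution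
  product of \<^typ>\<open>'g list \<Rightarrow>\<^sub>0 laurent\<close> is the product of the free associative \<open>R\<close>-algebra.\<close>

instantiation list :: (type) monoid_add
begin

definition zero_list_def: "(0 :: 'a list) = []"

definition plus_list_def: "(xs :: 'a list) + ys = xs @ ys"

instance
  by standard (simp_all add: zero_list_def plus_list_def)

end

text \<open>The monoid algebra over \<open>R\<close> of a submonoid \<open>M\<close>.\<close>

definition malg :: "'m::monoid_add set \<Rightarrow> ('m \<Rightarrow>\<^sub>0 laurent) ring" where
  "malg M = \<lparr>carrier = {x. Poly_Mapping.keys x \<subseteq> M}, mult = (*), one = 1, zero = 0, add = (+)\<rparr>"

text \<open>Its quotient by the two-sided ideal generated by \<open>Q\<close>, the class of an element in this
  quotient, and the image of a scalar.\<close>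

definition palg :: "'m::monoid_add set \<Rightarrow> ('m \<Rightarrow>\<^sub>0 laurent) set \<Rightarrow> ('m \<Rightarrow>\<^sub>0 laurent) set ring" where
  "palg M Q = malg M Quot (genideal (malg M) Q)"

definition pcls :: "'m::monoid_add set \<Rightarrow> ('m \<Rightarrow>\<^sub>0 laurent) set
    \<Rightarrow> ('m \<Rightarrow>\<^sub>0 laurent) \<Rightarrow> ('m \<Rightarrow>\<^sub>0 laurent) set" where
  "pcls M Q x = genideal (malg M) Q +>\<^bsub>malg M\<^esub> x"

definition scal :: "laurent \<Rightarrow> ('m::monoid_add \<Rightarrow>\<^sub>0 laurent)" where
  "scal c = Poly_Mapping.single 0 c"

definition lprod :: "('a, 'b) ring_scheme \<Rightarrow> 'a list \<Rightarrow> 'a" where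
  "lprod A xs = foldr (\<lambda>x y. x \<otimes>\<^bsub>A\<^esub> y) xs \<one>\<^bsub>A\<^esub>"


section \<open>Symmetric groups\<close>

text \<open>Permutations compose from right to left, and \<open>s\<^sub>i\<close> is \<^term>\<open>transpose i (Suc i)\<close>.\<close>

definition perm_of_word :: "nat list \<Rightarrow> nat \<Rightarrow> nat" where
  "perm_of_word is = foldr (\<lambda>i p. transpose i (Suc i) \<circ> p) is id"

definition len :: "nat \<Rightarrow> (nat \<Rightarrow> nat) \<Rightarrow> nat" where
  "len n w = (LEAST r. \<exists>is. set is \<subseteq> {1..<n} \<and> length is = r \<and> perm_of_word is = w)"

definition reduced_word :: "nat \<Rightarrow> (nat \<Rightarrow> nat) \<Rightarrow> nat list" where
  "reduced_word n w =
     (SOME is. set is \<subseteq> {1..<n} \<and> length is = len n w \<and> perm_of_word is = w)"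

abbreviation perm_inv :: "(nat \<Rightarrow> nat) \<Rightarrow> nat \<Rightarrow> nat" where
  "perm_inv w \<equiv> inv_into UNIV w"


section \<open>The affine Yokonuma--Hecke algebras\<close>

text \<open>The letters \<open>G i\<close>, \<open>X\<close>, \<open>X'\<close>, \<open>T j\<close> are $g_i$, $X_1$, $X_1^{-1}$, $t_j$.\<close>

datatype gen = G nat | X | X' | T nat

type_synonym falg = "gen list \<Rightarrow>\<^sub>0 laurent"

definition gens :: "nat \<Rightarrow> gen set" where
  "gens n = G ` {1..<n} \<union> T ` {1..n} \<union> (if n \<ge> 1 then {X, X'} else {})"

definition gn :: "gen \<Rightarrow> falg" where
  "gn a = Poly_Mapping.single [a] 1"

text \<open>As $t_{i+1}^d = 1$, the power $t_{i+1}^{-s}$ is written $t_{i+1}^{d-s}$.\<close>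

definition e_elt :: "nat \<Rightarrow> nat \<Rightarrow> falg" where
  "e_elt d i = scal (const_R (1 / of_nat d)) *
     (\<Sum>s=1..d. gn (T i) ^ s * gn (T (Suc i)) ^ (d - s))"

text \<open>A relation \<open>l = r\<close> is recorded as the element \<open>l - r\<close>.\<close>

inductive_set yrel :: "nat \<Rightarrow> nat \<Rightarrow> falg set" for d n :: nat where
  far: "\<lbrakk>i \<in> {1..<n}; j \<in> {1..<n}; Suc i < j \<or> Suc j < i\<rbrakk>
    \<Longrightarrow> gn (G i) * gn (G j) - gn (G j) * gn (G i) \<in> yrel d n"
| braid: "\<lbrakk>1 \<le> i; Suc i < n\<rbrakk>
    \<Longrightarrow> gn (G i) * gn (G (Suc i)) * gn (G i) - gn (G (Suc i)) * gn (G i) * gn (G (Suc i))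
        \<in> yrel d n"
| X_left_inv: "1 \<le> n \<Longrightarrow> gn X' * gn X - 1 \<in> yrel d n"
| X_right_inv: "1 \<le> n \<Longrightarrow> gn X * gn X' - 1 \<in> yrel d n"
| X_braid: "2 \<le> n
    \<Longrightarrow> gn X * gn (G 1) * gn X * gn (G 1) - gn (G 1) * gn X * gn (G 1) * gn X \<in> yrel d n"
| X_far: "\<lbrakk>2 \<le> i; i < n\<rbrakk> \<Longrightarrow> gn X * gn (G i) - gn (G i) * gn X \<in> yrel d n"
| T_comm: "\<lbrakk>i \<in> {1..n}; j \<in> {1..n}\<rbrakk> \<Longrightarrow> gn (T i) * gn (T j) - gn (T j) * gn (T i) \<in> yrel d n"
| G_T: "\<lbrakk>i \<in> {1..<n}; j \<in> {1..n}\<rbrakk>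
    \<Longrightarrow> gn (G i) * gn (T j) - gn (T (transpose i (Suc i) j)) * gn (G i) \<in> yrel d n"
| T_order: "j \<in> {1..n} \<Longrightarrow> gn (T j) ^ d - 1 \<in> yrel d n"
| X_T: "j \<in> {1..n} \<Longrightarrow> gn X * gn (T j) - gn (T j) * gn X \<in> yrel d n"
| quadratic: "i \<in> {1..<n}
    \<Longrightarrow> gn (G i) ^ 2 - (scal (u_pow 2) + scal v_ind * e_elt d i * gn (G i)) \<in> yrel d n"

text \<open>\<open>YH d n\<close> is $\widehat Y_{d,n}$; the affine Hecke algebra $\widehat H_n$ is \<open>YH 1 n\<close>, and
  \<open>YH 1 0\<close>, which has no generators and no relations, is the ground ring.\<close>

definition YH :: "nat \<Rightarrow> nat \<Rightarrow> falg set ring" where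
  "YH d n = palg (lists (gens n)) (yrel d n)"

definition ycls :: "nat \<Rightarrow> nat \<Rightarrow> falg \<Rightarrow> falg set" where
  "ycls d n = pcls (lists (gens n)) (yrel d n)"

text \<open>\<open>X_elt j\<close> is $X_j$ for \<open>j \<ge> 1\<close>; the value at 0 is not used.\<close>

fun X_elt :: "nat \<Rightarrow> falg" where
  "X_elt 0 = 1"
| "X_elt (Suc 0) = gn X"
| "X_elt (Suc (Suc i)) =
     scal (u_pow (- 2)) * gn (G (Suc i)) * X_elt (Suc i) * gn (G (Suc i))"

definition X_mon :: "nat \<Rightarrow> nat \<Rightarrow> (nat \<Rightarrow> int) \<Rightarrow> falg set" where
  "X_mon d n lam =
     lprod (YH d n) (map (\<lambda>j. ycls d n (X_elt j) [^]\<^bsub>YH d n\<^esub> lam j) [1..<Suc n])"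

definition g_elt :: "nat \<Rightarrow> nat \<Rightarrow> (nat \<Rightarrow> nat) \<Rightarrow> falg set" where
  "g_elt d n w = lprod (YH d n) (map (\<lambda>i. ycls d n (gn (G i))) (reduced_word n w))"


section \<open>Markov traces\<close>

definition linear_form :: "nat \<Rightarrow> nat \<Rightarrow> (falg set \<Rightarrow> laurent) \<Rightarrow> bool" where
  "linear_form d n f \<longleftrightarrow>
     (\<forall>x \<in> carrier (YH d n). \<forall>y \<in> carrier (YH d n). f (x \<oplus>\<^bsub>YH d n\<^esub> y) = f x + f y) \<and>
     (\<forall>c. \<forall>x \<in> carrier (YH d n). f (ycls d n (scal c) \<otimes>\<^bsub>YH d n\<^esub> x) = c * f x)"

text \<open>Since $\widehat Y_{d,n}$ is obtained by extension of scalars from its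
  $C[u^{\pm1},v^{\pm1}]$-form, which is spanned over $C[u^{\pm1},v^{\pm1}]$ by the monomials in the
  generators, a linear map with values in $C[u^{\pm1},v^{\pm1}]$, extended \<open>R\<close>-linearly, is an
  \<open>R\<close>-linear map satisfying \<open>uv_valued\<close>.\<close>

definition uv_valued :: "nat \<Rightarrow> nat \<Rightarrow> (falg set \<Rightarrow> laurent) \<Rightarrow> bool" where
  "uv_valued d n f \<longleftrightarrow>
     (\<forall>y \<in> carrier (malg (lists (gens n))).
        (\<forall>w. Poly_Mapping.lookup y w \<in> uv_ring) \<longrightarrow> f (ycls d n y) \<in> uv_ring)"

text \<open>The last clause runs over representatives \<open>y\<close> of the elements of $\widehat Y_{d,n}$: the
  inclusion $\widehat Y_{d,n} \subset \widehat Y_{d,n+1}$ sends the class of \<open>y\<close> to the class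
  of \<open>y\<close>. The value of a family at \<open>n = 0\<close> plays no role.\<close>

definition markov_trace :: "nat \<Rightarrow> (nat \<Rightarrow> falg set \<Rightarrow> laurent) \<Rightarrow> bool" where
  "markov_trace d \<rho> \<longleftrightarrow>
     (\<forall>n \<ge> 1. linear_form d n (\<rho> n) \<and> uv_valued d n (\<rho> n)
        \<and> (\<forall>x \<in> carrier (YH d n). \<forall>y \<in> carrier (YH d n).
             \<rho> n (x \<otimes>\<^bsub>YH d n\<^esub> y) = \<rho> n (y \<otimes>\<^bsub>YH d n\<^esub> x))
        \<and> (\<forall>y \<in> carrier (malg (lists (gens n))).
             \<rho> (Suc n) (ycls d (Suc n) y \<otimes>\<^bsub>YH d (Suc n)\<^esub> ycls d (Suc n) (gn (G n)))
               = \<rho> n (ycls d n y) \<and>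
             \<rho> (Suc n) (ycls d (Suc n) y \<otimes>\<^bsub>YH d (Suc n)\<^esub>
                 inv\<^bsub>YH d (Suc n)\<^esub> ycls d (Suc n) (gn (G n)))
               = \<rho> n (ycls d n y)))"


section \<open>Compositions and tensor products of affine Hecke algebras\<close>

definition comps :: "nat \<Rightarrow> nat \<Rightarrow> (nat \<Rightarrow> nat) set" where
  "comps d n = {\<mu>. (\<forall>a. a \<notin> {1..d} \<longrightarrow> \<mu> a = 0) \<and> (\<Sum>a=1..d. \<mu> a) = n}"

text \<open>The position \<open>j\<close> lies in the block \<open>blk \<mu> j\<close>, in which its rank is \<open>loc \<mu> j\<close>.\<close>

definition offs :: "(nat \<Rightarrow> nat) \<Rightarrow> nat \<Rightarrow> nat" where
  "offs \<mu> a = (\<Sum>b\<in>{1..<a}. \<mu> b)"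

definition blk :: "(nat \<Rightarrow> nat) \<Rightarrow> nat \<Rightarrow> nat" where
  "blk \<mu> j = (LEAST a. j \<le> offs \<mu> (Suc a))"

definition loc :: "(nat \<Rightarrow> nat) \<Rightarrow> nat \<Rightarrow> nat" where
  "loc \<mu> j = j - offs \<mu> (blk \<mu> j)"

text \<open>A tensor product of monoid algebras is the monoid algebra of the product monoid, the family
  of words \<open>f\<close> standing for the pure tensor of the \<open>f a\<close>. Hence
  $\widehat H^\mu = \widehat H_{\mu_1} \otimes \dots \otimes \widehat H_{\mu_d}$ is the monoid algebra
  of the families of words in the respective generators, modulo the relations of each factor.\<close>

type_synonym talg = "(nat \<Rightarrow> gen list) \<Rightarrow>\<^sub>0 laurent"

definition at_factor :: "nat \<Rightarrow> falg \<Rightarrow> talg" where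
  "at_factor a x = (\<Sum>w \<in> Poly_Mapping.keys x.
     Poly_Mapping.single ((\<lambda>_. [])(a := w)) (Poly_Mapping.lookup x w))"

definition hwords :: "(nat \<Rightarrow> nat) \<Rightarrow> (nat \<Rightarrow> gen list) set" where
  "hwords \<mu> = {f. \<forall>a. f a \<in> lists (gens (\<mu> a))}"

definition hrel :: "(nat \<Rightarrow> nat) \<Rightarrow> talg set" where
  "hrel \<mu> = (\<Union>a. at_factor a ` yrel 1 (\<mu> a))"

definition HH :: "(nat \<Rightarrow> nat) \<Rightarrow> talg set ring" where
  "HH \<mu> = palg (hwords \<mu>) (hrel \<mu>)"

definition hcls :: "(nat \<Rightarrow> nat) \<Rightarrow> talg \<Rightarrow> talg set" where
  "hcls \<mu> = pcls (hwords \<mu>) (hrel \<mu>)"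

text \<open>In the identification of $\widehat H^\mu$ with a subalgebra of $\widehat H_n$, the elements
  $\overline X_j$, and $\overline g_i$ for $s_i$ in the Young subgroup, are the corresponding
  elements of rank \<open>loc \<mu> j\<close>, \<open>loc \<mu> i\<close> of the tensor factor \<open>blk \<mu> j\<close>, \<open>blk \<mu> i\<close>. A reduced
  expression of an element of the Young subgroup involves only such $s_i$.\<close>

definition X_bar :: "(nat \<Rightarrow> nat) \<Rightarrow> nat \<Rightarrow> talg set" where
  "X_bar \<mu> j = hcls \<mu> (at_factor (blk \<mu> j) (X_elt (loc \<mu> j)))"

definition g_bar :: "nat \<Rightarrow> (nat \<Rightarrow> nat) \<Rightarrow> (nat \<Rightarrow> nat) \<Rightarrow> talg set" where
  "g_bar n \<mu> w =
     lprod (HH \<mu>) (map (\<lambda>i. hcls \<mu> (at_factor (blk \<mu> i) (gn (G (loc \<mu> i))))) (reduced_word n w))"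

text \<open>The linear form $\bigotimes_{a \in S} \tau^a_{\mu_a}$ on $\widehat H^\mu$, where \<open>\<mu> a = 0\<close>
  for \<open>a \<notin> S\<close>. It is defined by its values on pure tensors; as each \<open>\<tau> a (\<mu> a)\<close> vanishes on the
  relations, all the representatives \<open>y\<close> of \<open>z\<close> give the same value.\<close>

definition tensor_form ::
  "nat set \<Rightarrow> (nat \<Rightarrow> nat \<Rightarrow> falg set \<Rightarrow> laurent) \<Rightarrow> (nat \<Rightarrow> nat) \<Rightarrow> talg set \<Rightarrow> laurent" where
  "tensor_form S \<tau> \<mu> z = the_elem
     ((\<lambda>y. \<Sum>f \<in> Poly_Mapping.keys y. Poly_Mapping.lookup y f *
         (\<Prod>a\<in>S. \<tau> a (\<mu> a) (ycls 1 (\<mu> a) (Poly_Mapping.single (f a) 1)))) ` z)"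


section \<open>Characters\<close>

text \<open>A character of $(Z/dZ)^n$ is given by its values at $t_1,\dots,t_n$. Throughout, \<open>\<xi>\<close>
  enumerates the \<open>d\<close>-th roots of unity as \<open>\<xi> 1, \<dots>, \<xi> d\<close>.\<close>

type_synonym chr = "nat \<Rightarrow> complex"

definition Irr :: "nat \<Rightarrow> nat \<Rightarrow> chr set" where
  "Irr d n = {1..n} \<rightarrow>\<^sub>E {z. z ^ d = 1}"

definition comp_of :: "(nat \<Rightarrow> complex) \<Rightarrow> nat \<Rightarrow> nat \<Rightarrow> chr \<Rightarrow> nat \<Rightarrow> nat" where
  "comp_of \<xi> d n \<chi> = (\<lambda>a. if a \<in> {1..d} then card {j \<in> {1..n}. \<chi> j = \<xi> a} else 0)"

definition Irr_comp :: "(nat \<Rightarrow> complex) \<Rightarrow> nat \<Rightarrow> nat \<Rightarrow> (nat \<Rightarrow> nat) \<Rightarrow> chr set" where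
  "Irr_comp \<xi> d n \<mu> = {\<chi> \<in> Irr d n. comp_of \<xi> d n \<chi> = \<mu>}"

definition act :: "nat \<Rightarrow> (nat \<Rightarrow> nat) \<Rightarrow> chr \<Rightarrow> chr" where
  "act n w \<chi> = (\<lambda>i\<in>{1..n}. \<chi> (perm_inv w i))"

definition chi0 :: "(nat \<Rightarrow> complex) \<Rightarrow> nat \<Rightarrow> (nat \<Rightarrow> nat) \<Rightarrow> chr" where
  "chi0 \<xi> n \<mu> = (\<lambda>j\<in>{1..n}. \<xi> (blk \<mu> j))"

definition pi_chi :: "(nat \<Rightarrow> complex) \<Rightarrow> nat \<Rightarrow> nat \<Rightarrow> chr \<Rightarrow> nat \<Rightarrow> nat" where
  "pi_chi \<xi> d n \<chi> =
     arg_min (len n) (\<lambda>w. w permutes {1..n} \<and> act n w (chi0 \<xi> n (comp_of \<xi> d n \<chi>)) = \<chi>)"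

text \<open>The primitive idempotent
  $E_\chi = \prod_{j=1}^n \frac1d \sum_{s=0}^{d-1} \chi(t_j)^{-s} t_j^s$.\<close>

definition E_elt :: "nat \<Rightarrow> nat \<Rightarrow> chr \<Rightarrow> falg set" where
  "E_elt d n \<chi> = ycls d n (prod_list (map
     (\<lambda>j. scal (const_R (1 / of_nat d)) *
          (\<Sum>s<d. scal (const_R (inverse (\<chi> j) ^ s)) * gn (T j) ^ s))
     [1..<Suc n]))"


section \<open>The isomorphism with a direct sum of matrix algebras\<close>

definition mat_ring :: "'i set \<Rightarrow> ('a, 'b) ring_scheme \<Rightarrow> ('i \<Rightarrow> 'i \<Rightarrow> 'a) ring" where
  "mat_ring I A =
     \<lparr>carrier = I \<rightarrow>\<^sub>E (I \<rightarrow>\<^sub>E carrier A),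
      mult = (\<lambda>M N. \<lambda>i\<in>I. \<lambda>k\<in>I. finsum A (\<lambda>j. M i j \<otimes>\<^bsub>A\<^esub> N j k) I),
      one = (\<lambda>i\<in>I. \<lambda>k\<in>I. if i = k then \<one>\<^bsub>A\<^esub> else \<zero>\<^bsub>A\<^esub>),
      zero = (\<lambda>i\<in>I. \<lambda>k\<in>I. \<zero>\<^bsub>A\<^esub>),
      add = (\<lambda>M N. \<lambda>i\<in>I. \<lambda>k\<in>I. M i k \<oplus>\<^bsub>A\<^esub> N i k)\<rparr>"

text \<open>As \<open>K\<close> will be finite, the direct sum is the product.\<close>

definition sum_ring :: "'k set \<Rightarrow> ('k \<Rightarrow> ('a, 'b) ring_scheme) \<Rightarrow> ('k \<Rightarrow> 'a) ring" where
  "sum_ring K B =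
     \<lparr>carrier = (\<Pi>\<^sub>E k\<in>K. carrier (B k)),
      mult = (\<lambda>x y. \<lambda>k\<in>K. x k \<otimes>\<^bsub>B k\<^esub> y k),
      one = (\<lambda>k\<in>K. \<one>\<^bsub>B k\<^esub>),
      zero = (\<lambda>k\<in>K. \<zero>\<^bsub>B k\<^esub>),
      add = (\<lambda>x y. \<lambda>k\<in>K. x k \<oplus>\<^bsub>B k\<^esub> y k)\<rparr>"

type_synonym mats = "(nat \<Rightarrow> nat) \<Rightarrow> chr \<Rightarrow> chr \<Rightarrow> talg set"

definition mat_sum :: "(nat \<Rightarrow> complex) \<Rightarrow> nat \<Rightarrow> nat \<Rightarrow> mats ring" where
  "mat_sum \<xi> d n = sum_ring (comps d n) (\<lambda>\<mu>. mat_ring (Irr_comp \<xi> d n \<mu>) (HH \<mu>))"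

text \<open>The element \<open>h\<close> at position \<open>(\<chi>, \<chi>')\<close> of the matrix for the composition of \<open>\<chi>\<close>, and 0
  everywhere else.\<close>

definition mat_unit :: "(nat \<Rightarrow> complex) \<Rightarrow> nat \<Rightarrow> nat \<Rightarrow> chr \<Rightarrow> chr \<Rightarrow> talg set \<Rightarrow> mats" where
  "mat_unit \<xi> d n \<chi> \<chi>' h = (\<lambda>\<mu>\<in>comps d n. \<lambda>\<alpha>\<in>Irr_comp \<xi> d n \<mu>. \<lambda>\<beta>\<in>Irr_comp \<xi> d n \<mu>.
     if \<alpha> = \<chi> \<and> \<beta> = \<chi>' then h else \<zero>\<^bsub>HH \<mu>\<^esub>)"

text \<open>The image of $E_\chi X^\lambda g_{w^{-1}}$.\<close>

definition Psi_val ::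
  "(nat \<Rightarrow> complex) \<Rightarrow> nat \<Rightarrow> nat \<Rightarrow> chr \<Rightarrow> (nat \<Rightarrow> int) \<Rightarrow> (nat \<Rightarrow> nat) \<Rightarrow> mats" where
  "Psi_val \<xi> d n \<chi> lam w =
     (let \<mu> = comp_of \<xi> d n \<chi>;
          \<pi> = pi_chi \<xi> d n \<chi>;
          \<sigma> = perm_inv \<pi> \<circ> perm_inv w \<circ> pi_chi \<xi> d n (act n w \<chi>)
      in mat_unit \<xi> d n \<chi> (act n w \<chi>)
           (hcls \<mu> (scal (u_pow (int (len n (perm_inv w)) - int (len n \<sigma>)))) \<otimes>\<^bsub>HH \<mu>\<^esub>
            (lprod (HH \<mu>) (map (\<lambda>j. X_bar \<mu> (perm_inv \<pi> j) [^]\<^bsub>HH \<mu>\<^esub> lam j) [1..<Suc n])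
             \<otimes>\<^bsub>HH \<mu>\<^esub> g_bar n \<mu> \<sigma>)))"

text \<open>\<open>\<Psi>\<close> is the algebra isomorphism given by this formula. It is unique on
  $\widehat Y_{d,n}$, because the elements $E_\chi X^\lambda g_{w^{-1}}$ generate this algebra.\<close>

definition is_Psi ::
  "(nat \<Rightarrow> complex) \<Rightarrow> nat \<Rightarrow> nat \<Rightarrow> (falg set \<Rightarrow> mats) \<Rightarrow> bool" where
  "is_Psi \<xi> d n \<Psi> \<longleftrightarrow>
     \<Psi> \<in> ring_iso (YH d n) (mat_sum \<xi> d n) \<and>
     (\<forall>c. \<forall>x \<in> carrier (YH d n). \<forall>\<mu> \<in> comps d n.
        \<forall>\<alpha> \<in> Irr_comp \<xi> d n \<mu>. \<forall>\<beta> \<in> Irr_comp \<xi> d n \<mu>.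
          \<Psi> (ycls d n (scal c) \<otimes>\<^bsub>YH d n\<^esub> x) \<mu> \<alpha> \<beta> = hcls \<mu> (scal c) \<otimes>\<^bsub>HH \<mu>\<^esub> \<Psi> x \<mu> \<alpha> \<beta>) \<and>
     (\<forall>\<chi> \<in> Irr d n. \<forall>lam w. w permutes {1..n} \<longrightarrow>
        \<Psi> (E_elt d n \<chi> \<otimes>\<^bsub>YH d n\<^esub> (X_mon d n lam \<otimes>\<^bsub>YH d n\<^esub> g_elt d n (perm_inv w)))
          = Psi_val \<xi> d n \<chi> lam w)"


section \<open>Basic Markov traces\<close>

text \<open>\<open>basic_trace \<xi> \<Psi> d S \<tau>\<close> is $\{\rho_{d,n}^{S,\tau}\}_n$, where \<open>\<xi> d\<close> enumerates the \<open>d\<close>-th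
  roots of unity and \<open>\<Psi> d n\<close> is the isomorphism $\Psi_{d,n}$.\<close>

definition basic_trace ::
  "(nat \<Rightarrow> nat \<Rightarrow> complex) \<Rightarrow> (nat \<Rightarrow> nat \<Rightarrow> falg set \<Rightarrow> mats) \<Rightarrow> nat \<Rightarrow> nat set
    \<Rightarrow> (nat \<Rightarrow> nat \<Rightarrow> falg set \<Rightarrow> laurent) \<Rightarrow> nat \<Rightarrow> falg set \<Rightarrow> laurent" where
  "basic_trace \<xi> \<Psi> d S \<tau> n x =
     (\<Sum>\<mu> \<in> {\<mu> \<in> comps d n. \<forall>a \<in> {1..d}. \<mu> a \<noteq> 0 \<longleftrightarrow> a \<in> S}.
        tensor_form S \<tau> \<mu> (finsum (HH \<mu>) (\<lambda>\<chi>. \<Psi> d n x \<mu> \<chi> \<chi>) (Irr_comp (\<xi> d) d n \<mu>)))"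

definition in_basic_span ::
  "(nat \<Rightarrow> nat \<Rightarrow> complex) \<Rightarrow> (nat \<Rightarrow> nat \<Rightarrow> falg set \<Rightarrow> mats) \<Rightarrow> nat
    \<Rightarrow> (nat \<Rightarrow> falg set \<Rightarrow> laurent) \<Rightarrow> bool" where
  "in_basic_span \<xi> \<Psi> d \<rho> \<longleftrightarrow>
     lin_comb_on {(n, x). n \<ge> 1 \<and> x \<in> carrier (YH d n)}
       {case_prod (basic_trace \<xi> \<Psi> d S \<tau>) | S \<tau>.
          S \<noteq> {} \<and> S \<subseteq> {1..d} \<and> (\<forall>a\<in>S. markov_trace 1 (\<tau> a))}
       (case_prod \<rho>)"


section \<open>Braids and link invariants\<close>

text \<open>A framed affine braid on \<open>n\<close> strands is represented by a word in the generators
  \<open>Sig i\<close> (that is $\sigma_i$) and \<open>Frm j\<close> (that is $t_j$) and their inverses, the boolean being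
  \<open>False\<close> for an inverse. The map $\delta_{d,n}$ and the permutation of a braid are compatible
  with the relations, so a function of braids (or of links) is treated as a function of all the
  words representing them.\<close>

datatype bgen = Sig nat | Frm nat

type_synonym bword = "(bgen \<times> bool) list"

definition affine_words :: "nat \<Rightarrow> bword set" where
  "affine_words n = lists (Sig ` {0..<n} \<times> UNIV)"

definition classical_words :: "nat \<Rightarrow> bword set" where
  "classical_words n = lists (Sig ` {1..<n} \<times> UNIV)"

fun bgen_perm :: "bgen \<Rightarrow> nat \<Rightarrow> nat" where
  "bgen_perm (Sig i) = (if i = 0 then id else transpose i (Suc i))"
| "bgen_perm (Frm j) = id"

definition bword_perm :: "bword \<Rightarrow> nat \<Rightarrow> nat" where
  "bword_perm \<beta> =
     foldr (\<lambda>(a, pos) p. (if pos then bgen_perm a else perm_inv (bgen_perm a)) \<circ> p) \<beta> id"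

definition components :: "nat \<Rightarrow> bword \<Rightarrow> nat" where
  "components n \<beta> = card (orbit (bword_perm \<beta>) ` {1..n})"

text \<open>Non-framed links with \<open>N\<close> components in the solid torus, and classical ones, as closures of
  braids; the pair \<open>(n, \<beta>)\<close> is a braid on \<open>n\<close> strands.\<close>

definition affine_links :: "nat \<Rightarrow> (nat \<times> bword) set" where
  "affine_links N = {(n, \<beta>). n \<ge> 1 \<and> \<beta> \<in> affine_words n \<and> components n \<beta> = N}"

definition classical_links :: "nat \<Rightarrow> (nat \<times> bword) set" where
  "classical_links N = {(n, \<beta>). n \<ge> 1 \<and> \<beta> \<in> classical_words n \<and> components n \<beta> = N}"

fun delta_gen :: "nat \<Rightarrow> bgen \<Rightarrow> falg" where
  "delta_gen d (Sig i) =
     (if i = 0 then gn X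
      else (scal gamma_ind + scal (1 - gamma_ind) * e_elt d i) * gn (G i))"
| "delta_gen d (Frm j) = gn (T j)"

definition delta :: "nat \<Rightarrow> nat \<Rightarrow> bword \<Rightarrow> falg set" where
  "delta d n \<beta> = lprod (YH d n)
     (map (\<lambda>(a, pos). if pos then ycls d n (delta_gen d a)
                      else inv\<^bsub>YH d n\<^esub> ycls d n (delta_gen d a)) \<beta>)"

definition link_inv :: "nat \<Rightarrow> (nat \<Rightarrow> falg set \<Rightarrow> laurent) \<Rightarrow> nat \<times> bword \<Rightarrow> laurent" where
  "link_inv d \<rho> = (\<lambda>(n, \<beta>). \<rho> n (delta d n \<beta>))"

text \<open>The basic invariants $P_L^{k,\{1,\dots,k\},\tau}$ for \<open>1 \<le> k \<le> N\<close>, where \<open>\<tau>\<close> ranges over the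
  choices of \<open>k\<close> Markov traces on the affine Hecke algebras.\<close>

definition basic_invs ::
  "(nat \<Rightarrow> nat \<Rightarrow> complex) \<Rightarrow> (nat \<Rightarrow> nat \<Rightarrow> falg set \<Rightarrow> mats) \<Rightarrow> nat
    \<Rightarrow> (nat \<times> bword \<Rightarrow> laurent) set" where
  "basic_invs \<xi> \<Psi> N =
     {link_inv k (basic_trace \<xi> \<Psi> k {1..k} \<tau>) | k \<tau>.
        1 \<le> k \<and> k \<le> N \<and> (\<forall>a\<in>{1..k}. markov_trace 1 (\<tau> a))}"

end

theory Submission
  imports Defs "HOL-Library.Infinite_Set"
begin

text \<open>Let \<open>\<beta>\<close> be a braid word on \<open>n\<close> strands without framings and let \<open>b\<close> be its permutation. Under
  $\Psi_{d,n}$ the generators $X_1$ and $g_i$ and the idempotent $e_i$ become monomial matrices: the row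
  of a character \<open>\<chi>\<close> has at most one non-zero entry, in the column \<open>\<chi>\<close> for $X_1$ and $e_i$, and in the
  column $s_i(\chi)$ for $g_i$. Monomial matrices are closed under products and, where they exist,
  inverses, so the image of $\delta(\beta)$ is monomial as well, its row \<open>\<chi>\<close> being concentrated in the
  column \<open>\<chi> \<circ> b\<close> (\<open>delta_relabel\<close>).

  Consequently \<open>\<chi>\<close> contributes to the trace of this matrix only if it is constant on the cycles of
  \<open>b\<close>, and such a character takes at most \<open>N\<close> values when the closure of \<open>\<beta>\<close> has \<open>N\<close> components. The
  basic trace of \<open>S\<close> only sees the characters that take exactly the values $\xi_a$ with \<open>a \<in> S\<close>.
  Hence its invariant vanishes on links with fewer than $|S|$ components (\<open>link_inv_vanish\<close>).

  Let now $k = |S| \leq N$ and let \<open>p\<close> be the increasing bijection from $\{1,\dots,k\}$ to \<open>S\<close>. Replacing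
  the root of unity number \<open>p b\<close> of order \<open>d\<close> by the root number \<open>b\<close> of order \<open>k\<close> turns the characters
  that matter for \<open>d\<close> and \<open>S\<close> into those that matter for \<open>k\<close> and $\{1,\dots,k\}$, a composition \<open>\<mu>\<close>
  into \<open>\<mu> \<circ> p\<close>, and $\widehat H^{\mu}$ into $\widehat H^{\mu \circ p}$ by a permutation of the tensor
  factors. Everything in the formula for $\Psi$ is compatible with this. The blocks of \<open>\<mu>\<close> and of
  \<open>\<mu> \<circ> p\<close> are the same intervals because \<open>p\<close> is increasing; the permutation $\pi_\chi$ is chosen
  among the solutions of an equation between characters that does not change under relabelling; and
  $e_i$ only asks whether \<open>\<chi>\<close> takes the same value at \<open>i\<close> and at \<open>i + 1\<close>. So the basic invariant of
  \<open>d\<close>, \<open>S\<close>, \<open>\<tau>\<close> equals that of \<open>k\<close>, $\{1,\dots,k\}$, \<open>\<tau> \<circ> p\<close> (\<open>link_inv_relabel\<close>), which is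
  one of the listed invariants. Linearity gives the theorem (\<open>lin_comb_basic\<close>).\<close>

section \<open>Monoid algebras and their quotients\<close>

lemma poly_mapping_expansion:
  "x = (\<Sum>k\<in>Poly_Mapping.keys x. Poly_Mapping.single k (Poly_Mapping.lookup x k))"
  by (rule poly_mapping_eqI)
    (auto simp: lookup_sum lookup_single when_def in_keys_iff sum.delta if_distrib cong: if_cong)

lemma poly_mapping_single_add_induct:
  fixes x :: "'a \<Rightarrow>\<^sub>0 'b::comm_monoid_add"
  assumes single: "\<And>k c. k \<in> Poly_Mapping.keys x \<Longrightarrow> P (Poly_Mapping.single k c)"
    and plus: "\<And>y z. P y \<Longrightarrow> P z \<Longrightarrow> P (y + z)" and zero: "P 0"
  shows "P x"
proof -
  have "P (\<Sum>k\<in>K. Poly_Mapping.single k (Poly_Mapping.lookup x k))"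
    if "finite K" "K \<subseteq> Poly_Mapping.keys x" for K
    using that by (induction K rule: finite_induct) (auto intro: zero plus single)
  from this[OF finite_keys order_refl] show ?thesis
    by (simp flip: poly_mapping_expansion)
qed

lemma scal_central: "scal c * x = x * scal c"
  unfolding scal_def
  by (rule poly_mapping_single_add_induct[of x])
    (simp_all add: mult_single algebra_simps)

lemma scal_mult: "scal c * scal c' = scal (c * c')"
  by (simp add: scal_def mult_single)

lemma scal_add: "scal c + scal c' = scal (c + c')"
  by (simp add: scal_def single_add)

lemma scal_1 [simp]: "scal 1 = 1"
  by (simp add: scal_def single_one)

lemma scal_0 [simp]: "scal 0 = 0"
  by (simp add: scal_def)

text \<open>An algebra given by generators and relations; the monoid \<open>M\<close> consists of words or families of words.
  The algebras $\widehat Y_{d,n}$ and $\widehat H^{\mu}$ are both of this kind.\<close>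

locale presented_algebra =
  fixes M :: "'m::monoid_add set" and Q :: "('m \<Rightarrow>\<^sub>0 laurent) set"
  assumes zero_M: "0 \<in> M" and plus_M: "\<And>a b. a \<in> M \<Longrightarrow> b \<in> M \<Longrightarrow> a + b \<in> M"
    and Q_subset: "Q \<subseteq> carrier (malg M)"
begin

lemma carrier_malg_iff: "x \<in> carrier (malg M) \<longleftrightarrow> Poly_Mapping.keys x \<subseteq> M"
  by (simp add: malg_def)

lemma malg_simps [simp]:
  "x \<otimes>\<^bsub>malg M\<^esub> y = x * y" "x \<oplus>\<^bsub>malg M\<^esub> y = x + y" "\<one>\<^bsub>malg M\<^esub> = 1" "\<zero>\<^bsub>malg M\<^esub> = 0"
  by (simp_all add: malg_def)

lemma malg_single [simp]: "k \<in> M \<Longrightarrow> Poly_Mapping.single k c \<in> carrier (malg M)"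
  by (simp add: carrier_malg_iff)

lemma malg_scal [simp]: "scal c \<in> carrier (malg M)"
  by (simp add: scal_def zero_M)

lemma malg_zero [simp]: "0 \<in> carrier (malg M)" and malg_one [simp]: "1 \<in> carrier (malg M)"
  by (simp_all add: carrier_malg_iff zero_M)

lemma malg_add [simp]:
  "x \<in> carrier (malg M) \<Longrightarrow> y \<in> carrier (malg M) \<Longrightarrow> x + y \<in> carrier (malg M)"
  using keys_add[of x y] by (auto simp: carrier_malg_iff)

lemma malg_uminus [simp]: "x \<in> carrier (malg M) \<Longrightarrow> - x \<in> carrier (malg M)"
  by (auto simp: carrier_malg_iff in_keys_iff)

lemma malg_diff [simp]:
  "x \<in> carrier (malg M) \<Longrightarrow> y \<in> carrier (malg M) \<Longrightarrow> x - y \<in> carrier (malg M)"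
  using malg_add[of x "- y"] by simp

lemma malg_mult [simp]:
  "x \<in> carrier (malg M) \<Longrightarrow> y \<in> carrier (malg M) \<Longrightarrow> x * y \<in> carrier (malg M)"
  using keys_mult[of x y] plus_M by (fastforce simp: carrier_malg_iff)

lemma malg_power [simp]: "x \<in> carrier (malg M) \<Longrightarrow> x ^ k \<in> carrier (malg M)"
  by (induction k) simp_all

lemma malg_sum [simp]:
  "(\<And>a. a \<in> K \<Longrightarrow> f a \<in> carrier (malg M)) \<Longrightarrow> (\<Sum>a\<in>K. f a) \<in> carrier (malg M)"
  by (induction K rule: infinite_finite_induct) simp_all

lemma malg_prod_list [simp]:
  "(\<And>a. a \<in> set xs \<Longrightarrow> f a \<in> carrier (malg M)) \<Longrightarrow> prod_list (map f xs) \<in> carrier (malg M)"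
  by (induction xs) simp_all

sublocale malg: ring "malg M"
proof (rule ringI)
  show "abelian_group (malg M)"
  proof (rule abelian_groupI)
    fix x assume "x \<in> carrier (malg M)"
    then show "\<exists>y\<in>carrier (malg M). y \<oplus>\<^bsub>malg M\<^esub> x = \<zero>\<^bsub>malg M\<^esub>"
      by (intro bexI[of _ "- x"]) simp_all
  qed (simp_all add: algebra_simps)
  show "Group.monoid (malg M)"
    by (rule monoidI) (simp_all add: mult.assoc)
qed (simp_all add: algebra_simps)

abbreviation "relators \<equiv> genideal (malg M) Q"

lemma relators_ideal: "ideal relators (malg M)"
  by (rule malg.genideal_ideal[OF Q_subset])

sublocale palg: ring "palg M Q"
  unfolding palg_def by (rule ideal.quotient_is_ring[OF relators_ideal])

lemma pcls_hom: "pcls M Q \<in> ring_hom (malg M) (palg M Q)"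
  unfolding palg_def pcls_def by (rule ideal.rcos_ring_hom[OF relators_ideal])

lemma pcls_closed [simp]: "x \<in> carrier (malg M) \<Longrightarrow> pcls M Q x \<in> carrier (palg M Q)"
  using ring_hom_closed[OF pcls_hom] .

lemma pcls_mult:
  "x \<in> carrier (malg M) \<Longrightarrow> y \<in> carrier (malg M)
    \<Longrightarrow> pcls M Q (x * y) = pcls M Q x \<otimes>\<^bsub>palg M Q\<^esub> pcls M Q y"
  using ring_hom_mult[OF pcls_hom] by simp

lemma pcls_add:
  "x \<in> carrier (malg M) \<Longrightarrow> y \<in> carrier (malg M)
    \<Longrightarrow> pcls M Q (x + y) = pcls M Q x \<oplus>\<^bsub>palg M Q\<^esub> pcls M Q y"
  using ring_hom_add[OF pcls_hom] by simp

lemma pcls_one: "pcls M Q 1 = \<one>\<^bsub>palg M Q\<^esub>"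
  using ring_hom_one[OF pcls_hom] by simp

lemma pcls_zero: "pcls M Q 0 = \<zero>\<^bsub>palg M Q\<^esub>"
  using ring_hom_zero[OF pcls_hom malg.ring_axioms palg.ring_axioms] by simp

lemma carrier_palg: "carrier (palg M Q) = pcls M Q ` carrier (malg M)"
  by (auto simp: palg_def pcls_def FactRing_def A_RCOSETS_def RCOSETS_def a_r_coset_def)

lemma malg_minus: "x \<in> carrier (malg M) \<Longrightarrow> y \<in> carrier (malg M) \<Longrightarrow> x \<ominus>\<^bsub>malg M\<^esub> y = x - y"
proof -
  assume "x \<in> carrier (malg M)" "y \<in> carrier (malg M)"
  moreover from this have "\<ominus>\<^bsub>malg M\<^esub> y = - y"
    by (intro malg.minus_equality) simp_all
  ultimately show ?thesis
    by (simp add: a_minus_def)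
qed

lemma pcls_eq_iff:
  "x \<in> carrier (malg M) \<Longrightarrow> y \<in> carrier (malg M)
    \<Longrightarrow> pcls M Q x = pcls M Q y \<longleftrightarrow> x - y \<in> relators"
  unfolding pcls_def
  using malg.quotient_eq_iff_same_a_r_cos[OF relators_ideal] by (simp add: malg_minus)

lemma pcls_relation: 
  assumes "x - y \<in> Q" "x \<in> carrier (malg M)" "y \<in> carrier (malg M)"
  shows "pcls M Q x = pcls M Q y"
  using assms malg.genideal_self[OF Q_subset] by (auto simp: pcls_eq_iff)

end

section \<open>Transport along an isomorphism of monoids\<close>

text \<open>The linear map of monoid algebras induced by \<open>h\<close>. Both the embedding of a tensor factor and the
  permutation of the tensor factors have this form, so their composite is computed on words.\<close>

definition push :: "('m \<Rightarrow> 'n) \<Rightarrow> ('m \<Rightarrow>\<^sub>0 laurent) \<Rightarrow> ('n \<Rightarrow>\<^sub>0 laurent)" where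
  "push h x = (\<Sum>w\<in>Poly_Mapping.keys x. Poly_Mapping.single (h w) (Poly_Mapping.lookup x w))"

lemma push_zero [simp]: "push h 0 = 0"
  by (simp add: push_def)

lemma push_single [simp]: "push h (Poly_Mapping.single k c) = Poly_Mapping.single (h k) c"
  by (simp add: push_def)

lemma push_add: "push h (x + y) = push h x + push h y"
  unfolding push_def
  by (rule setsum_keys_plus_distrib) (simp_all add: single_add)

lemma push_diff: "push h (x - y) = push h x - push h y"
  using push_add[of h "x - y" y] by (simp add: algebra_simps)

lemma push_sum: "push h (\<Sum>a\<in>K. f a) = (\<Sum>a\<in>K. push h (f a))"
  by (induction K rule: infinite_finite_induct) (simp_all add: push_add)

lemma push_push: "push h (push h' x) = push (h \<circ> h') x"
  by (simp add: push_def[of h' x] push_def[of "h \<circ> h'" x] push_sum)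

lemma push_id [simp]: "push id x = x"
  by (simp add: push_def flip: poly_mapping_expansion)

lemma push_mult:
  assumes "\<And>a b. h (a + b) = h a + h b"
  shows "push h (x * y) = push h x * push h y"
proof -
  have 1: "push h (Poly_Mapping.single k c * y) = push h (Poly_Mapping.single k c) * push h y" for k c
    by (rule poly_mapping_single_add_induct[of y])
      (simp_all add: mult_single assms distrib_left push_add)
  show ?thesis
    by (rule poly_mapping_single_add_induct[of x]) (simp_all add: 1 distrib_right push_add)
qed

lemma keys_push: "Poly_Mapping.keys (push h x) \<subseteq> h ` Poly_Mapping.keys x"
proof
  fix k assume "k \<in> Poly_Mapping.keys (push h x)"
  then have "(\<Sum>w\<in>Poly_Mapping.keys x.
      Poly_Mapping.lookup (Poly_Mapping.single (h w) (Poly_Mapping.lookup x w)) k) \<noteq> 0"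
    by (simp add: in_keys_iff push_def lookup_sum)
  then show "k \<in> h ` Poly_Mapping.keys x"
    by (rule contrapos_np) (auto intro!: sum.neutral simp: lookup_single when_def)
qed

lemma at_factor_eq_push: "at_factor a = push (\<lambda>w. (\<lambda>_. [])(a := w))"
  by (simp add: fun_eq_iff at_factor_def push_def)

lemma push_scal [simp]: "h 0 = 0 \<Longrightarrow> push h (scal c) = scal c"
  by (simp add: scal_def)

text \<open>An isomorphism of monoids that matches the relators induces an isomorphism of the quotients. It is
  taken in the form \<open>(`) (push h)\<close>, the image of a coset under a bijection of the ambient ring: in
  this form it respects products and sums of arbitrary subsets, and the elements $\overline g_w$,
  which are products of classes, can be transported letter by letter without membership conditions.\<close>

locale algebra_transport =
  source: presented_algebra M Q + target: presented_algebra M' Q'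
  for M :: "'m::monoid_add set" and Q and M' :: "'n::monoid_add set" and Q' +
  fixes h :: "'m \<Rightarrow> 'n" and h' :: "'n \<Rightarrow> 'm"
  assumes h_zero: "h 0 = 0" and h_plus: "\<And>a b. h (a + b) = h a + h b"
    and h_inverse: "\<And>a. h' (h a) = a" "\<And>b. h (h' b) = b"
    and h_M: "h ` M = M'" and h_Q: "push h ` Q = Q'"
begin

lemma push_inverse [simp]: "push h' (push h x) = x" "push h (push h' y) = y"
  using h_inverse by (simp_all add: push_push comp_def flip: id_def)

lemma push_mult_h: "push h (x * y) = push h x * push h y"
  using push_mult h_plus by blast

lemma push_h_one [simp]: "push h 1 = 1"
  by (simp add: h_zero flip: single_one)

lemma push_carrier: "x \<in> carrier (malg M) \<Longrightarrow> push h x \<in> carrier (malg M')"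
  using keys_push[of h x] image_mono[of "Poly_Mapping.keys x" M h] h_M
  by (simp add: source.carrier_malg_iff target.carrier_malg_iff)

text \<open>The elements that \<open>push h\<close> sends to relators of the target form an ideal that contains \<open>Q\<close>, and
  the ideal generated by \<open>Q\<close> is the smallest one. The converse inclusion is this one for \<open>h'\<close>.\<close>

lemma push_relators_subset: "push h ` source.relators \<subseteq> target.relators"
proof -
  interpret target_ideal: ideal target.relators "malg M'"
    by (rule target.relators_ideal)
  let ?J = "{x \<in> carrier (malg M). push h x \<in> target.relators}"
  have "ideal ?J (malg M)"
  proof (rule idealI[OF source.malg.ring_axioms])
    show "subgroup ?J (add_monoid (malg M))"
    proof (rule source.malg.add.subgroupI)
      show "?J \<noteq> {}"
        using target_ideal.zero_closed by (auto intro!: exI[of _ 0])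
    next
      fix x assume x: "x \<in> ?J"
      then have "\<ominus>\<^bsub>malg M'\<^esub> push h x \<in> target.relators"
        using target_ideal.a_inv_closed by auto
      moreover have "\<ominus>\<^bsub>malg M'\<^esub> push h x = push h (\<ominus>\<^bsub>malg M\<^esub> x)"
      proof -
        have "\<ominus>\<^bsub>malg M\<^esub> x = - x" "\<ominus>\<^bsub>malg M'\<^esub> push h x = - push h x"
          using x push_carrier by (auto intro!: source.malg.minus_equality target.malg.minus_equality)
        then show ?thesis
          using push_diff[of h 0 x] by simp
      qed
      ultimately show "\<ominus>\<^bsub>malg M\<^esub> x \<in> ?J"
        using x by auto
    next
      fix x y assume "x \<in> ?J" "y \<in> ?J"
      then show "x \<oplus>\<^bsub>malg M\<^esub> y \<in> ?J"
        using target_ideal.a_closed by (auto simp: push_add)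
    qed auto
  next
    fix a x assume "a \<in> ?J" "x \<in> carrier (malg M)"
    then show "x \<otimes>\<^bsub>malg M\<^esub> a \<in> ?J" "a \<otimes>\<^bsub>malg M\<^esub> x \<in> ?J"
      using target_ideal.I_l_closed[of "push h a" "push h x"] target_ideal.I_r_closed[of "push h a" "push h x"]
      by (auto simp: push_mult_h push_carrier)
  qed
  moreover have "Q \<subseteq> ?J"
    using source.Q_subset h_Q target.malg.genideal_self[OF target.Q_subset] by auto
  ultimately have "source.relators \<subseteq> ?J"
    by (rule source.malg.genideal_minimal)
  then show ?thesis by auto
qed

lemma inverse_transport: "algebra_transport M' Q' M Q h' h"
proof
  show "h' 0 = 0" using h_zero h_inverse by metis
  show "h' (a + b) = h' a + h' b" for a b using h_plus h_inverse by metis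
  show "h' ` M' = M" by (simp add: image_image h_inverse flip: h_M)
  have "push h' ` push h ` Q = Q" by (simp add: image_image)
  then show "push h' ` Q' = Q" using h_Q by simp
qed (simp_all add: h_inverse)

lemma push_relators: "push h ` source.relators = target.relators"
proof
  show "target.relators \<subseteq> push h ` source.relators"
  proof
    fix y assume "y \<in> target.relators"
    then have "push h' y \<in> source.relators"
      using algebra_transport.push_relators_subset[OF inverse_transport] by blast
    then show "y \<in> push h ` source.relators"
      by (metis image_eqI push_inverse(2))
  qed
qed (rule push_relators_subset)

lemma transport_coset:
  "push h ` (source.relators +>\<^bsub>malg M\<^esub> x) = target.relators +>\<^bsub>malg M'\<^esub> push h x"
  by (auto simp: a_r_coset_def r_coset_def image_UN push_add simp flip: push_relators)

lemma transport_pcls: "push h ` pcls M Q x = pcls M' Q' (push h x)"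
  unfolding pcls_def by (rule transport_coset)

lemma transport_mult:
  "push h ` (A \<otimes>\<^bsub>palg M Q\<^esub> B) = (push h ` A) \<otimes>\<^bsub>palg M' Q'\<^esub> (push h ` B)"
  by (simp add: palg_def FactRing_def rcoset_mult_def image_UN transport_coset push_mult_h)

lemma transport_add:
  "push h ` (A \<oplus>\<^bsub>palg M Q\<^esub> B) = (push h ` A) \<oplus>\<^bsub>palg M' Q'\<^esub> (push h ` B)"
  by (auto simp: palg_def FactRing_def set_add_def' image_UN push_add)

lemma transport_one: "push h ` \<one>\<^bsub>palg M Q\<^esub> = \<one>\<^bsub>palg M' Q'\<^esub>"
  by (simp add: transport_pcls flip: source.pcls_one target.pcls_one)

lemma transport_zero: "push h ` \<zero>\<^bsub>palg M Q\<^esub> = \<zero>\<^bsub>palg M' Q'\<^esub>"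
  by (simp add: transport_pcls flip: source.pcls_zero target.pcls_zero)

lemma transport_closed: "A \<in> carrier (palg M Q) \<Longrightarrow> push h ` A \<in> carrier (palg M' Q')"
  by (auto simp: source.carrier_palg transport_pcls push_carrier)

lemma transport_lprod:
  "push h ` lprod (palg M Q) xs = lprod (palg M' Q') (map ((`) (push h)) xs)"
  by (induction xs) (simp_all add: lprod_def transport_one transport_mult)

lemma transport_pow: "push h ` (A [^]\<^bsub>palg M Q\<^esub> (k::nat)) = (push h ` A) [^]\<^bsub>palg M' Q'\<^esub> k"
  by (induction k) (simp_all add: nat_pow_def transport_one transport_mult)

lemma transport_finsum:
  assumes "finite K" "\<And>a. a \<in> K \<Longrightarrow> f a \<in> carrier (palg M Q)"
  shows "push h ` finsum (palg M Q) f K = finsum (palg M' Q') (\<lambda>a. push h ` f a) K"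
  using assms
proof (induction K rule: finite_induct)
  case (insert a K)
  then show ?case
    by (subst source.palg.finsum_insert)
      (auto simp: transport_add transport_closed target.palg.finsum_insert Pi_def)
qed (simp add: transport_zero)

end

section \<open>Words for permutations\<close>

lemma perm_of_word_simps [simp]:
  "perm_of_word [] = id" "perm_of_word (i # ks) = transpose i (Suc i) \<circ> perm_of_word ks"
  by (simp_all add: perm_of_word_def)

lemma perm_of_word_append: "perm_of_word (ks @ js) = perm_of_word ks \<circ> perm_of_word js"
  by (induction ks) (simp_all add: comp_assoc)

text \<open>By induction on \<open>b\<close>, as $(a, b+1)$ is the conjugate of $(a,b)$ by $s_b$.\<close>

lemma transpose_has_word:
  assumes "1 \<le> a" "a < b" "b \<le> n"
  shows "\<exists>ks. set ks \<subseteq> {1..<n} \<and> perm_of_word ks = transpose a b"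
  using assms(2,3)
proof (induction b)
  case (Suc b)
  show ?case
  proof (cases "a = b")
    case True
    with Suc.prems assms(1) show ?thesis
      by (intro exI[of _ "[b]"]) auto
  next
    case False
    with Suc obtain ks where ks: "set ks \<subseteq> {1..<n}" "perm_of_word ks = transpose a b"
      by auto
    have "transpose b (Suc b) \<circ> transpose a b \<circ> transpose b (Suc b) = transpose a (Suc b)"
      using False Suc.prems transpose_comp_triple[of "Suc b" a b]
      by (simp add: transpose_commute)
    then show ?thesis
      using ks Suc.prems assms(1) False
      by (intro exI[of _ "[b] @ ks @ [b]"]) (auto simp: perm_of_word_append comp_assoc)
  qed
qed simp

text \<open>Without the existence of a word neither \<open>len\<close> nor \<open>reduced_word\<close> would have a known value.\<close>

lemma permutes_has_word:
  assumes "w permutes {1..n}"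
  shows "\<exists>ks. set ks \<subseteq> {1..<n} \<and> perm_of_word ks = w"
  using assms finite_atLeastAtMost
proof (induction rule: permutes_induct)
  case id
  then show ?case by (intro exI[of _ "[]"]) auto
next
  case (swap a b p)
  obtain ks where ks: "set ks \<subseteq> {1..<n}" "perm_of_word ks = p"
    using swap by auto
  have "\<exists>js. set js \<subseteq> {1..<n} \<and> perm_of_word js = transpose a b"
    using swap transpose_has_word[of a b n] transpose_has_word[of b a n]
    by (cases a b rule: linorder_cases) (auto simp: transpose_commute)
  with ks show ?case
    by (metis Un_least perm_of_word_append set_append)
qed

lemma reduced_word:
  assumes "w permutes {1..n}"
  shows "set (reduced_word n w) \<subseteq> {1..<n}" "perm_of_word (reduced_word n w) = w"
    "length (reduced_word n w) = len n w"
proof -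
  have "\<exists>ks. set ks \<subseteq> {1..<n} \<and> length ks = len n w \<and> perm_of_word ks = w"
    unfolding len_def by (rule LeastI_ex) (use permutes_has_word[OF assms] in blast)
  from someI_ex[OF this, folded reduced_word_def]
  show "set (reduced_word n w) \<subseteq> {1..<n}" "perm_of_word (reduced_word n w) = w"
    "length (reduced_word n w) = len n w" by simp_all
qed

lemma len_le: "set ks \<subseteq> {1..<n} \<Longrightarrow> len n (perm_of_word ks) \<le> length ks"
  unfolding len_def by (rule Least_le) blast

lemma len_id [simp]: "len n id = 0" and reduced_word_id [simp]: "reduced_word n id = []"
proof -
  show "len n id = 0" using len_le[of "[]" n] by simp
  then show "reduced_word n id = []" using reduced_word(3)[of id n] by (simp add: permutes_id)
qed

lemma transpose_Suc_permutes: "i \<in> {1..<n} \<Longrightarrow> transpose i (Suc i) permutes {1..n}"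
  by (rule permutes_swap_id) auto

lemma reduced_word_transpose:
  assumes "i \<in> {1..<n}"
  shows "reduced_word n (transpose i (Suc i)) = [i]"
proof -
  let ?w = "reduced_word n (transpose i (Suc i))"
  note rw = reduced_word[OF transpose_Suc_permutes[OF assms]]
  have "length ?w \<le> 1"
    using rw(3) len_le[of "[i]" n] assms by auto
  then consider "?w = []" | j where "?w = [j]"
    by (cases ?w) auto
  then show ?thesis
  proof cases
    case 1
    then have "id i = transpose i (Suc i) i" using rw(2) by simp
    then show ?thesis by simp
  next
    case (2 j)
    then have eq: "transpose j (Suc j) = transpose i (Suc i)" using rw(2) by simp
    have "transpose j (Suc j) i = Suc i" using eq by simp
    then have "j = i" by (cases "i = j"; cases "i = Suc j") simp_all
    with 2 show ?thesis by simp
  qed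
qed

section \<open>Characters\<close>

text \<open>The action of \<open>b\<close> on characters from the right: rows are moved along a product of braid generators
  in the order in which the product is read (\<open>pull_pull\<close>), whereas \<open>act\<close> is a left action.\<close>

definition pull :: "nat \<Rightarrow> (nat \<Rightarrow> nat) \<Rightarrow> chr \<Rightarrow> chr" where
  "pull n b \<chi> = (\<lambda>i\<in>{1..n}. \<chi> (b i))"

lemma act_eq_pull: "act n w = pull n (perm_inv w)"
  by (simp add: fun_eq_iff act_def pull_def)

lemma pull_pull: "b' permutes {1..n} \<Longrightarrow> pull n b' (pull n b \<chi>) = pull n (b \<circ> b') \<chi>"
  using permutes_in_image[of b' "{1..n}"] by (auto simp: pull_def fun_eq_iff restrict_def)

lemma Irr_extensional: "\<chi> \<in> Irr d n \<Longrightarrow> pull n id \<chi> = \<chi>"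
  by (auto simp: Irr_def pull_def PiE_def extensional_restrict)

lemma pull_Irr: "b permutes {1..n} \<Longrightarrow> \<chi> \<in> Irr d n \<Longrightarrow> pull n b \<chi> \<in> Irr d n"
  using permutes_in_image[of b "{1..n}"] unfolding Irr_def pull_def
  by (auto simp del: atLeastAtMost_iff dest: PiE_mem)

lemma comp_of_pull:
  assumes "b permutes {1..n}"
  shows "comp_of \<xi> d n (pull n b \<chi>) = comp_of \<xi> d n \<chi>"
proof -
  have "card {j \<in> {1..n}. \<chi> j = z} = card {j \<in> {1..n}. pull n b \<chi> j = z}" for z
  proof -
    have "b ` {j \<in> {1..n}. pull n b \<chi> j = z} = {j \<in> {1..n}. \<chi> j = z}"
    proof (intro equalityI subsetI)
      fix j assume j: "j \<in> {j \<in> {1..n}. \<chi> j = z}"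
      then have "perm_inv b j \<in> {1..n}" "b (perm_inv b j) = j"
        using permutes_in_image[OF permutes_inv[OF assms]] permutes_inverses[OF assms] by auto
      then show "j \<in> b ` {j \<in> {1..n}. pull n b \<chi> j = z}"
        using j by (intro image_eqI[of _ _ "perm_inv b j"]) (simp_all add: pull_def)
    next
      fix j assume "j \<in> b ` {j \<in> {1..n}. pull n b \<chi> j = z}"
      then obtain i where "i \<in> {1..n}" "pull n b \<chi> i = z" "j = b i"
        by blast
      then show "j \<in> {j \<in> {1..n}. \<chi> j = z}"
        using permutes_in_image[OF assms, of i] by (simp add: pull_def)
    qed
    then show ?thesis
      using card_image[OF inj_on_subset[OF permutes_inj[OF assms] subset_UNIV]] by metis
  qed
  then show ?thesis by (auto simp: comp_of_def)
qed

lemma pull_Irr_comp: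
  "b permutes {1..n} \<Longrightarrow> \<chi> \<in> Irr_comp \<xi> d n \<mu> \<Longrightarrow> pull n b \<chi> \<in> Irr_comp \<xi> d n \<mu>"
  by (simp add: Irr_comp_def pull_Irr comp_of_pull)

lemma chr_root: "\<chi> \<in> Irr d n \<Longrightarrow> j \<in> {1..n} \<Longrightarrow> \<chi> j ^ d = 1"
  using PiE_mem[of \<chi> "{1..n}" "\<lambda>_. {z. z ^ d = 1}" j] by (simp add: Irr_def)

lemma finite_Irr: "d \<ge> 1 \<Longrightarrow> finite (Irr d n)"
  unfolding Irr_def by (intro finite_PiE) (auto intro: finite_roots_unity)

lemma finite_Irr_comp: "d \<ge> 1 \<Longrightarrow> finite (Irr_comp \<xi> d n \<mu>)"
  by (simp add: Irr_comp_def finite_Irr)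

locale root_enumeration =
  fixes \<xi> :: "nat \<Rightarrow> complex" and d :: nat
  assumes d_pos: "d \<ge> 1" and bij_roots: "bij_betw \<xi> {1..d} {z. z ^ d = 1}"
begin

lemma chr_in_range: "\<chi> \<in> Irr d n \<Longrightarrow> j \<in> {1..n} \<Longrightarrow> \<chi> j \<in> \<xi> ` {1..d}"
  unfolding bij_betw_imp_surj_on[OF bij_roots] Irr_def by (rule PiE_mem)

lemma xi_eq_iff: "a \<in> {1..d} \<Longrightarrow> b \<in> {1..d} \<Longrightarrow> \<xi> a = \<xi> b \<longleftrightarrow> a = b"
  using bij_betw_imp_inj_on[OF bij_roots] by (simp add: inj_on_eq_iff)

lemma xi_root: "a \<in> {1..d} \<Longrightarrow> \<xi> a ^ d = 1"
  using bij_betwE[OF bij_roots] by blast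

lemma comp_of_in_comps:
  assumes "\<chi> \<in> Irr d n"
  shows "comp_of \<xi> d n \<chi> \<in> comps d n"
proof -
  have "(\<Sum>z\<in>\<xi> ` {1..d}. \<Sum>j\<in>{j \<in> {1..n}. \<chi> j = z}. 1) = (\<Sum>j\<in>{1..n}. 1::nat)"
  proof (rule sum.group)
    show "\<chi> ` {1..n} \<subseteq> \<xi> ` {1..d}"
      using chr_in_range[OF assms] by (rule image_subsetI)
  qed simp_all
  also have "(\<Sum>z\<in>\<xi> ` {1..d}. \<Sum>j\<in>{j \<in> {1..n}. \<chi> j = z}. 1) =
      (\<Sum>a\<in>{1..d}. card {j \<in> {1..n}. \<chi> j = \<xi> a})"
    using bij_betw_imp_inj_on[OF bij_roots] by (simp add: sum.reindex)
  finally show ?thesis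
    by (simp add: comps_def comp_of_def)
qed

end

lemma offs_Suc: "offs \<mu> (Suc a) = (if a = 0 then 0 else offs \<mu> a + \<mu> a)"
  by (auto simp: offs_def atLeastLessThanSuc)

lemma offs_mono: "a \<le> b \<Longrightarrow> offs \<mu> a \<le> offs \<mu> b"
  unfolding offs_def by (rule sum_mono2) auto

lemma blk_eqI:
  assumes "offs \<mu> a < j" "j \<le> offs \<mu> (Suc a)"
  shows "blk \<mu> j = a"
  unfolding blk_def
proof (rule Least_equality)
  fix b assume "j \<le> offs \<mu> (Suc b)"
  then have "\<not> Suc b \<le> a" using offs_mono[of "Suc b" a \<mu>] assms(1) by linarith
  then show "a \<le> b" by simp
qed (rule assms)

lemma blk_bounds:
  assumes "\<mu> \<in> comps d n" "j \<in> {1..n}"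
  shows "blk \<mu> j \<in> {1..d}" "offs \<mu> (blk \<mu> j) < j" "j \<le> offs \<mu> (Suc (blk \<mu> j))"
    "\<mu> (blk \<mu> j) \<noteq> 0"
proof -
  let ?P = "\<lambda>a. j \<le> offs \<mu> (Suc a)"
  have d: "?P d"
    using assms by (simp add: comps_def offs_def atLeastLessThanSuc_atLeastAtMost)
  show P: "j \<le> offs \<mu> (Suc (blk \<mu> j))"
    unfolding blk_def by (rule LeastI[of ?P, OF d])
  have le: "blk \<mu> j \<le> d"
    unfolding blk_def by (rule Least_le[of ?P, OF d])
  have 0: "blk \<mu> j \<noteq> 0"
    using P assms(2) by (auto simp: offs_Suc split: if_splits)
  then obtain b where b: "blk \<mu> j = Suc b" by (cases "blk \<mu> j") auto
  have "\<not> ?P b"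
    using not_less_Least[of b ?P] b by (simp add: blk_def)
  with b show 1: "offs \<mu> (blk \<mu> j) < j" by simp
  show "blk \<mu> j \<in> {1..d}" using 0 le by auto
  show "\<mu> (blk \<mu> j) \<noteq> 0" using P 1 0 by (auto simp: offs_Suc)
qed

text \<open>The block \<open>a\<close> consists of the positions after \<open>offs \<mu> a\<close> up to \<open>offs \<mu> (Suc a)\<close>.\<close>

lemma card_blk:
  assumes "\<mu> \<in> comps d n" "a \<in> {1..d}"
  shows "card {j \<in> {1..n}. blk \<mu> j = a} = \<mu> a"
proof -
  have "offs \<mu> (Suc a) \<le> n"
    using offs_mono[of "Suc a" "Suc d" \<mu>] assms
    by (simp add: comps_def offs_def atLeastLessThanSuc_atLeastAtMost)
  then have "{j \<in> {1..n}. blk \<mu> j = a} = {offs \<mu> a<..offs \<mu> (Suc a)}"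
    using blk_bounds[OF assms(1)] blk_eqI by fastforce
  then show ?thesis using assms(2) by (simp add: offs_Suc)
qed

context root_enumeration
begin

text \<open>A minimum is attained because some permutation carries $\chi_0^\mu$ to \<open>\<chi>\<close>: both characters take
  the value $\xi_a$ exactly $\mu_a$ times.\<close>

lemma pi_chi:
  assumes "\<chi> \<in> Irr d n"
  shows "pi_chi \<xi> d n \<chi> permutes {1..n}"
    "act n (pi_chi \<xi> d n \<chi>) (chi0 \<xi> n (comp_of \<xi> d n \<chi>)) = \<chi>"
proof -
  define \<mu> where "\<mu> = comp_of \<xi> d n \<chi>"
  have \<mu>: "\<mu> \<in> comps d n" using comp_of_in_comps assms \<mu>_def by simp
  let ?f = "\<lambda>j. \<xi> (blk \<mu> j)"
  have "card {j \<in> {1..n}. \<chi> j = z} = card {j \<in> {1..n}. ?f j = z}" for z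
  proof (cases "z \<in> \<xi> ` {1..d}")
    case True
    then obtain a where a: "a \<in> {1..d}" "z = \<xi> a" by blast
    have "{j \<in> {1..n}. ?f j = z} = {j \<in> {1..n}. blk \<mu> j = a}"
      using a xi_eq_iff[OF blk_bounds(1)[OF \<mu>]] by blast
    then have "card {j \<in> {1..n}. ?f j = z} = \<mu> a"
      using card_blk[OF \<mu> a(1)] by simp
    then show ?thesis using a by (simp add: \<mu>_def comp_of_def)
  next
    case False
    then have "\<chi> j \<noteq> z" "?f j \<noteq> z" if "j \<in> {1..n}" for j
      using that chr_in_range[OF assms that] blk_bounds(1)[OF \<mu> that] by auto
    then have "{j \<in> {1..n}. \<chi> j = z} = {}" "{j \<in> {1..n}. ?f j = z} = {}"
      by simp_all
    then show ?thesis by (simp only:)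
  qed
  then have "image_mset \<chi> (mset_set {1..n}) = image_mset ?f (mset_set {1..n})"
    by (intro multiset_eqI) (simp add: count_image_mset' eq_commute[of "_ :: complex"])
  then obtain p where p: "p permutes {1..n}" "\<forall>j\<in>{1..n}. \<chi> j = ?f (p j)"
    using image_mset_eq_implies_permutes[of "{1..n}" \<chi> ?f] by auto
  have "act n (perm_inv p) (chi0 \<xi> n \<mu>) = pull n id \<chi>"
    using p(2) permutes_in_image[OF p(1)] inv_inv_eq[OF permutes_bij[OF p(1)]]
    by (auto simp: act_eq_pull pull_def chi0_def fun_eq_iff restrict_def)
  then have "perm_inv p permutes {1..n} \<and> act n (perm_inv p) (chi0 \<xi> n \<mu>) = \<chi>"
    using assms p by (simp add: Irr_extensional permutes_inv)
  from arg_min_natI[of "\<lambda>w. w permutes {1..n} \<and> act n w (chi0 \<xi> n \<mu>) = \<chi>", OF this]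
  show "pi_chi \<xi> d n \<chi> permutes {1..n}" "act n (pi_chi \<xi> d n \<chi>) (chi0 \<xi> n (comp_of \<xi> d n \<chi>)) = \<chi>"
    by (auto simp: pi_chi_def \<mu>_def)
qed

end

section \<open>The algebras as presented algebras\<close>

context presented_algebra
begin

text \<open>Equality in the quotient for representatives. Calculations with representatives can use the laws
  of the type class of rings; membership is part of the relation so that steps can be chained without
  side conditions.\<close>

definition eqv :: "('m \<Rightarrow>\<^sub>0 laurent) \<Rightarrow> ('m \<Rightarrow>\<^sub>0 laurent) \<Rightarrow> bool" where
  "eqv x y \<longleftrightarrow> x \<in> carrier (malg M) \<and> y \<in> carrier (malg M) \<and> pcls M Q x = pcls M Q y"

lemma eqv_refl: "x \<in> carrier (malg M) \<Longrightarrow> eqv x x"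
  by (simp add: eqv_def)

lemma eqv_trans [trans]: "eqv x y \<Longrightarrow> eqv y z \<Longrightarrow> eqv x z"
  by (simp add: eqv_def)

lemma eqv_mult: "eqv x y \<Longrightarrow> eqv x' y' \<Longrightarrow> eqv (x * x') (y * y')"
  by (simp add: eqv_def pcls_mult)

lemma eqv_add: "eqv x y \<Longrightarrow> eqv x' y' \<Longrightarrow> eqv (x + x') (y + y')"
  by (simp add: eqv_def pcls_add)

lemma eqv_sum: "(\<And>a. a \<in> K \<Longrightarrow> eqv (f a) (g a)) \<Longrightarrow> eqv (sum f K) (sum g K)"
  by (induction K rule: infinite_finite_induct) (simp_all add: eqv_add eqv_refl)

lemma eqv_relation:
  "x - y \<in> Q \<Longrightarrow> x \<in> carrier (malg M) \<Longrightarrow> y \<in> carrier (malg M) \<Longrightarrow> eqv x y"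
  by (simp add: eqv_def pcls_relation)

end

lemma gens_simps [simp]:
  "G i \<in> gens n \<longleftrightarrow> 1 \<le> i \<and> i < n" "T j \<in> gens n \<longleftrightarrow> 1 \<le> j \<and> j \<le> n"
  "X \<in> gens n \<longleftrightarrow> 1 \<le> n" "X' \<in> gens n \<longleftrightarrow> 1 \<le> n"
  by (auto simp: gens_def)

text \<open>The free algebra, where closure of the carrier can be used to see that the relators of
  $\widehat Y_{d,n}$ lie in the carrier.\<close>

lemma presented_free: "presented_algebra (lists (gens n)) {}"
  by standard (simp_all add: zero_list_def plus_list_def)

lemma gn_closed [simp]: "a \<in> gens n \<Longrightarrow> gn a \<in> carrier (malg (lists (gens n)))"
  by (simp add: gn_def malg_def)

lemma e_elt_closed [simp]: "i \<in> {1..<n} \<Longrightarrow> e_elt d i \<in> carrier (malg (lists (gens n)))"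
proof -
  assume "i \<in> {1..<n}"
  interpret presented_algebra "lists (gens n)" "{}" by (rule presented_free)
  show ?thesis using \<open>i \<in> {1..<n}\<close> by (simp add: e_elt_def)
qed

lemma yrel_closed: "yrel d n \<subseteq> carrier (malg (lists (gens n)))"
proof
  interpret presented_algebra "lists (gens n)" "{}" by (rule presented_free)
  fix x assume "x \<in> yrel d n"
  then show "x \<in> carrier (malg (lists (gens n)))"
    by cases (auto simp: transpose_def)
qed

interpretation Y: presented_algebra "lists (gens n)" "yrel d n"
  rewrites "palg (lists (gens n)) (yrel d n) = YH d n"
    and "pcls (lists (gens n)) (yrel d n) = ycls d n"
  for d n
  subgoal
    using yrel_closed by unfold_locales (simp_all add: zero_list_def plus_list_def)
  by (simp_all add: YH_def ycls_def)

lemma yrel_0: "yrel d 0 = {}"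
proof -
  have "x \<notin> yrel d 0" for x by (auto elim: yrel.cases)
  then show ?thesis by blast
qed

lemma at_factor_closed:
  assumes "x \<in> carrier (malg (lists (gens (\<mu> a))))"
  shows "at_factor a x \<in> carrier (malg (hwords \<mu>))"
proof -
  have "Poly_Mapping.keys (at_factor a x) \<subseteq> (\<lambda>w. (\<lambda>_. [])(a := w)) ` Poly_Mapping.keys x"
    unfolding at_factor_eq_push by (rule keys_push)
  also have "\<dots> \<subseteq> hwords \<mu>"
    using assms by (auto simp: hwords_def malg_def)
  finally show ?thesis by (simp add: malg_def)
qed

interpretation H: presented_algebra "hwords \<mu>" "hrel \<mu>"
  rewrites "palg (hwords \<mu>) (hrel \<mu>) = HH \<mu>"
    and "pcls (hwords \<mu>) (hrel \<mu>) = hcls \<mu>"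
  for \<mu>
  subgoal
  proof
    show "hrel \<mu> \<subseteq> carrier (malg (hwords \<mu>))"
      using at_factor_closed[OF subsetD[OF yrel_closed]] unfolding hrel_def by blast
  qed (auto simp: hwords_def zero_list_def plus_list_def)
  by (simp_all add: HH_def hcls_def)

lemma hcls_scal_mult: "hcls \<mu> (scal c) \<otimes>\<^bsub>HH \<mu>\<^esub> hcls \<mu> (scal c') = hcls \<mu> (scal (c * c'))"
  by (simp add: scal_mult flip: H.pcls_mult)

lemma hcls_scal_add: "hcls \<mu> (scal c) \<oplus>\<^bsub>HH \<mu>\<^esub> hcls \<mu> (scal c') = hcls \<mu> (scal (c + c'))"
  by (simp add: scal_add flip: H.pcls_add)

lemma hcls_scal_0: "hcls \<mu> (scal 0) = \<zero>\<^bsub>HH \<mu>\<^esub>"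
  by (simp add: H.pcls_zero)

lemma hcls_scal_1: "hcls \<mu> (scal 1) = \<one>\<^bsub>HH \<mu>\<^esub>"
  by (simp add: H.pcls_one)

lemma ycls_eq_of_eqv: "Y.eqv n d x y \<Longrightarrow> ycls d n x = ycls d n y"
  by (simp add: Y.eqv_def)


section \<open>The idempotents are eigenvectors of the framing generators\<close>

text \<open>The factor of $E_\chi$ at the position \<open>j\<close>: the projector to the eigenvalue \<open>z\<close> of $t_j$.\<close>

definition proj :: "nat \<Rightarrow> nat \<Rightarrow> complex \<Rightarrow> falg" where
  "proj d j z = scal (const_R (1 / of_nat d)) *
     (\<Sum>s<d. scal (const_R (inverse z ^ s)) * gn (T j) ^ s)"

lemma E_elt_eq: "E_elt d n \<chi> = ycls d n (prod_list (map (\<lambda>j. proj d j (\<chi> j)) [1..<Suc n]))"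
  by (simp add: E_elt_def proj_def)

lemma proj_closed [simp]: "j \<in> {1..n} \<Longrightarrow> proj d j z \<in> carrier (malg (lists (gens n)))"
  by (simp add: proj_def)

lemma const_R_mult: "const_R a * const_R b = const_R (a * b)"
  by (simp add: const_R_def mult_single)

lemma const_R_add: "const_R a + const_R b = const_R (a + b)"
  by (simp add: const_R_def single_add)

lemma const_R_1 [simp]: "const_R 1 = 1"
  by (simp add: const_R_def)

lemma const_R_0 [simp]: "const_R 0 = 0"
  by (simp add: const_R_def)

lemma const_R_power: "const_R a ^ k = const_R (a ^ k)"
  by (induction k) (simp_all add: const_R_mult)

lemma const_R_sum: "(\<Sum>a\<in>K. const_R (f a)) = const_R (\<Sum>a\<in>K. f a)"
  by (induction K rule: infinite_finite_induct) (simp_all add: const_R_add)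

lemma commute_T_mult:
  assumes "Y.eqv n d (x * t) (t * x)" "Y.eqv n d (y * t) (t * y)" 
    and c: "x \<in> carrier (malg (lists (gens n)))" "y \<in> carrier (malg (lists (gens n)))"
  shows "Y.eqv n d (x * y * t) (t * (x * y))"
proof -
  have "Y.eqv n d (x * (y * t)) (x * (t * y))"
    by (rule Y.eqv_mult[OF Y.eqv_refl[OF c(1)] assms(2)])
  also have "x * (t * y) = (x * t) * y" by (simp add: mult.assoc)
  also have "Y.eqv n d ((x * t) * y) ((t * x) * y)"
    by (rule Y.eqv_mult[OF assms(1) Y.eqv_refl[OF c(2)]])
  finally show ?thesis by (simp add: mult.assoc)
qed

lemma proj_commute:
  assumes "i \<in> {1..n}" "j \<in> {1..n}"
  shows "Y.eqv n d (proj d i z * gn (T j)) (gn (T j) * proj d i z)"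
proof -
  let ?t = "gn (T j)"
  have t: "?t \<in> carrier (malg (lists (gens n)))" using assms by simp
  have scal: "Y.eqv n d (scal c * ?t) (?t * scal c)" for c
    using t scal_central[of c ?t] by (metis Y.eqv_refl Y.malg_mult Y.malg_scal)
  have T: "Y.eqv n d (gn (T i) * ?t) (?t * gn (T i))"
    by (rule Y.eqv_relation) (use assms in \<open>simp_all add: yrel.T_comm\<close>)
  have pow: "Y.eqv n d (gn (T i) ^ s * ?t) (?t * gn (T i) ^ s)" for s
  proof (induction s)
    case (Suc s)
    then show ?case
      using commute_T_mult[OF T Suc] assms by (simp add: mult.assoc)
  qed (use t in \<open>simp add: Y.eqv_refl\<close>)
  have "Y.eqv n d ((\<Sum>s<d. scal (c s) * gn (T i) ^ s) * ?t) (?t * (\<Sum>s<d. scal (c s) * gn (T i) ^ s))"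
    for c
    unfolding sum_distrib_left sum_distrib_right
    by (intro Y.eqv_sum commute_T_mult scal pow) (use assms in simp_all)
  then show ?thesis
    unfolding proj_def by (intro commute_T_mult scal) (use assms in simp_all)
qed

text \<open>Multiplication by $t_j$ shifts the summation index by one; the term that leaves the range comes
  back at its other end because $t_j^d = 1$ and $z^d = 1$.\<close>

lemma proj_T:
  assumes "j \<in> {1..n}" "z ^ d = 1" "d \<ge> 1"
  shows "Y.eqv n d (proj d j z * gn (T j)) (scal (const_R z) * proj d j z)"
proof -
  let ?t = "gn (T j)"
  \<comment> \<open>After the shift the summand is \<open>f (Suc s)\<close>, and \<open>f d\<close> agrees with \<open>f 0\<close> in the quotient.\<close>
  define f where "f s = scal (const_R (z * inverse z ^ s)) * ?t ^ s" for s
  have z: "z \<noteq> 0" using assms(2,3) by (auto simp: power_0_left)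
  have 1: "proj d j z * ?t = scal (const_R (1 / of_nat d)) * (\<Sum>s<d. f (Suc s))"
  proof -
    have "z * inverse z ^ Suc s = inverse z ^ s" for s using z by simp
    then show ?thesis
      unfolding proj_def f_def power_Suc2[of ?t] by (simp only: mult.assoc sum_distrib_right)
  qed
  have "scal (const_R z) * proj d j z
      = scal (const_R (1 / of_nat d)) * (scal (const_R z) * (\<Sum>s<d. scal (const_R (inverse z ^ s)) * ?t ^ s))"
    unfolding proj_def mult.assoc[symmetric] scal_mult by (simp add: mult.commute)
  also have "scal (const_R z) * (\<Sum>s<d. scal (const_R (inverse z ^ s)) * ?t ^ s) = (\<Sum>s<d. f s)"
    unfolding sum_distrib_left mult.assoc[symmetric] scal_mult const_R_mult f_def ..
  finally have 2: "scal (const_R z) * proj d j z = scal (const_R (1 / of_nat d)) * (\<Sum>s<d. f s)" .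
  have f: "f s \<in> carrier (malg (lists (gens n)))" for s
    using assms(1) by (simp add: f_def)
  have "Y.eqv n d (?t ^ d) 1"
    by (rule Y.eqv_relation) (use assms in \<open>simp_all add: yrel.T_order\<close>)
  then have "Y.eqv n d (f d) (f 0)"
    unfolding f_def using assms(2)
    by (intro Y.eqv_mult) (simp_all add: Y.eqv_refl power_inverse)
  then have "Y.eqv n d ((\<Sum>s<d. f s) - f 0 + f d) ((\<Sum>s<d. f s) - f 0 + f 0)"
    by (intro Y.eqv_add Y.eqv_refl) (simp_all add: f)
  moreover have "(\<Sum>s<d. f s) - f 0 + f d = (\<Sum>s<d. f (Suc s))"
    using sum.lessThan_Suc[of f d] sum.lessThan_Suc_shift[of f d] by (simp add: algebra_simps)
  ultimately have "Y.eqv n d (\<Sum>s<d. f (Suc s)) (\<Sum>s<d. f s)"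
    by simp
  then show ?thesis
    unfolding 1 2 by (intro Y.eqv_mult Y.eqv_refl) simp_all
qed

text \<open>The generator $t_j$ commutes with the factors of $E_\chi$ behind the position \<open>j\<close> and is then absorbed
  by the factor at \<open>j\<close>, which leaves the eigenvalue.\<close>

lemma E_elt_T:
  assumes "\<chi> \<in> Irr d n" "j \<in> {1..n}" "d \<ge> 1"
  shows "E_elt d n \<chi> \<otimes>\<^bsub>YH d n\<^esub> ycls d n (gn (T j))
    = ycls d n (scal (const_R (\<chi> j))) \<otimes>\<^bsub>YH d n\<^esub> E_elt d n \<chi>"
proof -
  let ?t = "gn (T j)" and ?F = "\<lambda>js. prod_list (map (\<lambda>j. proj d j (\<chi> j)) js)"
  have t: "?t \<in> carrier (malg (lists (gens n)))" using assms by simp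
  have F: "?F js \<in> carrier (malg (lists (gens n)))" if "set js \<subseteq> {1..n}" for js
    using that by (intro Y.malg_prod_list) auto
  have comm: "Y.eqv n d (?F js * ?t) (?t * ?F js)" if "set js \<subseteq> {1..n}" for js
    using that
  proof (induction js)
    case (Cons i js)
    then have "Y.eqv n d (proj d i (\<chi> i) * ?F js * ?t) (?t * (proj d i (\<chi> i) * ?F js))"
      using assms(2) F by (intro commute_T_mult proj_commute) simp_all
    then show ?case by simp
  qed (simp add: t Y.eqv_refl)
  have root: "\<chi> j ^ d = 1" using assms(1,2) by (rule chr_root)
  have "Y.eqv n d (?F js * ?t) (scal (const_R (\<chi> j)) * ?F js)"
    if "set js \<subseteq> {1..n}" "j \<in> set js" for js
    using that
  proof (induction js)
    case (Cons i js)
    show ?case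
    proof (cases "j \<in> set js")
      case True
      with Cons have IH: "Y.eqv n d (?F js * ?t) (scal (const_R (\<chi> j)) * ?F js)"
        by simp
      have "proj d i (\<chi> i) \<in> carrier (malg (lists (gens n)))"
        using Cons by simp
      from Y.eqv_mult[OF Y.eqv_refl[OF this] IH]
      have "Y.eqv n d (proj d i (\<chi> i) * (?F js * ?t)) (proj d i (\<chi> i) * (scal (const_R (\<chi> j)) * ?F js))" .
      also have "proj d i (\<chi> i) * (scal (const_R (\<chi> j)) * ?F js) = scal (const_R (\<chi> j)) * ?F (i # js)"
        using scal_central[of "const_R (\<chi> j)" "proj d i (\<chi> i)"] by (simp flip: mult.assoc)
      finally show ?thesis by (simp add: mult.assoc)
    next
      case False
      with Cons have ij: "i = j" by simp
      have "Y.eqv n d (proj d j (\<chi> j) * (?F js * ?t)) (proj d j (\<chi> j) * (?t * ?F js))"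
        using Cons ij by (intro Y.eqv_mult[OF Y.eqv_refl comm]) simp_all
      also have "\<dots> = (proj d j (\<chi> j) * ?t) * ?F js" by (simp add: mult.assoc)
      also have "Y.eqv n d \<dots> ((scal (const_R (\<chi> j)) * proj d j (\<chi> j)) * ?F js)"
        using Cons ij assms root F by (intro Y.eqv_mult[OF proj_T Y.eqv_refl]) simp_all
      finally show ?thesis by (simp add: ij mult.assoc)
    qed
  qed simp
  from this[of "[1..<Suc n]"]
  have "Y.eqv n d (?F [1..<Suc n] * ?t) (scal (const_R (\<chi> j)) * ?F [1..<Suc n])"
    using assms(2) by (simp only: set_upt atLeastLessThanSuc_atLeastAtMost order_refl simp_thms)
  then have "ycls d n (?F [1..<Suc n] * ?t) = ycls d n (scal (const_R (\<chi> j)) * ?F [1..<Suc n])"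
    by (rule ycls_eq_of_eqv)
  moreover have "?F [1..<Suc n] \<in> carrier (malg (lists (gens n)))"
    by (rule F) auto
  ultimately show ?thesis
    unfolding E_elt_eq using t by (simp add: Y.pcls_mult del: upt_Suc)
qed

lemma E_elt_closed [simp]: "E_elt d n \<chi> \<in> carrier (YH d n)"
  unfolding E_elt_eq by (intro Y.pcls_closed Y.malg_prod_list) auto

section \<open>Elements with monomial image\<close>

locale matrix_iso = root_enumeration \<xi> d for \<xi> d +
  fixes n :: nat and \<Psi> :: "falg set \<Rightarrow> mats"
  assumes n_pos: "n \<ge> 1" and is_Psi: "is_Psi \<xi> d n \<Psi>"
begin

lemma Psi_hom: "\<Psi> \<in> ring_hom (YH d n) (mat_sum \<xi> d n)"
  and Psi_bij: "bij_betw \<Psi> (carrier (YH d n)) (carrier (mat_sum \<xi> d n))"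
  using is_Psi by (auto simp: is_Psi_def ring_iso_def)

lemma comp_Irr [simp]:
  assumes "\<chi> \<in> Irr d n"
  shows "comp_of \<xi> d n \<chi> \<in> comps d n" "\<chi> \<in> Irr_comp \<xi> d n (comp_of \<xi> d n \<chi>)"
  using assms comp_of_in_comps by (auto simp: Irr_comp_def)

lemma Psi_carrier: "x \<in> carrier (YH d n) \<Longrightarrow> \<Psi> x \<in> carrier (mat_sum \<xi> d n)"
  by (rule ring_hom_closed[OF Psi_hom])

lemma Psi_closed:
  assumes "x \<in> carrier (YH d n)" "\<mu> \<in> comps d n" "\<alpha> \<in> Irr_comp \<xi> d n \<mu>" "\<beta> \<in> Irr_comp \<xi> d n \<mu>"
  shows "\<Psi> x \<mu> \<alpha> \<beta> \<in> carrier (HH \<mu>)"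
proof -
  have "\<Psi> x \<in> (\<Pi>\<^sub>E \<mu>\<in>comps d n. Irr_comp \<xi> d n \<mu> \<rightarrow>\<^sub>E (Irr_comp \<xi> d n \<mu> \<rightarrow>\<^sub>E carrier (HH \<mu>)))"
    using Psi_carrier[OF assms(1)] by (simp add: mat_sum_def sum_ring_def mat_ring_def)
  from PiE_mem[OF PiE_mem[OF PiE_mem[OF this assms(2)] assms(3)] assms(4)] show ?thesis .
qed

lemma Psi_add:
  assumes "x \<in> carrier (YH d n)" "y \<in> carrier (YH d n)"
    "\<mu> \<in> comps d n" "\<alpha> \<in> Irr_comp \<xi> d n \<mu>" "\<beta> \<in> Irr_comp \<xi> d n \<mu>"
  shows "\<Psi> (x \<oplus>\<^bsub>YH d n\<^esub> y) \<mu> \<alpha> \<beta> = \<Psi> x \<mu> \<alpha> \<beta> \<oplus>\<^bsub>HH \<mu>\<^esub> \<Psi> y \<mu> \<alpha> \<beta>"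
  using ring_hom_add[OF Psi_hom assms(1,2)] assms(3-5)
  by (simp add: mat_sum_def sum_ring_def mat_ring_def)

lemma Psi_mult:
  assumes "x \<in> carrier (YH d n)" "y \<in> carrier (YH d n)"
    "\<mu> \<in> comps d n" "\<alpha> \<in> Irr_comp \<xi> d n \<mu>" "\<beta> \<in> Irr_comp \<xi> d n \<mu>"
  shows "\<Psi> (x \<otimes>\<^bsub>YH d n\<^esub> y) \<mu> \<alpha> \<beta> =
    finsum (HH \<mu>) (\<lambda>j. \<Psi> x \<mu> \<alpha> j \<otimes>\<^bsub>HH \<mu>\<^esub> \<Psi> y \<mu> j \<beta>) (Irr_comp \<xi> d n \<mu>)"
  using ring_hom_mult[OF Psi_hom assms(1,2)] assms(3-5)
  by (simp add: mat_sum_def sum_ring_def mat_ring_def)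

lemma Psi_one:
  assumes "\<mu> \<in> comps d n" "\<alpha> \<in> Irr_comp \<xi> d n \<mu>" "\<beta> \<in> Irr_comp \<xi> d n \<mu>"
  shows "\<Psi> \<one>\<^bsub>YH d n\<^esub> \<mu> \<alpha> \<beta> = (if \<alpha> = \<beta> then \<one>\<^bsub>HH \<mu>\<^esub> else \<zero>\<^bsub>HH \<mu>\<^esub>)"
  using ring_hom_one[OF Psi_hom] assms
  by (simp add: mat_sum_def sum_ring_def mat_ring_def)

lemma Psi_scal:
  assumes "x \<in> carrier (YH d n)" "\<mu> \<in> comps d n" "\<alpha> \<in> Irr_comp \<xi> d n \<mu>" "\<beta> \<in> Irr_comp \<xi> d n \<mu>"
  shows "\<Psi> (ycls d n (scal c) \<otimes>\<^bsub>YH d n\<^esub> x) \<mu> \<alpha> \<beta> = hcls \<mu> (scal c) \<otimes>\<^bsub>HH \<mu>\<^esub> \<Psi> x \<mu> \<alpha> \<beta>"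
  using is_Psi assms by (simp add: is_Psi_def)

lemma Psi_eqI:
  assumes "x \<in> carrier (YH d n)" "y \<in> carrier (YH d n)"
    "\<And>\<mu> \<alpha> \<beta>. \<mu> \<in> comps d n \<Longrightarrow> \<alpha> \<in> Irr_comp \<xi> d n \<mu> \<Longrightarrow> \<beta> \<in> Irr_comp \<xi> d n \<mu>
      \<Longrightarrow> \<Psi> x \<mu> \<alpha> \<beta> = \<Psi> y \<mu> \<alpha> \<beta>"
  shows "x = y"
proof -
  have x: "\<Psi> x \<in> carrier (mat_sum \<xi> d n)" and y: "\<Psi> y \<in> carrier (mat_sum \<xi> d n)"
    using assms(1,2) by (simp_all add: Psi_carrier)
  have "\<Psi> x = \<Psi> y"
  proof (rule PiE_ext)
    let ?B = "\<lambda>\<mu>. Irr_comp \<xi> d n \<mu> \<rightarrow>\<^sub>E (Irr_comp \<xi> d n \<mu> \<rightarrow>\<^sub>E carrier (HH \<mu>))"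
    show xP: "\<Psi> x \<in> (\<Pi>\<^sub>E \<mu>\<in>comps d n. ?B \<mu>)" and yP: "\<Psi> y \<in> (\<Pi>\<^sub>E \<mu>\<in>comps d n. ?B \<mu>)"
      using x y by (simp_all add: mat_sum_def sum_ring_def mat_ring_def)
    fix \<mu> assume \<mu>: "\<mu> \<in> comps d n"
    show "\<Psi> x \<mu> = \<Psi> y \<mu>"
    proof (rule PiE_ext)
      show xI: "\<Psi> x \<mu> \<in> ?B \<mu>" and yI: "\<Psi> y \<mu> \<in> ?B \<mu>"
        using PiE_mem[OF xP \<mu>] PiE_mem[OF yP \<mu>] .
      fix \<alpha> assume \<alpha>: "\<alpha> \<in> Irr_comp \<xi> d n \<mu>"
      show "\<Psi> x \<mu> \<alpha> = \<Psi> y \<mu> \<alpha>"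
        by (rule PiE_ext[OF PiE_mem[OF xI \<alpha>] PiE_mem[OF yI \<alpha>]]) (use assms(3) \<mu> \<alpha> in blast)
    qed
  qed
  then show ?thesis
    using assms(1,2) bij_betw_imp_inj_on[OF Psi_bij] by (simp add: inj_on_eq_iff)
qed

text \<open>The image of \<open>x\<close> is monomial with permutation \<open>b\<close>: in the row \<open>\<chi>\<close> the only entry that can be
  non-zero is \<open>h \<chi>\<close>, and its column is \<open>\<chi> \<circ> b\<close>. Every row \<open>\<chi>\<close> belongs to one composition, namely
  \<open>comp_of \<xi> d n \<chi>\<close>, so the family \<open>h\<close> determines the whole image (\<open>monomial_eqI\<close>).\<close>

definition monomial :: "(nat \<Rightarrow> nat) \<Rightarrow> (chr \<Rightarrow> talg set) \<Rightarrow> falg set \<Rightarrow> bool" where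
  "monomial b h x \<longleftrightarrow> b permutes {1..n} \<and> x \<in> carrier (YH d n) \<and>
     (\<forall>\<chi>\<in>Irr d n. \<forall>\<beta>\<in>Irr_comp \<xi> d n (comp_of \<xi> d n \<chi>).
        \<Psi> x (comp_of \<xi> d n \<chi>) \<chi> \<beta> =
          (if \<beta> = pull n b \<chi> then h \<chi> else \<zero>\<^bsub>HH (comp_of \<xi> d n \<chi>)\<^esub>))"

lemma monomialD:
  assumes "monomial b h x"
  shows "b permutes {1..n}" "x \<in> carrier (YH d n)"
    "\<mu> = comp_of \<xi> d n \<chi> \<Longrightarrow> \<chi> \<in> Irr d n \<Longrightarrow> \<beta> \<in> Irr_comp \<xi> d n \<mu>
      \<Longrightarrow> \<Psi> x \<mu> \<chi> \<beta> = (if \<beta> = pull n b \<chi> then h \<chi> else \<zero>\<^bsub>HH \<mu>\<^esub>)"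
  using assms by (auto simp: monomial_def)

lemma monomial_entry_closed:
  assumes "monomial b h x" "\<chi> \<in> Irr d n"
  shows "h \<chi> \<in> carrier (HH (comp_of \<xi> d n \<chi>))"
proof -
  let ?\<mu> = "comp_of \<xi> d n \<chi>"
  note m = monomialD[OF assms(1)]
  have p: "pull n b \<chi> \<in> Irr_comp \<xi> d n ?\<mu>"
    using assms(2) m(1) by (simp add: pull_Irr_comp)
  have "\<Psi> x ?\<mu> \<chi> (pull n b \<chi>) \<in> carrier (HH ?\<mu>)"
    using assms(2) m(2) p by (intro Psi_closed) simp_all
  then show ?thesis
    using m(3)[OF refl assms(2) p] by simp
qed

lemma Irr_compD: "\<chi> \<in> Irr_comp \<xi> d n \<mu> \<Longrightarrow> \<chi> \<in> Irr d n \<and> comp_of \<xi> d n \<chi> = \<mu>"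
  by (simp add: Irr_comp_def)

lemma monomial_one: "monomial id (\<lambda>\<chi>. \<one>\<^bsub>HH (comp_of \<xi> d n \<chi>)\<^esub>) \<one>\<^bsub>YH d n\<^esub>"
  by (auto simp: monomial_def permutes_id Psi_one Irr_extensional)

lemma monomial_eqI:
  assumes "monomial b h x" "monomial b h' y" "\<And>\<chi>. \<chi> \<in> Irr d n \<Longrightarrow> h \<chi> = h' \<chi>"
  shows "x = y"
proof (rule Psi_eqI)
  fix \<mu> \<alpha> \<beta> assume *: "\<mu> \<in> comps d n" "\<alpha> \<in> Irr_comp \<xi> d n \<mu>" "\<beta> \<in> Irr_comp \<xi> d n \<mu>"
  from Irr_compD[OF *(2)] *(3) assms(3) show "\<Psi> x \<mu> \<alpha> \<beta> = \<Psi> y \<mu> \<alpha> \<beta>"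
    using monomialD(3)[OF assms(1), of \<mu> \<alpha> \<beta>] monomialD(3)[OF assms(2), of \<mu> \<alpha> \<beta>] by simp
qed (use assms monomialD(2) in blast)+

lemma monomial_mult:
  assumes x: "monomial b h x" and y: "monomial b' h' y"
  shows "monomial (b \<circ> b') (\<lambda>\<chi>. h \<chi> \<otimes>\<^bsub>HH (comp_of \<xi> d n \<chi>)\<^esub> h' (pull n b \<chi>)) (x \<otimes>\<^bsub>YH d n\<^esub> y)"
proof -
  note mx = monomialD[OF x] and my = monomialD[OF y]
  have "\<Psi> (x \<otimes>\<^bsub>YH d n\<^esub> y) \<mu> \<chi> \<beta> = (if \<beta> = pull n (b \<circ> b') \<chi>
      then h \<chi> \<otimes>\<^bsub>HH \<mu>\<^esub> h' (pull n b \<chi>) else \<zero>\<^bsub>HH \<mu>\<^esub>)"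
    if \<mu>: "\<mu> = comp_of \<xi> d n \<chi>" and \<chi>: "\<chi> \<in> Irr d n" and \<beta>: "\<beta> \<in> Irr_comp \<xi> d n \<mu>" for \<mu> \<chi> \<beta>
  proof -
    let ?c = "pull n b \<chi>"
    have c: "?c \<in> Irr_comp \<xi> d n \<mu>" "?c \<in> Irr d n" "\<mu> = comp_of \<xi> d n ?c"
      using \<mu> \<chi> mx(1) by (simp_all add: pull_Irr_comp pull_Irr comp_of_pull)
    have in_comps: "\<mu> \<in> comps d n" using \<mu> \<chi> by simp
    have y_closed: "\<Psi> y \<mu> j \<beta> \<in> carrier (HH \<mu>)" if "j \<in> Irr_comp \<xi> d n \<mu>" for j
      using Psi_closed[OF my(2) in_comps that \<beta>] .
    have h: "h \<chi> \<in> carrier (HH \<mu>)" using monomial_entry_closed[OF x \<chi>] \<mu> by simp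
    have "\<Psi> (x \<otimes>\<^bsub>YH d n\<^esub> y) \<mu> \<chi> \<beta> =
        finsum (HH \<mu>) (\<lambda>j. \<Psi> x \<mu> \<chi> j \<otimes>\<^bsub>HH \<mu>\<^esub> \<Psi> y \<mu> j \<beta>) (Irr_comp \<xi> d n \<mu>)"
      using \<mu> \<chi> \<beta> mx(2) my(2) by (intro Psi_mult) simp_all
    also have "\<dots> = finsum (HH \<mu>)
        (\<lambda>j. if ?c = j then h \<chi> \<otimes>\<^bsub>HH \<mu>\<^esub> \<Psi> y \<mu> j \<beta> else \<zero>\<^bsub>HH \<mu>\<^esub>) (Irr_comp \<xi> d n \<mu>)"
      using mx(3)[OF \<mu> \<chi>] y_closed h
      by (intro H.palg.finsum_cong') auto
    also have "\<dots> = h \<chi> \<otimes>\<^bsub>HH \<mu>\<^esub> \<Psi> y \<mu> ?c \<beta>"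
      using c h y_closed d_pos by (subst H.palg.finsum_singleton) (auto simp: finite_Irr_comp)
    also have "\<dots> = (if \<beta> = pull n (b \<circ> b') \<chi> then h \<chi> \<otimes>\<^bsub>HH \<mu>\<^esub> h' ?c else \<zero>\<^bsub>HH \<mu>\<^esub>)"
      using my(3)[OF c(3,2) \<beta>] my(1) h by (simp add: pull_pull)
    finally show ?thesis .
  qed
  then show ?thesis
    using mx(1,2) my(1,2) by (simp add: monomial_def permutes_compose)
qed

text \<open>Let \<open>y\<close> be the inverse of \<open>x\<close>. Row \<open>\<chi>\<close> of \<open>x * y = 1\<close> and column \<open>\<chi> \<circ> b\<close> of \<open>y * x = 1\<close> each reduce
  to one term; they say that the entry of \<open>y\<close> at \<open>(\<chi> \<circ> b, \<chi>)\<close> is a two-sided inverse of \<open>h \<chi>\<close> and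
  that \<open>h \<chi>\<close> annihilates the other entries of that row of \<open>y\<close>. So these entries are 0.\<close>

lemma monomial_inv:
  assumes x: "monomial b h x" and unit: "x \<in> Units (YH d n)"
  obtains h' where "monomial (perm_inv b) h' (inv\<^bsub>YH d n\<^esub> x)"
    "\<forall>\<chi>\<in>Irr d n. h' (pull n b \<chi>) \<otimes>\<^bsub>HH (comp_of \<xi> d n \<chi>)\<^esub> h \<chi> = \<one>\<^bsub>HH (comp_of \<xi> d n \<chi>)\<^esub>
      \<and> h \<chi> \<otimes>\<^bsub>HH (comp_of \<xi> d n \<chi>)\<^esub> h' (pull n b \<chi>) = \<one>\<^bsub>HH (comp_of \<xi> d n \<chi>)\<^esub>"
proof -
  note mx = monomialD[OF x]
  let ?y = "inv\<^bsub>YH d n\<^esub> x"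
  have y: "?y \<in> carrier (YH d n)" using unit by (rule Y.palg.Units_inv_closed)
  have b': "perm_inv b permutes {1..n}" using mx(1) by (rule permutes_inv)
  have pull_inv: "pull n (perm_inv b) (pull n b \<chi>) = \<chi>" "pull n b (pull n (perm_inv b) \<chi>) = \<chi>"
    if "\<chi> \<in> Irr d n" for \<chi>
    using that mx(1) b' by (simp_all add: pull_pull permutes_inv_o Irr_extensional)
  define h' where "h' \<psi> = \<Psi> ?y (comp_of \<xi> d n \<psi>) \<psi> (pull n (perm_inv b) \<psi>)" for \<psi>
  have main: "\<Psi> ?y \<mu> (pull n b \<chi>) \<beta> = (if \<beta> = \<chi> then h' (pull n b \<chi>) else \<zero>\<^bsub>HH \<mu>\<^esub>)
      \<and> h' (pull n b \<chi>) \<otimes>\<^bsub>HH \<mu>\<^esub> h \<chi> = \<one>\<^bsub>HH \<mu>\<^esub> \<and> h \<chi> \<otimes>\<^bsub>HH \<mu>\<^esub> h' (pull n b \<chi>) = \<one>\<^bsub>HH \<mu>\<^esub>"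
    if \<chi>: "\<chi> \<in> Irr d n" and \<mu>: "\<mu> = comp_of \<xi> d n \<chi>" and \<beta>: "\<beta> \<in> Irr_comp \<xi> d n \<mu>" for \<chi> \<mu> \<beta>
  proof -
    let ?c = "pull n b \<chi>" and ?I = "Irr_comp \<xi> d n \<mu>"
    have c: "?c \<in> ?I" "?c \<in> Irr d n" "\<mu> = comp_of \<xi> d n ?c"
      using \<mu> \<chi> mx(1) by (simp_all add: pull_Irr_comp pull_Irr comp_of_pull)
    have \<chi>I: "\<chi> \<in> ?I" and in_comps: "\<mu> \<in> comps d n" using \<mu> \<chi> by simp_all
    have h: "h \<chi> \<in> carrier (HH \<mu>)" using monomial_entry_closed[OF x \<chi>] \<mu> by simp
    have y_closed: "\<Psi> ?y \<mu> \<alpha> \<beta> \<in> carrier (HH \<mu>)" if "\<alpha> \<in> ?I" "\<beta> \<in> ?I" for \<alpha> \<beta>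
      using Psi_closed[OF y in_comps that] .
    have x_closed: "\<Psi> x \<mu> \<alpha> \<beta> \<in> carrier (HH \<mu>)" if "\<alpha> \<in> ?I" "\<beta> \<in> ?I" for \<alpha> \<beta>
      using Psi_closed[OF mx(2) in_comps that] .
    \<comment> \<open>From the row \<open>\<chi>\<close> of \<open>x * y = 1\<close>.\<close>
    have right: "h \<chi> \<otimes>\<^bsub>HH \<mu>\<^esub> \<Psi> ?y \<mu> ?c \<beta> = (if \<chi> = \<beta> then \<one>\<^bsub>HH \<mu>\<^esub> else \<zero>\<^bsub>HH \<mu>\<^esub>)" if \<beta>: "\<beta> \<in> ?I" for \<beta>
    proof -
      have "(if \<chi> = \<beta> then \<one>\<^bsub>HH \<mu>\<^esub> else \<zero>\<^bsub>HH \<mu>\<^esub>) = \<Psi> (x \<otimes>\<^bsub>YH d n\<^esub> ?y) \<mu> \<chi> \<beta>"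
        using Psi_one[OF in_comps \<chi>I \<beta>] unit by (simp add: Y.palg.Units_r_inv)
      also have "\<dots> = finsum (HH \<mu>) (\<lambda>j. \<Psi> x \<mu> \<chi> j \<otimes>\<^bsub>HH \<mu>\<^esub> \<Psi> ?y \<mu> j \<beta>) ?I"
        using mx(2) y in_comps \<chi>I \<beta> by (rule Psi_mult)
      also have "\<dots> = finsum (HH \<mu>)
          (\<lambda>j. if ?c = j then h \<chi> \<otimes>\<^bsub>HH \<mu>\<^esub> \<Psi> ?y \<mu> j \<beta> else \<zero>\<^bsub>HH \<mu>\<^esub>) ?I"
        using mx(3)[OF \<mu> \<chi>] y_closed \<beta> h by (intro H.palg.finsum_cong') auto
      also have "\<dots> = h \<chi> \<otimes>\<^bsub>HH \<mu>\<^esub> \<Psi> ?y \<mu> ?c \<beta>"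
        using c h y_closed \<beta> d_pos by (subst H.palg.finsum_singleton) (auto simp: finite_Irr_comp)
      finally show ?thesis ..
    qed
    \<comment> \<open>From the entry \<open>(\<chi> \<circ> b, \<chi> \<circ> b)\<close> of \<open>y * x = 1\<close>.\<close>
    have left: "\<Psi> ?y \<mu> ?c \<chi> \<otimes>\<^bsub>HH \<mu>\<^esub> h \<chi> = \<one>\<^bsub>HH \<mu>\<^esub>"
    proof -
      have entry: "\<Psi> x \<mu> j ?c = (if \<chi> = j then h \<chi> else \<zero>\<^bsub>HH \<mu>\<^esub>)" if j: "j \<in> ?I" for j
      proof -
        have "?c = pull n b j \<longleftrightarrow> \<chi> = j"
          using pull_inv(1)[OF \<chi>] pull_inv(1)[of j] Irr_compD[OF j] by metis
        then show ?thesis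
          using mx(3)[of \<mu> j ?c] Irr_compD[OF j] c by simp
      qed
      have "\<one>\<^bsub>HH \<mu>\<^esub> = \<Psi> (?y \<otimes>\<^bsub>YH d n\<^esub> x) \<mu> ?c ?c"
        using Psi_one[OF in_comps c(1) c(1)] unit by (simp add: Y.palg.Units_l_inv)
      also have "\<dots> = finsum (HH \<mu>) (\<lambda>j. \<Psi> ?y \<mu> ?c j \<otimes>\<^bsub>HH \<mu>\<^esub> \<Psi> x \<mu> j ?c) ?I"
        using y mx(2) in_comps c(1) c(1) by (rule Psi_mult)
      also have "\<dots> = finsum (HH \<mu>)
          (\<lambda>j. if \<chi> = j then \<Psi> ?y \<mu> ?c j \<otimes>\<^bsub>HH \<mu>\<^esub> h \<chi> else \<zero>\<^bsub>HH \<mu>\<^esub>) ?I"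
        using entry y_closed c h by (intro H.palg.finsum_cong') auto
      also have "\<dots> = \<Psi> ?y \<mu> ?c \<chi> \<otimes>\<^bsub>HH \<mu>\<^esub> h \<chi>"
        using c h y_closed \<chi>I d_pos by (subst H.palg.finsum_singleton) (auto simp: finite_Irr_comp)
      finally show ?thesis ..
    qed
    have h'_eq: "h' ?c = \<Psi> ?y \<mu> ?c \<chi>"
      using c(3) pull_inv(1)[OF \<chi>] by (simp add: h'_def)
    have "\<Psi> ?y \<mu> ?c \<beta> = \<zero>\<^bsub>HH \<mu>\<^esub>" if "\<beta> \<noteq> \<chi>"
    proof -
      have "\<Psi> ?y \<mu> ?c \<beta> = (\<Psi> ?y \<mu> ?c \<chi> \<otimes>\<^bsub>HH \<mu>\<^esub> h \<chi>) \<otimes>\<^bsub>HH \<mu>\<^esub> \<Psi> ?y \<mu> ?c \<beta>"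
        using left y_closed c(1) \<beta> by simp
      also have "\<dots> = \<Psi> ?y \<mu> ?c \<chi> \<otimes>\<^bsub>HH \<mu>\<^esub> (h \<chi> \<otimes>\<^bsub>HH \<mu>\<^esub> \<Psi> ?y \<mu> ?c \<beta>)"
        using y_closed c(1) \<beta> \<chi>I h by (simp add: H.palg.m_assoc)
      also have "\<dots> = \<zero>\<^bsub>HH \<mu>\<^esub>"
        using right[OF \<beta>] that y_closed c(1) \<chi>I by auto
      finally show ?thesis .
    qed
    then show ?thesis
      using left right[OF \<chi>I] by (simp add: h'_eq)
  qed
  show thesis
  proof
    show "monomial (perm_inv b) h' ?y"
      unfolding monomial_def
    proof (intro conjI ballI b' y)
      fix \<psi> \<beta> assume \<psi>: "\<psi> \<in> Irr d n" and \<beta>: "\<beta> \<in> Irr_comp \<xi> d n (comp_of \<xi> d n \<psi>)"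
      let ?\<chi> = "pull n (perm_inv b) \<psi>"
      have "?\<chi> \<in> Irr d n" "comp_of \<xi> d n ?\<chi> = comp_of \<xi> d n \<psi>"
        using \<psi> b' by (simp_all add: pull_Irr comp_of_pull)
      with main[of ?\<chi> "comp_of \<xi> d n \<psi>" \<beta>] \<beta> pull_inv(2)[OF \<psi>]
      show "\<Psi> ?y (comp_of \<xi> d n \<psi>) \<psi> \<beta> =
          (if \<beta> = ?\<chi> then h' \<psi> else \<zero>\<^bsub>HH (comp_of \<xi> d n \<psi>)\<^esub>)" by simp
    qed
    show "\<forall>\<chi>\<in>Irr d n. h' (pull n b \<chi>) \<otimes>\<^bsub>HH (comp_of \<xi> d n \<chi>)\<^esub> h \<chi> = \<one>\<^bsub>HH (comp_of \<xi> d n \<chi>)\<^esub>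
      \<and> h \<chi> \<otimes>\<^bsub>HH (comp_of \<xi> d n \<chi>)\<^esub> h' (pull n b \<chi>) = \<one>\<^bsub>HH (comp_of \<xi> d n \<chi>)\<^esub>"
      using main[OF _ refl comp_Irr(2)] by blast
  qed
qed

end

section \<open>The images of the generators\<close>

text \<open>The entry of \<open>Psi_val \<xi> d n \<chi> lam w\<close> in the row \<open>\<chi>\<close> and the column $w(\chi)$.\<close>

definition Psi_entry ::
  "(nat \<Rightarrow> complex) \<Rightarrow> nat \<Rightarrow> nat \<Rightarrow> (nat \<Rightarrow> int) \<Rightarrow> (nat \<Rightarrow> nat) \<Rightarrow> chr \<Rightarrow> talg set" where
  "Psi_entry \<xi> d n lam w \<chi> =
     (let \<mu> = comp_of \<xi> d n \<chi>;
          \<pi> = pi_chi \<xi> d n \<chi>;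
          \<sigma> = perm_inv \<pi> \<circ> perm_inv w \<circ> pi_chi \<xi> d n (act n w \<chi>)
      in hcls \<mu> (scal (u_pow (int (len n (perm_inv w)) - int (len n \<sigma>)))) \<otimes>\<^bsub>HH \<mu>\<^esub>
            (lprod (HH \<mu>) (map (\<lambda>j. X_bar \<mu> (perm_inv \<pi> j) [^]\<^bsub>HH \<mu>\<^esub> lam j) [1..<Suc n])
             \<otimes>\<^bsub>HH \<mu>\<^esub> g_bar n \<mu> \<sigma>))"

text \<open>The entry in the row \<open>\<chi>\<close> of the image of $\sigma_i$. As $e_i$ acts on this row by 1 if \<open>\<chi>\<close> takes
  the same value at \<open>i\<close> and \<open>i + 1\<close> and by 0 otherwise, $\gamma + (1 - \gamma) e_i$ acts by 1 or by
  $\gamma$.\<close>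

definition gen_entry :: "(nat \<Rightarrow> complex) \<Rightarrow> nat \<Rightarrow> nat \<Rightarrow> nat \<Rightarrow> chr \<Rightarrow> talg set" where
  "gen_entry \<xi> d n i \<chi> =
     (if i = 0 then Psi_entry \<xi> d n (\<lambda>j. if j = 1 then 1 else 0) id \<chi>
      else hcls (comp_of \<xi> d n \<chi>) (scal (if \<chi> i = \<chi> (Suc i) then 1 else gamma_ind))
        \<otimes>\<^bsub>HH (comp_of \<xi> d n \<chi>)\<^esub> Psi_entry \<xi> d n (\<lambda>_. 0) (transpose i (Suc i)) \<chi>)"

lemma Psi_val_eq:
  "Psi_val \<xi> d n \<chi> lam w = mat_unit \<xi> d n \<chi> (act n w \<chi>) (Psi_entry \<xi> d n lam w \<chi>)"
  by (simp add: Psi_val_def Psi_entry_def Let_def)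

lemma lprod_simps [simp]:
  "lprod A [] = \<one>\<^bsub>A\<^esub>" "lprod A (x # xs) = x \<otimes>\<^bsub>A\<^esub> lprod A xs"
  by (simp_all add: lprod_def)

lemma lprod_one:
  assumes "ring A" "\<And>x. x \<in> set xs \<Longrightarrow> f x = \<one>\<^bsub>A\<^esub>"
  shows "lprod A (map f xs) = \<one>\<^bsub>A\<^esub>"
proof -
  interpret ring A by (rule assms(1))
  show ?thesis using assms(2) by (induction xs) simp_all
qed

lemma u_pow_0: "u_pow 0 = 1"
  by (simp add: u_pow_def flip: zero_prod_def)

context matrix_iso
begin

lemma X_mon_0: "X_mon d n (\<lambda>_. 0) = \<one>\<^bsub>YH d n\<^esub>"
  unfolding X_mon_def by (rule lprod_one[OF Y.palg.ring_axioms]) (simp add: int_pow_0)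

lemma X_mon_1: "X_mon d n (\<lambda>j. if j = 1 then 1 else 0) = ycls d n (gn X)"
proof -
  have "lprod (YH d n) (map (\<lambda>j. ycls d n (X_elt j) [^]\<^bsub>YH d n\<^esub> (if j = 1 then 1 else 0 :: int)) [Suc 1..<Suc n])
      = \<one>\<^bsub>YH d n\<^esub>"
    by (rule lprod_one[OF Y.palg.ring_axioms]) (auto simp: int_pow_0)
  moreover have "[1..<Suc n] = 1 # [Suc 1..<Suc n]"
    using n_pos by (simp add: upt_conv_Cons)
  moreover have "ycls d n (gn X) [^]\<^bsub>YH d n\<^esub> (1::int) = ycls d n (gn X)"
    using n_pos by (simp add: int_pow_def2 Y.pcls_closed)
  ultimately show ?thesis
    using n_pos by (simp add: X_mon_def del: upt_Suc)
qed

lemma g_elt_id: "g_elt d n id = \<one>\<^bsub>YH d n\<^esub>"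
  by (simp add: g_elt_def)

lemma g_elt_transpose: "i \<in> {1..<n} \<Longrightarrow> g_elt d n (transpose i (Suc i)) = ycls d n (gn (G i))"
  unfolding g_elt_def reduced_word_transpose by (simp add: Y.pcls_closed)

lemma Psi_E:
  assumes "\<chi> \<in> Irr d n"
  shows "\<Psi> (E_elt d n \<chi>) = mat_unit \<xi> d n \<chi> \<chi> \<one>\<^bsub>HH (comp_of \<xi> d n \<chi>)\<^esub>"
proof -
  let ?\<mu> = "comp_of \<xi> d n \<chi>"
  have act: "act n id \<chi> = \<chi>"
    using Irr_extensional[OF assms] by (simp add: act_eq_pull)
  have one: "lprod (HH ?\<mu>) (map (\<lambda>j. \<one>\<^bsub>HH ?\<mu>\<^esub>) ks) = \<one>\<^bsub>HH ?\<mu>\<^esub>" for ks :: "nat list"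
    by (rule lprod_one[OF H.palg.ring_axioms]) simp
  have "perm_inv (pi_chi \<xi> d n \<chi>) \<circ> perm_inv id \<circ> pi_chi \<xi> d n (act n id \<chi>) = id"
    using permutes_inv_o(2)[OF pi_chi(1)[OF assms]] by (simp add: act)
  then have "Psi_entry \<xi> d n (\<lambda>_. 0) id \<chi> = \<one>\<^bsub>HH ?\<mu>\<^esub>"
    by (simp add: Psi_entry_def Let_def one int_pow_0 u_pow_0 H.pcls_one g_bar_def del: upt_Suc)
  moreover have "\<Psi> (E_elt d n \<chi> \<otimes>\<^bsub>YH d n\<^esub> (X_mon d n (\<lambda>_. 0) \<otimes>\<^bsub>YH d n\<^esub> g_elt d n (perm_inv id)))
      = Psi_val \<xi> d n \<chi> (\<lambda>_. 0) id"
    using is_Psi assms permutes_id unfolding is_Psi_def by blast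
  ultimately show ?thesis
    by (simp add: X_mon_0 g_elt_id Psi_val_eq act)
qed

text \<open>Multiplication by $E_\chi$ isolates the row \<open>\<chi>\<close>, so the prescribed image of $E_\chi X^\lambda g_{w^{-1}}$
  gives every row of the image of $X^\lambda g_{w^{-1}}$.\<close>

lemma Psi_E_row:
  assumes "\<chi> \<in> Irr d n" "x \<in> carrier (YH d n)" "\<mu> = comp_of \<xi> d n \<chi>" "\<beta> \<in> Irr_comp \<xi> d n \<mu>"
  shows "\<Psi> (E_elt d n \<chi> \<otimes>\<^bsub>YH d n\<^esub> x) \<mu> \<chi> \<beta> = \<Psi> x \<mu> \<chi> \<beta>"
proof -
  let ?I = "Irr_comp \<xi> d n \<mu>"
  have \<mu>: "\<mu> \<in> comps d n" "\<chi> \<in> ?I" using assms(1,3) by simp_all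
  have x_closed: "\<Psi> x \<mu> j \<beta> \<in> carrier (HH \<mu>)" if "j \<in> ?I" for j
    using Psi_closed[OF assms(2) \<mu>(1) that assms(4)] .
  have "\<Psi> (E_elt d n \<chi> \<otimes>\<^bsub>YH d n\<^esub> x) \<mu> \<chi> \<beta> =
      finsum (HH \<mu>) (\<lambda>j. \<Psi> (E_elt d n \<chi>) \<mu> \<chi> j \<otimes>\<^bsub>HH \<mu>\<^esub> \<Psi> x \<mu> j \<beta>) ?I"
    using assms(2,4) \<mu> by (intro Psi_mult) simp_all
  also have "\<dots> = finsum (HH \<mu>) (\<lambda>j. if \<chi> = j then \<Psi> x \<mu> j \<beta> else \<zero>\<^bsub>HH \<mu>\<^esub>) ?I"
    using x_closed \<mu> unfolding Psi_E[OF assms(1)] assms(3)[symmetric]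
    by (intro H.palg.finsum_cong') (auto simp: mat_unit_def)
  also have "\<dots> = \<Psi> x \<mu> \<chi> \<beta>"
    using x_closed \<mu> d_pos by (subst H.palg.finsum_singleton) (auto simp: finite_Irr_comp)
  finally show ?thesis .
qed

lemma monomial_basis:
  assumes "w permutes {1..n}" "X_mon d n lam \<otimes>\<^bsub>YH d n\<^esub> g_elt d n (perm_inv w) = x"
    "x \<in> carrier (YH d n)"
  shows "monomial (perm_inv w) (Psi_entry \<xi> d n lam w) x"
  unfolding monomial_def
proof (intro conjI ballI)
  fix \<chi> \<beta> assume \<chi>: "\<chi> \<in> Irr d n" and \<beta>: "\<beta> \<in> Irr_comp \<xi> d n (comp_of \<xi> d n \<chi>)"
  have "\<Psi> x (comp_of \<xi> d n \<chi>) \<chi> \<beta> = \<Psi> (E_elt d n \<chi> \<otimes>\<^bsub>YH d n\<^esub> x) (comp_of \<xi> d n \<chi>) \<chi> \<beta>"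
    using Psi_E_row[OF \<chi> assms(3) refl \<beta>] ..
  also have "\<Psi> (E_elt d n \<chi> \<otimes>\<^bsub>YH d n\<^esub> x) = Psi_val \<xi> d n \<chi> lam w"
    using is_Psi \<chi> assms(1) unfolding is_Psi_def assms(2)[symmetric] by blast
  finally show "\<Psi> x (comp_of \<xi> d n \<chi>) \<chi> \<beta> = (if \<beta> = pull n (perm_inv w) \<chi>
      then Psi_entry \<xi> d n lam w \<chi> else \<zero>\<^bsub>HH (comp_of \<xi> d n \<chi>)\<^esub>)"
    using \<chi> \<beta> by (simp add: Psi_val_eq mat_unit_def act_eq_pull)
qed (use assms permutes_inv in auto)

lemma monomial_G:
  assumes "i \<in> {1..<n}"
  shows "monomial (transpose i (Suc i)) (Psi_entry \<xi> d n (\<lambda>_. 0) (transpose i (Suc i))) (ycls d n (gn (G i)))"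
proof -
  have "ycls d n (gn (G i)) \<in> carrier (YH d n)"
    using assms by (simp add: Y.pcls_closed)
  then show ?thesis
    using monomial_basis[OF transpose_Suc_permutes[OF assms], of "\<lambda>_. 0" "ycls d n (gn (G i))"] assms
    by (simp add: X_mon_0 g_elt_transpose)
qed

lemma monomial_X:
  "monomial id (Psi_entry \<xi> d n (\<lambda>j. if j = 1 then 1 else 0) id) (ycls d n (gn X))"
proof -
  have "ycls d n (gn X) \<in> carrier (YH d n)"
    using n_pos by (simp add: Y.pcls_closed)
  then show ?thesis
    using monomial_basis[OF permutes_id, of "\<lambda>j. if j = 1 then 1 else 0" "ycls d n (gn X)"]
    by (simp only: X_mon_1 g_elt_id inv_id Y.palg.r_one simp_thms)
qed

text \<open>The image of \<open>y\<close> is diagonal with scalar entries, as is the case for all elements of the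
  commutative subalgebra generated by the $t_j$.\<close>

definition diagonal :: "(chr \<Rightarrow> laurent) \<Rightarrow> falg \<Rightarrow> bool" where
  "diagonal c y \<longleftrightarrow> y \<in> carrier (malg (lists (gens n))) \<and>
     monomial id (\<lambda>\<chi>. hcls (comp_of \<xi> d n \<chi>) (scal (c \<chi>))) (ycls d n y)"

lemma monomial_cong:
  "monomial b h x \<Longrightarrow> (\<And>\<chi>. \<chi> \<in> Irr d n \<Longrightarrow> h \<chi> = h' \<chi>) \<Longrightarrow> monomial b h' x"
  by (simp add: monomial_def)

lemma diagonal_cong:
  "diagonal c y \<Longrightarrow> (\<And>\<chi>. \<chi> \<in> Irr d n \<Longrightarrow> c \<chi> = c' \<chi>) \<Longrightarrow> diagonal c' y"
  by (auto simp: diagonal_def intro: monomial_cong)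

lemma diagonal_scal: "diagonal (\<lambda>_. r) (scal r)"
  unfolding diagonal_def monomial_def
proof (intro conjI ballI)
  fix \<chi> \<beta> assume \<chi>: "\<chi> \<in> Irr d n" and \<beta>: "\<beta> \<in> Irr_comp \<xi> d n (comp_of \<xi> d n \<chi>)"
  let ?\<mu> = "comp_of \<xi> d n \<chi>"
  have "\<Psi> (ycls d n (scal r)) ?\<mu> \<chi> \<beta> = \<Psi> (ycls d n (scal r) \<otimes>\<^bsub>YH d n\<^esub> \<one>\<^bsub>YH d n\<^esub>) ?\<mu> \<chi> \<beta>"
    by (simp add: Y.pcls_closed)
  also have "\<dots> = hcls ?\<mu> (scal r) \<otimes>\<^bsub>HH ?\<mu>\<^esub> \<Psi> \<one>\<^bsub>YH d n\<^esub> ?\<mu> \<chi> \<beta>"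
    using \<chi> \<beta> by (intro Psi_scal) simp_all
  also have "\<dots> = (if \<beta> = \<chi> then hcls ?\<mu> (scal r) else \<zero>\<^bsub>HH ?\<mu>\<^esub>)"
    using \<chi> \<beta> by (simp add: Psi_one H.pcls_closed)
  finally show "\<Psi> (ycls d n (scal r)) ?\<mu> \<chi> \<beta> =
      (if \<beta> = pull n id \<chi> then hcls ?\<mu> (scal r) else \<zero>\<^bsub>HH ?\<mu>\<^esub>)"
    using \<chi> by (simp add: Irr_extensional)
qed (simp_all add: permutes_id Y.pcls_closed)

lemma diagonal_mult:
  assumes "diagonal c x" "diagonal c' y"
  shows "diagonal (\<lambda>\<chi>. c \<chi> * c' \<chi>) (x * y)"
proof -
  have xy: "x \<in> carrier (malg (lists (gens n)))" "y \<in> carrier (malg (lists (gens n)))"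
    using assms by (simp_all add: diagonal_def)
  have m: "monomial id (\<lambda>\<chi>. hcls (comp_of \<xi> d n \<chi>) (scal (c \<chi>))) (ycls d n x)"
      "monomial id (\<lambda>\<chi>. hcls (comp_of \<xi> d n \<chi>) (scal (c' \<chi>))) (ycls d n y)"
    using assms by (simp_all add: diagonal_def)
  have "monomial id (\<lambda>\<chi>. hcls (comp_of \<xi> d n \<chi>) (scal (c \<chi> * c' \<chi>))) (ycls d n (x * y))"
    using monomial_mult[OF m] unfolding Y.pcls_mult[OF xy] comp_id
    by (rule monomial_cong) (simp add: Irr_extensional hcls_scal_mult)
  then show ?thesis
    using xy by (simp add: diagonal_def)
qed

lemma diagonal_add:
  assumes "diagonal c x" "diagonal c' y"
  shows "diagonal (\<lambda>\<chi>. c \<chi> + c' \<chi>) (x + y)"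
proof -
  have xy: "x \<in> carrier (malg (lists (gens n)))" "y \<in> carrier (malg (lists (gens n)))"
    and m: "monomial id (\<lambda>\<chi>. hcls (comp_of \<xi> d n \<chi>) (scal (c \<chi>))) (ycls d n x)"
      "monomial id (\<lambda>\<chi>. hcls (comp_of \<xi> d n \<chi>) (scal (c' \<chi>))) (ycls d n y)"
    using assms by (simp_all add: diagonal_def)
  note mx = monomialD[OF m(1)] and my = monomialD[OF m(2)]
  show ?thesis
    unfolding diagonal_def monomial_def Y.pcls_add[OF xy]
  proof (intro conjI ballI)
    fix \<chi> \<beta> assume \<chi>: "\<chi> \<in> Irr d n" and \<beta>: "\<beta> \<in> Irr_comp \<xi> d n (comp_of \<xi> d n \<chi>)"
    let ?\<mu> = "comp_of \<xi> d n \<chi>"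
    have "\<Psi> (ycls d n x \<oplus>\<^bsub>YH d n\<^esub> ycls d n y) ?\<mu> \<chi> \<beta>
        = \<Psi> (ycls d n x) ?\<mu> \<chi> \<beta> \<oplus>\<^bsub>HH ?\<mu>\<^esub> \<Psi> (ycls d n y) ?\<mu> \<chi> \<beta>"
      using \<chi> \<beta> mx(2) my(2) by (intro Psi_add) simp_all
    then show "\<Psi> (ycls d n x \<oplus>\<^bsub>YH d n\<^esub> ycls d n y) ?\<mu> \<chi> \<beta> =
        (if \<beta> = pull n id \<chi> then hcls ?\<mu> (scal (c \<chi> + c' \<chi>)) else \<zero>\<^bsub>HH ?\<mu>\<^esub>)"
      using mx(3)[OF refl \<chi> \<beta>] my(3)[OF refl \<chi> \<beta>] by (simp add: hcls_scal_add)
  qed (use xy mx(2) my(2) in \<open>simp_all add: permutes_id\<close>)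
qed

lemma diagonal_sum:
  "finite K \<Longrightarrow> (\<And>a. a \<in> K \<Longrightarrow> diagonal (c a) (f a)) \<Longrightarrow> diagonal (\<lambda>\<chi>. \<Sum>a\<in>K. c a \<chi>) (\<Sum>a\<in>K. f a)"
proof (induction K rule: finite_induct)
  case empty
  show ?case using diagonal_scal[of 0] by simp
qed (simp add: diagonal_add)

lemma diagonal_power: "diagonal c y \<Longrightarrow> diagonal (\<lambda>\<chi>. c \<chi> ^ k) (y ^ k)"
proof (induction k)
  case 0
  show ?case using diagonal_scal[of 1] by simp
qed (simp add: diagonal_mult)

lemma diagonal_T:
  assumes j: "j \<in> {1..n}"
  shows "diagonal (\<lambda>\<chi>. const_R (\<chi> j)) (gn (T j))"
proof -
  have T: "ycls d n (gn (T j)) \<in> carrier (YH d n)"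
    using j by (simp add: Y.pcls_closed)
  have "\<Psi> (ycls d n (gn (T j))) (comp_of \<xi> d n \<chi>) \<chi> \<beta> =
      (if \<beta> = pull n id \<chi> then hcls (comp_of \<xi> d n \<chi>) (scal (const_R (\<chi> j))) else \<zero>\<^bsub>HH (comp_of \<xi> d n \<chi>)\<^esub>)"
    if \<chi>: "\<chi> \<in> Irr d n" and \<beta>: "\<beta> \<in> Irr_comp \<xi> d n (comp_of \<xi> d n \<chi>)" for \<chi> \<beta>
  proof -
    let ?\<mu> = "comp_of \<xi> d n \<chi>"
    have "\<Psi> (ycls d n (gn (T j))) ?\<mu> \<chi> \<beta> = \<Psi> (E_elt d n \<chi> \<otimes>\<^bsub>YH d n\<^esub> ycls d n (gn (T j))) ?\<mu> \<chi> \<beta>"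
      using Psi_E_row[OF \<chi> T refl \<beta>] ..
    also have "\<dots> = hcls ?\<mu> (scal (const_R (\<chi> j))) \<otimes>\<^bsub>HH ?\<mu>\<^esub> \<Psi> (E_elt d n \<chi>) ?\<mu> \<chi> \<beta>"
      unfolding E_elt_T[OF \<chi> j d_pos] using \<chi> \<beta> by (intro Psi_scal) simp_all
    finally show ?thesis
      using \<chi> \<beta> by (simp add: Psi_E mat_unit_def Irr_extensional H.pcls_closed)
  qed
  then show ?thesis
    using T j by (simp add: diagonal_def monomial_def permutes_id)
qed

text \<open>For \<open>a \<noteq> b\<close>, multiplication by $a - b$ turns the sum into $a (a^d - b^d) = 0$.\<close>

lemma root_sum:
  assumes "a ^ d = (1::complex)" "b ^ d = 1"
  shows "(\<Sum>s=1..d. a ^ s * b ^ (d - s)) = (if a = b then of_nat d else 0)"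
proof (cases "a = b")
  case True
  then have "(\<Sum>s=1..d. a ^ s * b ^ (d - s)) = (\<Sum>s=1..d. 1)"
    using assms by (intro sum.cong) (simp_all flip: power_add)
  then show ?thesis using True by simp
next
  case False
  have "(\<Sum>s=1..d. a ^ s * b ^ (d - s)) = (\<Sum>s<d. a ^ Suc s * b ^ (d - Suc s))"
    using sum.atLeast1_atMost_eq[of "\<lambda>s. a ^ s * b ^ (d - s)" d] by simp
  also have "\<dots> = a * (\<Sum>s<d. b ^ (d - Suc s) * a ^ s)"
    by (simp add: sum_distrib_left mult_ac)
  also have "(\<Sum>s<d. b ^ (d - Suc s) * a ^ s) = 0"
    using power_diff_sumr2[of a d b] assms False by simp
  finally show ?thesis using False by simp
qed

lemma diagonal_e:
  assumes i: "i \<in> {1..<n}"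
  shows "diagonal (\<lambda>\<chi>. if \<chi> i = \<chi> (Suc i) then 1 else 0) (e_elt d i)"
proof -
  have "diagonal (\<lambda>\<chi>. const_R (1 / of_nat d) *
      (\<Sum>s=1..d. const_R (\<chi> i) ^ s * const_R (\<chi> (Suc i)) ^ (d - s))) (e_elt d i)"
    unfolding e_elt_def using i
    by (intro diagonal_mult diagonal_sum diagonal_scal diagonal_power diagonal_T) simp_all
  then show ?thesis
  proof (rule diagonal_cong)
    fix \<chi> assume "\<chi> \<in> Irr d n"
    then have "\<chi> i ^ d = 1" "\<chi> (Suc i) ^ d = 1"
      using i by (auto intro: chr_root)
    from root_sum[OF this] show "const_R (1 / of_nat d) *
        (\<Sum>s=1..d. const_R (\<chi> i) ^ s * const_R (\<chi> (Suc i)) ^ (d - s)) = (if \<chi> i = \<chi> (Suc i) then 1 else 0)"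
      unfolding const_R_power const_R_mult const_R_sum using d_pos by simp
  qed
qed

text \<open>The product of the two elements has the image of 1, and \<open>\<Psi>\<close> is injective.\<close>

lemma diagonal_unit:
  assumes "diagonal c y" "diagonal c' y'" "\<And>\<chi>. \<chi> \<in> Irr d n \<Longrightarrow> c \<chi> * c' \<chi> = 1"
  shows "ycls d n y \<in> Units (YH d n)"
proof -
  have y: "y \<in> carrier (malg (lists (gens n)))" "y' \<in> carrier (malg (lists (gens n)))"
    using assms by (simp_all add: diagonal_def)
  have one: "monomial id (\<lambda>\<chi>. hcls (comp_of \<xi> d n \<chi>) (scal 1)) (ycls d n 1)"
    using diagonal_scal[of 1] by (simp add: diagonal_def)
  have "ycls d n (y * y') = ycls d n 1" "ycls d n (y' * y) = ycls d n 1"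
    using diagonal_mult[OF assms(1,2)] diagonal_mult[OF assms(2,1)] assms(3)
    by (auto simp: diagonal_def mult.commute intro!: monomial_eqI[OF _ one])
  then show ?thesis
    using y unfolding Units_def by (auto simp: Y.pcls_mult Y.pcls_one Y.pcls_closed)
qed

text \<open>The elements $e_i$ and $g_i$ commute: this can be read off the matrices, since \<open>\<chi>\<close> takes equal
  values at \<open>i\<close> and \<open>i + 1\<close> if and only if $s_i(\chi)$ does. The quadratic relation therefore factors
  from both sides, and the inverse of $g_i$ is $u^{-2} (g_i - v e_i)$.\<close>

lemma G_unit:
  assumes i: "i \<in> {1..<n}"
  shows "ycls d n (gn (G i)) \<in> Units (YH d n)"
proof -
  let ?g = "gn (G i)" and ?e = "e_elt d i"
  have c: "?g \<in> carrier (malg (lists (gens n)))" "?e \<in> carrier (malg (lists (gens n)))"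
    using i by simp_all
  have "ycls d n (?e * ?g) = ycls d n (?g * ?e)"
  proof -
    have e: "monomial id (\<lambda>\<chi>. hcls (comp_of \<xi> d n \<chi>) (scal (if \<chi> i = \<chi> (Suc i) then 1 else 0))) (ycls d n ?e)"
      using diagonal_e[OF i] by (simp add: diagonal_def)
    note eg = monomial_mult[OF e monomial_G[OF i]] and ge = monomial_mult[OF monomial_G[OF i] e]
    show ?thesis
      unfolding Y.pcls_mult[OF c] Y.pcls_mult[OF c(2,1)]
    proof (rule monomial_eqI[OF eg[unfolded id_comp] ge[unfolded comp_id]])
      fix \<chi> assume \<chi>: "\<chi> \<in> Irr d n"
      let ?s = "transpose i (Suc i)"
      have "pull n ?s \<chi> i = \<chi> (Suc i)" "pull n ?s \<chi> (Suc i) = \<chi> i"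
        using i by (simp_all add: pull_def)
      moreover have "comp_of \<xi> d n (pull n ?s \<chi>) = comp_of \<xi> d n \<chi>"
        using transpose_Suc_permutes[OF i] by (rule comp_of_pull)
      ultimately show "hcls (comp_of \<xi> d n \<chi>) (scal (if \<chi> i = \<chi> (Suc i) then 1 else 0)) \<otimes>\<^bsub>HH (comp_of \<xi> d n \<chi>)\<^esub>
           Psi_entry \<xi> d n (\<lambda>_. 0) ?s (pull n id \<chi>) =
           Psi_entry \<xi> d n (\<lambda>_. 0) ?s \<chi> \<otimes>\<^bsub>HH (comp_of \<xi> d n \<chi>)\<^esub>
           hcls (comp_of \<xi> d n (pull n ?s \<chi>)) (scal (if pull n ?s \<chi> i = pull n ?s \<chi> (Suc i) then 1 else 0))"
        using monomial_entry_closed[OF monomial_G[OF i] \<chi>] \<chi>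
        by (simp add: Irr_extensional hcls_scal_0[simplified] hcls_scal_1[simplified] eq_commute)
    qed
  qed
  then have comm: "Y.eqv n d (scal v_ind * (?e * ?g)) (scal v_ind * (?g * ?e))"
    using c by (intro Y.eqv_mult[OF Y.eqv_refl]) (simp_all add: Y.eqv_def)
  have quad: "Y.eqv n d (?g * ?g) (scal (u_pow 2) + scal v_ind * (?e * ?g))"
    using c yrel.quadratic[OF i, of d]
    by (intro Y.eqv_relation) (simp_all add: power2_eq_square mult.assoc)
  define y where "y = scal (u_pow (- 2)) * (?g - scal v_ind * ?e)"
  have y: "y \<in> carrier (malg (lists (gens n)))" using c by (simp add: y_def)
  have u: "scal (u_pow (- 2)) * scal (u_pow 2) = 1"
    by (simp add: scal_mult u_pow_def mult_single flip: zero_prod_def)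
  have "Y.eqv n d (scal (u_pow (- 2)) * (?g * ?g + (- scal v_ind) * (?e * ?g)))
      (scal (u_pow (- 2)) * ((scal (u_pow 2) + scal v_ind * (?e * ?g)) + (- scal v_ind) * (?e * ?g)))"
    using c by (intro Y.eqv_mult[OF Y.eqv_refl Y.eqv_add[OF quad Y.eqv_refl]]) simp_all
  moreover have "scal (u_pow (- 2)) * (?g * ?g + (- scal v_ind) * (?e * ?g)) = y * ?g"
    by (simp add: y_def algebra_simps)
  ultimately have left: "Y.eqv n d (y * ?g) 1"
    by (simp add: u)
  have quad': "Y.eqv n d (?g * ?g) (scal (u_pow 2) + scal v_ind * (?g * ?e))"
    by (rule Y.eqv_trans[OF quad Y.eqv_add[OF Y.eqv_refl comm]]) simp
  have "Y.eqv n d (scal (u_pow (- 2)) * (?g * ?g + (- scal v_ind) * (?g * ?e)))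
      (scal (u_pow (- 2)) * ((scal (u_pow 2) + scal v_ind * (?g * ?e)) + (- scal v_ind) * (?g * ?e)))"
    using c by (intro Y.eqv_mult[OF Y.eqv_refl Y.eqv_add[OF quad' Y.eqv_refl]]) simp_all
  moreover have "scal (u_pow (- 2)) * (?g * ?g + (- scal v_ind) * (?g * ?e)) = ?g * y"
  proof -
    have "?g * (scal r * x) = scal r * (?g * x)" for r x
      using scal_central[of r ?g] by (simp flip: mult.assoc)
    then show ?thesis
      by (simp add: y_def right_diff_distrib distrib_left)
  qed
  ultimately have right: "Y.eqv n d (?g * y) 1"
    by (simp add: u)
  show ?thesis
    using left right c y unfolding Units_def
    by (auto simp: Y.eqv_def Y.pcls_mult Y.pcls_one Y.pcls_closed intro!: bexI[of _ "ycls d n y"])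
qed

lemma X_unit: "ycls d n (gn X) \<in> Units (YH d n)"
proof -
  have "ycls d n (gn X' * gn X) = ycls d n 1" "ycls d n (gn X * gn X') = ycls d n 1"
    using n_pos yrel.X_left_inv[OF n_pos, of d] yrel.X_right_inv[OF n_pos, of d]
    by (auto intro!: ycls_eq_of_eqv Y.eqv_relation)
  then show ?thesis
    using n_pos unfolding Units_def
    by (auto simp: Y.pcls_mult Y.pcls_one Y.pcls_closed intro!: bexI[of _ "ycls d n (gn X')"])
qed

text \<open>For a unit \<open>r\<close> the entries are units; \<open>r\<close> will be $\gamma$ and $\gamma^{-1}$.\<close>

lemma diagonal_framing:
  assumes "i \<in> {1..<n}"
  shows "diagonal (\<lambda>\<chi>. if \<chi> i = \<chi> (Suc i) then 1 else r) (scal r + scal (1 - r) * e_elt d i)"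
proof (rule diagonal_cong)
  show "diagonal (\<lambda>\<chi>. r + (1 - r) * (if \<chi> i = \<chi> (Suc i) then 1 else 0)) (scal r + scal (1 - r) * e_elt d i)"
    by (intro diagonal_add diagonal_mult diagonal_scal diagonal_e assms)
qed simp

lemma delta_gen_monomial:
  assumes "i < n"
  shows "monomial (bgen_perm (Sig i)) (gen_entry \<xi> d n i) (ycls d n (delta_gen d (Sig i)))"
    and "ycls d n (delta_gen d (Sig i)) \<in> Units (YH d n)"
proof -
  have "monomial (bgen_perm (Sig i)) (gen_entry \<xi> d n i) (ycls d n (delta_gen d (Sig i)))
    \<and> ycls d n (delta_gen d (Sig i)) \<in> Units (YH d n)"
  proof (cases "i = 0")
    case True
    then show ?thesis using monomial_X X_unit by (simp add: gen_entry_def[abs_def])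
  next
    case False
    then have i: "i \<in> {1..<n}" using assms by simp
    let ?f = "\<lambda>r. scal r + scal (1 - r) * e_elt d i"
    have f: "?f r \<in> carrier (malg (lists (gens n)))" for r using i by simp
    have g: "gn (G i) \<in> carrier (malg (lists (gens n)))" using i by simp
    have "monomial id (\<lambda>\<chi>. hcls (comp_of \<xi> d n \<chi>) (scal (if \<chi> i = \<chi> (Suc i) then 1 else gamma_ind)))
        (ycls d n (?f gamma_ind))"
      using diagonal_framing[OF i, of gamma_ind] by (simp add: diagonal_def)
    from monomial_mult[OF this monomial_G[OF i]]
    have 1: "monomial (transpose i (Suc i)) (gen_entry \<xi> d n i)
        (ycls d n (?f gamma_ind) \<otimes>\<^bsub>YH d n\<^esub> ycls d n (gn (G i)))"
      unfolding id_comp by (rule monomial_cong) (use False in \<open>simp add: gen_entry_def Irr_extensional\<close>)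
    have "gamma_ind * Poly_Mapping.single (0, 0, -1) 1 = 1"
      by (simp add: gamma_ind_def mult_single flip: zero_prod_def)
    then have "ycls d n (?f gamma_ind) \<in> Units (YH d n)"
      by (intro diagonal_unit[OF diagonal_framing[OF i]
            diagonal_framing[OF i, of "Poly_Mapping.single (0, 0, -1) 1"]]) simp
    then have 2: "ycls d n (?f gamma_ind) \<otimes>\<^bsub>YH d n\<^esub> ycls d n (gn (G i)) \<in> Units (YH d n)"
      using G_unit[OF i] by (rule Y.palg.Units_m_closed)
    show ?thesis
      using 1 2 False by (simp add: Y.pcls_mult[OF f g])
  qed
  then show "monomial (bgen_perm (Sig i)) (gen_entry \<xi> d n i) (ycls d n (delta_gen d (Sig i)))"
    "ycls d n (delta_gen d (Sig i)) \<in> Units (YH d n)" by simp_all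
qed

end

section \<open>Words of braids\<close>

lemma bword_perm_simps [simp]:
  "bword_perm [] = id"
  "bword_perm ((a, pos) # \<beta>) = (if pos then bgen_perm a else perm_inv (bgen_perm a)) \<circ> bword_perm \<beta>"
  by (simp_all add: bword_perm_def)

lemma delta_simps:
  "delta d n [] = \<one>\<^bsub>YH d n\<^esub>"
  "delta d n ((a, pos) # \<beta>) = (if pos then ycls d n (delta_gen d a)
      else inv\<^bsub>YH d n\<^esub> ycls d n (delta_gen d a)) \<otimes>\<^bsub>YH d n\<^esub> delta d n \<beta>"
  by (simp_all add: delta_def)

section \<open>Relabelling the roots of unity\<close>

text \<open>The subset \<open>S\<close> is \<open>p ` {1..k}\<close>. The bijection from \<open>{1..k}\<close> to \<open>S\<close> is extended to a permutation \<open>p\<close> of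
  \<open>{1..d}\<close>, so that composition with \<open>p\<close> is a bijection on families of words and on compositions. It is
  increasing on \<open>{1..k}\<close> so that it keeps the order of the blocks.\<close>

locale relabelling =
  source: matrix_iso \<xi> d n \<Psi> + target: matrix_iso \<xi>' k n \<Psi>'
  for \<xi> d n \<Psi> \<xi>' k \<Psi>' +
  fixes p :: "nat \<Rightarrow> nat"
  assumes p_permutes: "p permutes {1..d}" and k_le: "k \<le> d" and p_mono: "strict_mono_on {1..k} p"
begin

definition permute_factors :: "(nat \<Rightarrow> gen list) \<Rightarrow> (nat \<Rightarrow> gen list)" where "permute_factors f = f \<circ> p"

text \<open>The compositions of \<open>n\<close> whose non-zero parts have their index in \<open>S\<close>. These are the ones for
  which \<open>\<mu> \<circ> p\<close> is a \<open>k\<close>-composition.\<close>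

definition supported :: "(nat \<Rightarrow> nat) \<Rightarrow> bool" where
  "supported \<mu> \<longleftrightarrow> \<mu> \<in> comps d n \<and> (\<forall>a. \<mu> a \<noteq> 0 \<longrightarrow> a \<in> p ` {1..k})"

lemma p_inv [simp]: "perm_inv p (p a) = a" "p (perm_inv p a) = a"
  using permutes_inverses[OF p_permutes] by simp_all

lemma p_in: "b \<in> {1..k} \<Longrightarrow> p b \<in> {1..d}"
  using k_le permutes_in_image[OF p_permutes, of b] by auto

lemma p_inj: "p a = p b \<longleftrightarrow> a = b"
  using permutes_inj[OF p_permutes] by (simp add: inj_eq)

lemma p_image_iff: "p b \<in> p ` A \<longleftrightarrow> b \<in> A"
  by (rule inj_image_mem_iff[OF permutes_inj[OF p_permutes]])

lemma p_less_iff: "b \<in> {1..k} \<Longrightarrow> c \<in> {1..k} \<Longrightarrow> p b < p c \<longleftrightarrow> b < c"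
  using p_mono by (rule strict_mono_on_less)

lemma supportedD: "supported \<mu> \<Longrightarrow> \<mu> \<in> comps d n" "supported \<mu> \<Longrightarrow> a \<notin> p ` {1..k} \<Longrightarrow> \<mu> a = 0"
  unfolding supported_def by blast+

lemma push_permute_factors_at_factor: "push permute_factors (at_factor a x) = at_factor (perm_inv p a) x"
proof -
  have "permute_factors \<circ> (\<lambda>w. (\<lambda>_. [])(a := w)) = (\<lambda>w. (\<lambda>_. [])(perm_inv p a := w))"
    by (auto simp: fun_eq_iff permute_factors_def)
  then show ?thesis by (simp add: at_factor_eq_push push_push)
qed

text \<open>Permuting the tensor factors identifies $\widehat H^{\mu}$ with $\widehat H^{\mu \circ p}$.\<close>

lemma transport: "algebra_transport (hwords \<mu>) (hrel \<mu>) (hwords (\<mu> \<circ> p)) (hrel (\<mu> \<circ> p)) permute_factors (\<lambda>f. f \<circ> perm_inv p)"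
proof (intro algebra_transport.intro algebra_transport_axioms.intro H.presented_algebra_axioms)
  show "permute_factors 0 = 0" by (simp add: permute_factors_def zero_fun_def fun_eq_iff)
  show "permute_factors (a + b) = permute_factors a + permute_factors b" for a b by (simp add: permute_factors_def plus_fun_def fun_eq_iff)
  show "permute_factors a \<circ> perm_inv p = a" "permute_factors (b \<circ> perm_inv p) = b" for a b by (simp_all add: permute_factors_def fun_eq_iff)
  show "permute_factors ` hwords \<mu> = hwords (\<mu> \<circ> p)"
  proof (intro equalityI subsetI)
    fix f assume f: "f \<in> hwords (\<mu> \<circ> p)"
    have "(f \<circ> perm_inv p) a \<in> lists (gens (\<mu> a))" for a
    proof -
      have "f (perm_inv p a) \<in> lists (gens ((\<mu> \<circ> p) (perm_inv p a)))"
        using f unfolding hwords_def by blast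
      then show ?thesis by simp
    qed
    then have "f \<circ> perm_inv p \<in> hwords \<mu>" unfolding hwords_def by blast
    moreover have "f = permute_factors (f \<circ> perm_inv p)" by (simp add: permute_factors_def fun_eq_iff)
    ultimately show "f \<in> permute_factors ` hwords \<mu>" by blast
  next
    fix g assume "g \<in> permute_factors ` hwords \<mu>"
    then show "g \<in> hwords (\<mu> \<circ> p)" unfolding hwords_def permute_factors_def comp_def by blast
  qed
  have "push permute_factors ` hrel \<mu> = (\<Union>a. at_factor (perm_inv p a) ` yrel 1 ((\<mu> \<circ> p) (perm_inv p a)))"
    by (simp add: hrel_def image_UN image_image push_permute_factors_at_factor)
  also have "\<dots> = (\<Union>a\<in>range (perm_inv p). at_factor a ` yrel 1 ((\<mu> \<circ> p) a))"
    by blast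
  also have "range (perm_inv p) = UNIV"
    using permutes_inv[OF p_permutes] by (rule permutes_surj)
  finally show "push permute_factors ` hrel \<mu> = hrel (\<mu> \<circ> p)"
    unfolding hrel_def .
qed

subsection \<open>Compositions and blocks\<close>

lemma supported_comps:
  assumes "supported \<mu>"
  shows "\<mu> \<circ> p \<in> comps k n"
proof -
  have z: "\<mu> (p b) = 0" if "b \<notin> {1..k}" for b
  proof -
    have "p b \<notin> p ` {1..k}" using that by (simp only: p_image_iff not_False_eq_True)
    then show ?thesis by (rule supportedD(2)[OF assms])
  qed
  have "(\<Sum>b=1..k. \<mu> (p b)) = (\<Sum>b=1..d. \<mu> (p b))"
    using k_le z by (intro sum.mono_neutral_left) auto
  also have "\<dots> = (\<Sum>a=1..d. \<mu> a)"
    using sum.permute[OF p_permutes, of \<mu>] by (simp add: comp_def)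
  finally show ?thesis
    using assms z by (simp add: supported_def comps_def)
qed

text \<open>The non-zero parts of \<open>\<mu>\<close> before the part \<open>p b\<close> are the parts \<open>p c\<close> with \<open>c < b\<close>, as \<open>p\<close> is
  increasing.\<close>

lemma offs_relabel:
  assumes "supported \<mu>" "b \<in> {1..k}"
  shows "offs \<mu> (p b) = offs (\<mu> \<circ> p) b"
proof -
  have "offs \<mu> (p b) = (\<Sum>c\<in>p ` {1..<b}. \<mu> c)"
    unfolding offs_def
  proof (rule sum.mono_neutral_right)
    have "p c \<in> {1..<p b}" if "c \<in> {1..<b}" for c
      using that assms(2) p_in[of c] p_less_iff[of c b] by auto
    then show "p ` {1..<b} \<subseteq> {1..<p b}" by blast
    show "\<forall>i\<in>{1..<p b} - p ` {1..<b}. \<mu> i = 0"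
    proof (rule ballI, rule ccontr)
      fix i assume i: "i \<in> {1..<p b} - p ` {1..<b}" "\<mu> i \<noteq> 0"
      then have "i \<in> p ` {1..k}"
        using supportedD(2)[OF assms(1), of i] by argo
      then obtain c where c: "c \<in> {1..k}" "i = p c"
        by (elim imageE)
      then have "c \<in> {1..<b}"
        using p_less_iff[OF c(1) assms(2)] i(1) by simp
      then have "i \<in> p ` {1..<b}" by (simp only: c(2) p_image_iff)
      with i(1) show False by (simp only: Diff_iff simp_thms)
    qed
  qed simp
  also have "\<dots> = offs (\<mu> \<circ> p) b"
    unfolding offs_def using p_inj by (subst sum.reindex) (auto simp: inj_on_def)
  finally show ?thesis .
qed

lemma blk_relabel:
  assumes "supported \<mu>" "j \<in> {1..n}"
  shows "blk \<mu> j = p (blk (\<mu> \<circ> p) j)" "loc \<mu> j = loc (\<mu> \<circ> p) j"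
    "blk (\<mu> \<circ> p) j \<in> {1..k}"
proof -
  let ?b = "blk (\<mu> \<circ> p) j"
  note b = blk_bounds[OF supported_comps[OF assms(1)] assms(2)]
  show 1: "?b \<in> {1..k}" by (rule b(1))
  have "offs \<mu> (Suc (p ?b)) = offs (\<mu> \<circ> p) (Suc ?b)"
    using p_in[OF 1] 1 offs_relabel[OF assms(1) 1] by (simp add: offs_Suc)
  then show 2: "blk \<mu> j = p ?b"
    using b offs_relabel[OF assms(1) 1] by (intro blk_eqI) simp_all
  show "loc \<mu> j = loc (\<mu> \<circ> p) j"
    using offs_relabel[OF assms(1) 1] by (simp add: loc_def 2)
qed

subsection \<open>Characters\<close>

text \<open>It sends \<open>\<xi> (p b)\<close> to \<open>\<xi>' b\<close>.\<close>

definition root_map :: "complex \<Rightarrow> complex" where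
  "root_map z = \<xi>' (perm_inv p (inv_into {1..d} \<xi> z))"

definition relabel :: "chr \<Rightarrow> chr" where
  "relabel \<chi> = (\<lambda>j\<in>{1..n}. root_map (\<chi> j))"

text \<open>The characters all of whose values are of the form \<open>\<xi> a\<close> with \<open>a \<in> S\<close>.\<close>

definition supported_chr :: "chr \<Rightarrow> bool" where
  "supported_chr \<chi> \<longleftrightarrow> \<chi> \<in> Irr d n \<and> supported (comp_of \<xi> d n \<chi>)"

lemma root_map_xi: "a \<in> {1..d} \<Longrightarrow> root_map (\<xi> a) = \<xi>' (perm_inv p a)"
  unfolding root_map_def using bij_betw_imp_inj_on[OF source.bij_roots] by (simp add: inv_into_f_f)

lemma supported_chr_cases:
  assumes "supported_chr \<chi>" "j \<in> {1..n}"
  obtains b where "b \<in> {1..k}" "\<chi> j = \<xi> (p b)" "root_map (\<chi> j) = \<xi>' b"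
proof -
  have \<chi>: "\<chi> \<in> Irr d n" and supp: "supported (comp_of \<xi> d n \<chi>)"
    using assms(1) by (simp_all add: supported_chr_def)
  obtain a where a: "a \<in> {1..d}" "\<chi> j = \<xi> a"
    using source.chr_in_range[OF \<chi> assms(2)] by blast
  have "j \<in> {j \<in> {1..n}. \<chi> j = \<xi> a}" using assms(2) a by simp
  then have "comp_of \<xi> d n \<chi> a \<noteq> 0"
    using a(1) by (auto simp: comp_of_def)
  then have "a \<in> p ` {1..k}"
    using supportedD(2)[OF supp, of a] by argo
  then obtain b where "b \<in> {1..k}" "a = p b"
    by (elim imageE)
  with a that root_map_xi show thesis by simp
qed

lemma root_map_eq_iff:
  assumes "supported_chr \<chi>" "i \<in> {1..n}" "supported_chr \<psi>" "j \<in> {1..n}"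
  shows "root_map (\<chi> i) = root_map (\<psi> j) \<longleftrightarrow> \<chi> i = \<psi> j"
proof -
  obtain b where b: "b \<in> {1..k}" "\<chi> i = \<xi> (p b)" "root_map (\<chi> i) = \<xi>' b"
    using supported_chr_cases[OF assms(1,2)] .
  obtain c where c: "c \<in> {1..k}" "\<psi> j = \<xi> (p c)" "root_map (\<psi> j) = \<xi>' c"
    using supported_chr_cases[OF assms(3,4)] .
  show ?thesis
    using b c target.xi_eq_iff[OF b(1) c(1)] source.xi_eq_iff[OF p_in p_in, OF b(1) c(1)] p_inj by simp
qed

lemma relabel_inj:
  assumes "supported_chr \<chi>" "supported_chr \<psi>"
  shows "relabel \<chi> = relabel \<psi> \<longleftrightarrow> \<chi> = \<psi>"
proof
  assume eq: "relabel \<chi> = relabel \<psi>"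
  have "\<chi> j = \<psi> j" if "j \<in> {1..n}" for j
    using that fun_cong[OF eq, of j] root_map_eq_iff[OF assms(1) that assms(2) that]
    by (simp add: relabel_def)
  moreover have "\<chi> \<in> Irr d n" "\<psi> \<in> Irr d n"
    using assms by (simp_all add: supported_chr_def)
  ultimately show "\<chi> = \<psi>"
    unfolding Irr_def by (rule PiE_ext[rotated 2])
qed simp

lemma relabel_comp:
  assumes "supported_chr \<chi>"
  shows "relabel \<chi> \<in> Irr k n" "comp_of \<xi>' k n (relabel \<chi>) = comp_of \<xi> d n \<chi> \<circ> p"
proof -
  have "root_map (\<chi> j) ^ k = 1" if "j \<in> {1..n}" for j
    using supported_chr_cases[OF assms that] target.xi_root by metis
  then show "relabel \<chi> \<in> Irr k n"
    unfolding Irr_def relabel_def by (intro restrict_PiE_iff[THEN iffD2]) simp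
  show "comp_of \<xi>' k n (relabel \<chi>) = comp_of \<xi> d n \<chi> \<circ> p"
  proof
    fix b
    show "comp_of \<xi>' k n (relabel \<chi>) b = (comp_of \<xi> d n \<chi> \<circ> p) b"
    proof (cases "b \<in> {1..k}")
      case True
      have iff: "relabel \<chi> j = \<xi>' b \<longleftrightarrow> \<chi> j = \<xi> (p b)" if j: "j \<in> {1..n}" for j
      proof -
        obtain c where c: "c \<in> {1..k}" "\<chi> j = \<xi> (p c)" "root_map (\<chi> j) = \<xi>' c"
          using supported_chr_cases[OF assms j] .
        then show ?thesis
          using j target.xi_eq_iff[OF c(1) True] source.xi_eq_iff[OF p_in p_in, OF c(1) True] p_inj
          by (simp add: relabel_def)
      qed
      then have "{j \<in> {1..n}. relabel \<chi> j = \<xi>' b} = {j \<in> {1..n}. \<chi> j = \<xi> (p b)}"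
        by (intro Collect_cong conj_cong refl iff)
      then show ?thesis
        using True p_in[OF True] by (simp add: comp_of_def)
    next
      case False
      then have "p b \<notin> p ` {1..k}" by (simp only: p_image_iff not_False_eq_True)
      then have "comp_of \<xi> d n \<chi> (p b) = 0"
        using assms unfolding supported_chr_def by (intro supportedD(2)) simp_all
      then show ?thesis using False by (auto simp: comp_of_def)
    qed
  qed
qed

lemma supported_chr_pull: "supported_chr \<chi> \<Longrightarrow> b permutes {1..n} \<Longrightarrow> supported_chr (pull n b \<chi>)"
  by (simp add: supported_chr_def pull_Irr comp_of_pull)

lemma relabel_pull: "b permutes {1..n} \<Longrightarrow> relabel (pull n b \<chi>) = pull n b (relabel \<chi>)"
  using permutes_in_image[of b "{1..n}"] by (auto simp: relabel_def pull_def fun_eq_iff)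

lemma supported_chrI: "supported \<mu> \<Longrightarrow> \<chi> \<in> Irr_comp \<xi> d n \<mu> \<Longrightarrow> supported_chr \<chi>"
  by (simp add: supported_chr_def Irr_comp_def)

text \<open>The inverse replaces the value \<open>\<xi>' b\<close> by \<open>\<xi> (p b)\<close>; both maps preserve the number of positions
  at which corresponding values are taken.\<close>

lemma bij_relabel:
  assumes "supported \<mu>"
  shows "bij_betw relabel (Irr_comp \<xi> d n \<mu>) (Irr_comp \<xi>' k n (\<mu> \<circ> p))"
proof -
  let ?A = "Irr_comp \<xi> d n \<mu>"
  note supp = supported_chrI[OF assms]
  have inj: "inj_on relabel ?A"
    by (rule inj_onI) (simp add: relabel_inj supp)
  have "relabel ` ?A = Irr_comp \<xi>' k n (\<mu> \<circ> p)"
  proof (intro equalityI subsetI)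
    fix \<psi> assume "\<psi> \<in> relabel ` ?A"
    then show "\<psi> \<in> Irr_comp \<xi>' k n (\<mu> \<circ> p)"
      using relabel_comp[OF supp] by (auto simp: Irr_comp_def)
  next
    fix \<psi> assume "\<psi> \<in> Irr_comp \<xi>' k n (\<mu> \<circ> p)"
    then have \<psi>: "\<psi> \<in> Irr k n" "comp_of \<xi>' k n \<psi> = \<mu> \<circ> p"
      by (simp_all add: Irr_comp_def)
    \<comment> \<open>The value of \<open>\<psi>\<close> at \<open>j\<close> is the root number \<open>c j\<close>.\<close>
    define c where "c j = inv_into {1..k} \<xi>' (\<psi> j)" for j
    have c: "c j \<in> {1..k}" "\<psi> j = \<xi>' (c j)" if "j \<in> {1..n}" for j
      using target.chr_in_range[OF \<psi>(1) that] unfolding c_def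
      by (simp_all only: inv_into_into f_inv_into_f)
    define \<chi> where "\<chi> = (\<lambda>j\<in>{1..n}. \<xi> (p (c j)))"
    have \<chi>_Irr: "\<chi> \<in> Irr d n"
      unfolding Irr_def \<chi>_def using source.xi_root[OF p_in[OF c(1)]]
      by (intro restrict_PiE_iff[THEN iffD2]) simp
    have "comp_of \<xi> d n \<chi> a = \<mu> a" for a
    proof (cases "a \<in> {1..d}")
      case True
      show ?thesis
      proof (cases "perm_inv p a \<in> {1..k}")
        case in_k: True
        have iff: "\<chi> j = \<xi> a \<longleftrightarrow> \<psi> j = \<xi>' (perm_inv p a)" if j: "j \<in> {1..n}" for j
          using j c[OF j] True in_k source.xi_eq_iff[OF p_in[OF c(1)[OF j]] True]
            target.xi_eq_iff[OF c(1)[OF j] in_k] p_inj[of "c j" "perm_inv p a"]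
          by (simp add: \<chi>_def)
        then have "{j \<in> {1..n}. \<chi> j = \<xi> a} = {j \<in> {1..n}. \<psi> j = \<xi>' (perm_inv p a)}"
          by (intro Collect_cong conj_cong refl iff)
        then have "comp_of \<xi> d n \<chi> a = comp_of \<xi>' k n \<psi> (perm_inv p a)"
          using True in_k by (simp add: comp_of_def)
        then show ?thesis using \<psi>(2) by simp
      next
        case False
        have "\<chi> j \<noteq> \<xi> a" if j: "j \<in> {1..n}" for j
        proof
          assume "\<chi> j = \<xi> a"
          then have "p (c j) = a"
            using j source.xi_eq_iff[OF p_in[OF c(1)[OF j]] True] by (simp add: \<chi>_def)
          then show False using False c(1)[OF j] by auto
        qed
        then have "{j \<in> {1..n}. \<chi> j = \<xi> a} = {}" by blast
        moreover have "\<mu> a = 0"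
        proof -
          have "a \<notin> p ` {1..k}" using False p_image_iff[of "perm_inv p a" "{1..k}"] by simp
          then show ?thesis by (rule supportedD(2)[OF assms])
        qed
        ultimately show ?thesis by (simp only: comp_of_def card.empty if_cancel)
      qed
    next
      case False
      then have "\<mu> a = 0" using assms by (auto simp: supported_def comps_def)
      then show ?thesis using False by (auto simp: comp_of_def)
    qed
    then have \<chi>A: "\<chi> \<in> ?A"
      using \<chi>_Irr by (auto simp: Irr_comp_def)
    have "relabel \<chi> = \<psi>"
    proof (rule PiE_ext[OF relabel_comp(1)[OF supp[OF \<chi>A], unfolded Irr_def] \<psi>(1)[unfolded Irr_def]])
      fix j assume j: "j \<in> {1..n}"
      then show "relabel \<chi> j = \<psi> j"
        using c[OF j] root_map_xi[OF p_in[OF c(1)[OF j]]] by (simp add: relabel_def \<chi>_def)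
    qed
    then show "\<psi> \<in> relabel ` ?A" using \<chi>A by blast
  qed
  with inj show ?thesis by (simp add: bij_betw_def)
qed

text \<open>Relabelling commutes with the action of permutations, is injective on supported characters and
  sends $\chi_0^{\mu}$ to $\chi_0^{\mu \circ p}$. So the two sides minimise the length over the same set
  of permutations, by the same choice.\<close>

lemma pi_chi_relabel:
  assumes "supported_chr \<chi>"
  shows "pi_chi \<xi>' k n (relabel \<chi>) = pi_chi \<xi> d n \<chi>"
proof -
  let ?\<mu> = "comp_of \<xi> d n \<chi>"
  have \<mu>: "supported ?\<mu>" and \<chi>: "\<chi> \<in> Irr d n" using assms by (simp_all add: supported_chr_def)
  note \<mu>' = \<mu>[unfolded supported_def]
  have chi0: "relabel (chi0 \<xi> n ?\<mu>) = chi0 \<xi>' n (?\<mu> \<circ> p)"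
  proof
    fix j
    show "relabel (chi0 \<xi> n ?\<mu>) j = chi0 \<xi>' n (?\<mu> \<circ> p) j"
    proof (cases "j \<in> {1..n}")
      case True
      then show ?thesis
        using blk_relabel[OF \<mu> True] root_map_xi[OF p_in[OF blk_relabel(3)[OF \<mu> True]]]
        by (simp add: relabel_def chi0_def)
    qed (simp only: relabel_def chi0_def restrict_def if_False)
  qed
  have chi0_supp: "supported_chr (chi0 \<xi> n ?\<mu>)"
  proof -
    note pi = source.pi_chi[OF \<chi>]
    have inv: "perm_inv (pi_chi \<xi> d n \<chi>) permutes {1..n}" by (rule permutes_inv[OF pi(1)])
    have "pull n (pi_chi \<xi> d n \<chi>) \<chi> = pull n (pi_chi \<xi> d n \<chi>) (pull n (perm_inv (pi_chi \<xi> d n \<chi>)) (chi0 \<xi> n ?\<mu>))"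
      using pi(2) by (simp add: act_eq_pull)
    also have "\<dots> = pull n id (chi0 \<xi> n ?\<mu>)"
      using pi(1) by (simp add: pull_pull permutes_inv_o)
    also have "\<dots> = chi0 \<xi> n ?\<mu>" by (simp add: pull_def chi0_def fun_eq_iff)
    finally have "chi0 \<xi> n ?\<mu> = pull n (pi_chi \<xi> d n \<chi>) \<chi>" ..
    then show ?thesis using supported_chr_pull[OF assms pi(1)] by simp
  qed
  have "w permutes {1..n} \<and> act n w (chi0 \<xi>' n (?\<mu> \<circ> p)) = relabel \<chi> \<longleftrightarrow>
      w permutes {1..n} \<and> act n w (chi0 \<xi> n ?\<mu>) = \<chi>" for w
  proof (rule conj_cong[OF refl])
    assume w: "w permutes {1..n}"
    note w' = permutes_inv[OF w]
    show "act n w (chi0 \<xi>' n (?\<mu> \<circ> p)) = relabel \<chi> \<longleftrightarrow> act n w (chi0 \<xi> n ?\<mu>) = \<chi>"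
      unfolding act_eq_pull chi0[symmetric] relabel_pull[OF w', symmetric]
      by (rule relabel_inj[OF supported_chr_pull[OF chi0_supp w'] assms])
  qed
  then show ?thesis
    unfolding pi_chi_def relabel_comp(2)[OF assms] by simp
qed

subsection \<open>Matrix entries\<close>

lemma transport_X_bar:
  assumes "supported \<mu>" "j \<in> {1..n}"
  shows "push permute_factors ` X_bar \<mu> j = X_bar (\<mu> \<circ> p) j"
  using algebra_transport.transport_pcls[OF transport, of \<mu>] blk_relabel[OF assms]
  by (simp add: X_bar_def hcls_def push_permute_factors_at_factor)

lemma transport_g_bar:
  assumes "supported \<mu>" "\<sigma> permutes {1..n}"
  shows "push permute_factors ` g_bar n \<mu> \<sigma> = g_bar n (\<mu> \<circ> p) \<sigma>"
proof -
  have "push permute_factors ` hcls \<mu> (at_factor (blk \<mu> i) (gn (G (loc \<mu> i)))) =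
      hcls (\<mu> \<circ> p) (at_factor (blk (\<mu> \<circ> p) i) (gn (G (loc (\<mu> \<circ> p) i))))"
    if "i \<in> set (reduced_word n \<sigma>)" for i
  proof -
    have "i \<in> {1..n}" using that reduced_word(1)[OF assms(2)] by auto
    then show ?thesis
      using algebra_transport.transport_pcls[OF transport, of \<mu>] blk_relabel[OF assms(1)]
      by (simp add: hcls_def push_permute_factors_at_factor)
  qed
  then show ?thesis
    unfolding g_bar_def HH_def algebra_transport.transport_lprod[OF transport] map_map comp_def[of "(`) (push permute_factors)"]
    by (intro arg_cong[where f = "lprod _"] map_cong refl) simp
qed

text \<open>For exponents that are not negative the powers in $X^\lambda$ are iterated products, and these can
  be transported without knowing that the $\overline X_j$ are invertible.\<close>

lemma transport_Psi_entry:
  assumes "supported_chr \<chi>" "w permutes {1..n}" "\<And>j. lam j \<ge> 0"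
  shows "push permute_factors ` Psi_entry \<xi> d n lam w \<chi> = Psi_entry \<xi>' k n lam w (relabel \<chi>)"
proof -
  let ?\<mu> = "comp_of \<xi> d n \<chi>" and ?\<pi> = "pi_chi \<xi> d n \<chi>"
  let ?\<sigma> = "perm_inv ?\<pi> \<circ> perm_inv w \<circ> pi_chi \<xi> d n (act n w \<chi>)"
  interpret tr: algebra_transport "hwords ?\<mu>" "hrel ?\<mu>" "hwords (?\<mu> \<circ> p)" "hrel (?\<mu> \<circ> p)" permute_factors "\<lambda>f. f \<circ> perm_inv p"
    by (rule transport)
  note tr = tr.transport_mult[folded HH_def] tr.transport_lprod[folded HH_def]
    tr.transport_pow[folded HH_def] tr.transport_pcls[folded hcls_def]
  have \<mu>: "supported ?\<mu>" and \<chi>: "\<chi> \<in> Irr d n" using assms(1) by (simp_all add: supported_chr_def)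
  note w' = permutes_inv[OF assms(2)]
  have supp_act: "supported_chr (act n w \<chi>)"
    using supported_chr_pull[OF assms(1) w'] by (simp add: act_eq_pull)
  have rel_act: "relabel (act n w \<chi>) = act n w (relabel \<chi>)"
    using relabel_pull[OF w'] by (simp add: act_eq_pull)
  have pi_act: "pi_chi \<xi>' k n (act n w (relabel \<chi>)) = pi_chi \<xi> d n (act n w \<chi>)"
    using pi_chi_relabel[OF supp_act] by (simp add: rel_act)
  note pi = source.pi_chi(1)[OF \<chi>]
  have \<sigma>: "?\<sigma> permutes {1..n}"
    using permutes_compose[OF permutes_compose[OF source.pi_chi(1) w'] permutes_inv[OF pi]] supp_act
    by (simp add: supported_chr_def comp_assoc)
  have X: "push permute_factors ` (X_bar ?\<mu> (perm_inv ?\<pi> j) [^]\<^bsub>HH ?\<mu>\<^esub> lam j) =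
      X_bar (?\<mu> \<circ> p) (perm_inv ?\<pi> j) [^]\<^bsub>HH (?\<mu> \<circ> p)\<^esub> lam j" if "j \<in> {1..n}" for j
  proof -
    have "perm_inv ?\<pi> j \<in> {1..n}"
      using permutes_in_image[OF permutes_inv[OF pi]] that by blast
    note X_bar = transport_X_bar[OF \<mu> this]
    have pow: "A [^]\<^bsub>HH \<nu>\<^esub> lam j = A [^]\<^bsub>HH \<nu>\<^esub> nat (lam j)" for A \<nu>
      using int_pow_int[of "HH \<nu>" A "nat (lam j)"] by (simp only: nat_0_le[OF assms(3)])
    show ?thesis
      by (simp only: pow tr X_bar)
  qed
  have "lprod (HH (?\<mu> \<circ> p)) (map ((`) (push permute_factors)) (map (\<lambda>j. X_bar ?\<mu> (perm_inv ?\<pi> j) [^]\<^bsub>HH ?\<mu>\<^esub> lam j) [1..<Suc n]))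
      = lprod (HH (?\<mu> \<circ> p)) (map (\<lambda>j. X_bar (?\<mu> \<circ> p) (perm_inv ?\<pi> j) [^]\<^bsub>HH (?\<mu> \<circ> p)\<^esub> lam j) [1..<Suc n])"
    unfolding map_map by (intro arg_cong[where f = "lprod _"] map_cong refl) (use X in \<open>auto simp del: upt_Suc\<close>)
  then show ?thesis
    unfolding Psi_entry_def Let_def pi_act pi_chi_relabel[OF assms(1)] relabel_comp(2)[OF assms(1)]
    by (simp only: tr transport_g_bar[OF \<mu> \<sigma>] push_scal tr.h_zero)
qed

lemma transport_gen_entry:
  assumes "supported_chr \<chi>" "i < n"
  shows "push permute_factors ` gen_entry \<xi> d n i \<chi> = gen_entry \<xi>' k n i (relabel \<chi>)"
proof (cases "i = 0")
  case True
  then show ?thesis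
    using transport_Psi_entry[OF assms(1) permutes_id, of "\<lambda>j. if j = 1 then 1 else 0"]
    by (simp add: gen_entry_def)
next
  case False
  let ?\<mu> = "comp_of \<xi> d n \<chi>"
  have i: "i \<in> {1..<n}" "i \<in> {1..n}" "Suc i \<in> {1..n}" using False assms(2) by auto
  interpret tr: algebra_transport "hwords ?\<mu>" "hrel ?\<mu>" "hwords (?\<mu> \<circ> p)" "hrel (?\<mu> \<circ> p)" permute_factors "\<lambda>f. f \<circ> perm_inv p"
    by (rule transport)
  note tr = tr.transport_mult[folded HH_def] tr.transport_pcls[folded hcls_def]
  have "relabel \<chi> i = relabel \<chi> (Suc i) \<longleftrightarrow> \<chi> i = \<chi> (Suc i)"
    using root_map_eq_iff[OF assms(1) i(2) assms(1) i(3)] i(2,3) by (simp add: relabel_def)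
  then show ?thesis
    using False transport_Psi_entry[OF assms(1) transpose_Suc_permutes[OF i(1)], of "\<lambda>_. 0"]
    unfolding gen_entry_def relabel_comp(2)[OF assms(1)]
    by (simp only: tr push_scal tr.h_zero if_False order_refl)
qed

text \<open>For an inverse generator both sides are inverse to the same unit of $\widehat H^{\mu \circ p}$, by
  \<open>monomial_inv\<close>, and so agree.\<close>

lemma delta_gen_relabel:
  assumes "i < n"
  shows "\<exists>b q q'. source.monomial b q (if pos then ycls d n (delta_gen d (Sig i))
            else inv\<^bsub>YH d n\<^esub> ycls d n (delta_gen d (Sig i)))
     \<and> target.monomial b q' (if pos then ycls k n (delta_gen k (Sig i))
            else inv\<^bsub>YH k n\<^esub> ycls k n (delta_gen k (Sig i)))
     \<and> b = (if pos then bgen_perm (Sig i) else perm_inv (bgen_perm (Sig i)))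
     \<and> (\<forall>\<chi>. supported_chr \<chi> \<longrightarrow> push permute_factors ` q \<chi> = q' (relabel \<chi>))"
proof (cases pos)
  case True
  then show ?thesis
    using source.delta_gen_monomial(1)[OF assms] target.delta_gen_monomial(1)[OF assms]
      transport_gen_entry[OF _ assms] by (auto simp del: bgen_perm.simps delta_gen.simps)
next
  case False
  let ?b = "bgen_perm (Sig i)"
  let ?inv = "\<lambda>d. inv\<^bsub>YH d n\<^esub> ycls d n (delta_gen d (Sig i))"
  note m = source.delta_gen_monomial(1)[OF assms] and m' = target.delta_gen_monomial(1)[OF assms]
  have b: "?b permutes {1..n}" by (rule source.monomialD(1)[OF m])
  obtain q where q: "source.monomial (perm_inv ?b) q (?inv d)"
    "\<forall>\<chi>\<in>Irr d n. q (pull n ?b \<chi>) \<otimes>\<^bsub>HH (comp_of \<xi> d n \<chi>)\<^esub> gen_entry \<xi> d n i \<chi> = \<one>\<^bsub>HH (comp_of \<xi> d n \<chi>)\<^esub>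
      \<and> gen_entry \<xi> d n i \<chi> \<otimes>\<^bsub>HH (comp_of \<xi> d n \<chi>)\<^esub> q (pull n ?b \<chi>) = \<one>\<^bsub>HH (comp_of \<xi> d n \<chi>)\<^esub>"
    using source.monomial_inv[OF m source.delta_gen_monomial(2)[OF assms]] .
  obtain q' where q': "target.monomial (perm_inv ?b) q' (?inv k)"
    "\<forall>\<chi>\<in>Irr k n. q' (pull n ?b \<chi>) \<otimes>\<^bsub>HH (comp_of \<xi>' k n \<chi>)\<^esub> gen_entry \<xi>' k n i \<chi> = \<one>\<^bsub>HH (comp_of \<xi>' k n \<chi>)\<^esub>
      \<and> gen_entry \<xi>' k n i \<chi> \<otimes>\<^bsub>HH (comp_of \<xi>' k n \<chi>)\<^esub> q' (pull n ?b \<chi>) = \<one>\<^bsub>HH (comp_of \<xi>' k n \<chi>)\<^esub>"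
    using target.monomial_inv[OF m' target.delta_gen_monomial(2)[OF assms]] .
  have "push permute_factors ` q \<psi> = q' (relabel \<psi>)" if \<psi>: "supported_chr \<psi>" for \<psi>
  proof -
    let ?\<chi> = "pull n (perm_inv ?b) \<psi>"
    let ?\<mu> = "comp_of \<xi> d n ?\<chi>"
    interpret tr: algebra_transport "hwords ?\<mu>" "hrel ?\<mu>" "hwords (?\<mu> \<circ> p)" "hrel (?\<mu> \<circ> p)" permute_factors "\<lambda>f. f \<circ> perm_inv p"
      by (rule transport)
    have \<chi>: "supported_chr ?\<chi>" using supported_chr_pull[OF \<psi> permutes_inv[OF b]] .
    then have \<chi>_Irr: "?\<chi> \<in> Irr d n" by (simp add: supported_chr_def)
    have \<psi>_eq: "pull n ?b ?\<chi> = \<psi>"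
      using \<psi> Irr_extensional[of \<psi> d n] unfolding pull_pull[OF b] permutes_inv_o(2)[OF b]
      by (simp add: supported_chr_def)
    have rel_\<psi>: "pull n ?b (relabel ?\<chi>) = relabel \<psi>"
      using relabel_pull[OF b, of ?\<chi>] by (simp only: \<psi>_eq)
    let ?\<mu>' = "?\<mu> \<circ> p" and ?g = "gen_entry \<xi>' k n i (relabel ?\<chi>)"
    have rel: "relabel ?\<chi> \<in> Irr k n" "?\<mu>' = comp_of \<xi>' k n (relabel ?\<chi>)"
      using relabel_comp[OF \<chi>] by simp_all
    have 1: "(push permute_factors ` q \<psi>) \<otimes>\<^bsub>HH ?\<mu>'\<^esub> ?g = \<one>\<^bsub>HH ?\<mu>'\<^esub>"
    proof -
      have "(push permute_factors ` q \<psi>) \<otimes>\<^bsub>HH ?\<mu>'\<^esub> ?g = push permute_factors ` (q \<psi> \<otimes>\<^bsub>HH ?\<mu>\<^esub> gen_entry \<xi> d n i ?\<chi>)"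
        unfolding transport_gen_entry[OF \<chi> assms, symmetric] by (rule tr.transport_mult[folded HH_def, symmetric])
      also have "q \<psi> \<otimes>\<^bsub>HH ?\<mu>\<^esub> gen_entry \<xi> d n i ?\<chi> = \<one>\<^bsub>HH ?\<mu>\<^esub>"
        using bspec[OF q(2) \<chi>_Irr] by (simp only: \<psi>_eq)
      finally show ?thesis by (simp only: tr.transport_one[folded HH_def])
    qed
    have 2: "?g \<otimes>\<^bsub>HH ?\<mu>'\<^esub> q' (relabel \<psi>) = \<one>\<^bsub>HH ?\<mu>'\<^esub>"
      using bspec[OF q'(2) rel(1)] by (simp only: rel_\<psi> rel(2))
    have comp_\<psi>: "comp_of \<xi> d n \<psi> = ?\<mu>" "comp_of \<xi>' k n (relabel \<psi>) = ?\<mu>'"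
      using comp_of_pull[OF permutes_inv[OF b]] relabel_comp(2)[OF \<psi>] by simp_all
    have closed: "push permute_factors ` q \<psi> \<in> carrier (HH ?\<mu>')" "?g \<in> carrier (HH ?\<mu>')" "q' (relabel \<psi>) \<in> carrier (HH ?\<mu>')"
      using tr.transport_closed[folded HH_def] source.monomial_entry_closed[OF q(1), of \<psi>]
        target.monomial_entry_closed[OF q'(1), of "relabel \<psi>"]
        target.monomial_entry_closed[OF m' rel(1)] \<psi> relabel_comp[OF \<psi>] rel
      by (simp_all add: comp_\<psi> supported_chr_def del: bgen_perm.simps)
    show ?thesis
      using H.palg.inv_unique[OF 1 2] closed by simp
  qed
  then show ?thesis
    using q(1) q'(1) False by (auto simp del: bgen_perm.simps delta_gen.simps)
qed

text \<open>Along the word the permutations compose and the entries multiply, and \<open>(`) (push permute_factors)\<close>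
  respects products; so it is enough to know single generators and their inverses.\<close>

lemma delta_relabel:
  assumes "\<beta> \<in> affine_words n"
  shows "\<exists>q q'. source.monomial (bword_perm \<beta>) q (delta d n \<beta>) \<and> target.monomial (bword_perm \<beta>) q' (delta k n \<beta>)
    \<and> (\<forall>\<chi>. supported_chr \<chi> \<longrightarrow> push permute_factors ` q \<chi> = q' (relabel \<chi>))"
  using assms
proof (induction \<beta>)
  case Nil
  have "push permute_factors ` \<one>\<^bsub>HH (comp_of \<xi> d n \<chi>)\<^esub> = \<one>\<^bsub>HH (comp_of \<xi>' k n (relabel \<chi>))\<^esub>"
    if "supported_chr \<chi>" for \<chi>
    unfolding relabel_comp(2)[OF that] HH_def by (rule algebra_transport.transport_one[OF transport])
  then show ?case
    using source.monomial_one target.monomial_one unfolding delta_simps bword_perm_simps by blast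
next
  case (Cons l \<beta>)
  then obtain i pos where l: "l = (Sig i, pos)" "i < n" and \<beta>: "\<beta> \<in> affine_words n"
    by (auto simp: affine_words_def)
  obtain b q q' where a: "source.monomial b q (if pos then ycls d n (delta_gen d (Sig i))
            else inv\<^bsub>YH d n\<^esub> ycls d n (delta_gen d (Sig i)))"
     "target.monomial b q' (if pos then ycls k n (delta_gen k (Sig i))
            else inv\<^bsub>YH k n\<^esub> ycls k n (delta_gen k (Sig i)))"
     "b = (if pos then bgen_perm (Sig i) else perm_inv (bgen_perm (Sig i)))"
     "\<And>\<chi>. supported_chr \<chi> \<Longrightarrow> push permute_factors ` q \<chi> = q' (relabel \<chi>)"
    using delta_gen_relabel[OF l(2), of pos] by blast
  obtain r r' where r: "source.monomial (bword_perm \<beta>) r (delta d n \<beta>)"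
    "target.monomial (bword_perm \<beta>) r' (delta k n \<beta>)"
    "\<And>\<chi>. supported_chr \<chi> \<Longrightarrow> push permute_factors ` r \<chi> = r' (relabel \<chi>)"
    using Cons.IH[OF \<beta>] by blast
  have b: "b permutes {1..n}" by (rule source.monomialD(1)[OF a(1)])
  let ?q = "\<lambda>\<chi>. q \<chi> \<otimes>\<^bsub>HH (comp_of \<xi> d n \<chi>)\<^esub> r (pull n b \<chi>)"
    and ?q' = "\<lambda>\<chi>. q' \<chi> \<otimes>\<^bsub>HH (comp_of \<xi>' k n \<chi>)\<^esub> r' (pull n b \<chi>)"
  have "push permute_factors ` ?q \<chi> = ?q' (relabel \<chi>)" if \<chi>: "supported_chr \<chi>" for \<chi>
    unfolding algebra_transport.transport_mult[OF transport, folded HH_def] relabel_comp(2)[OF \<chi>]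
      a(4)[OF \<chi>] r(3)[OF supported_chr_pull[OF \<chi> b]] relabel_pull[OF b] ..
  moreover have perm: "bword_perm (l # \<beta>) = b \<circ> bword_perm \<beta>"
    by (simp only: l(1) bword_perm_simps a(3))
  moreover have "source.monomial (bword_perm (l # \<beta>)) ?q (delta d n (l # \<beta>))"
    using source.monomial_mult[OF a(1) r(1)] unfolding perm unfolding l(1) delta_simps(2) .
  moreover have "target.monomial (bword_perm (l # \<beta>)) ?q' (delta k n (l # \<beta>))"
    using target.monomial_mult[OF a(2) r(2)] unfolding perm unfolding l(1) delta_simps(2) .
  ultimately show ?case
    by (intro exI[of _ ?q] exI[of _ ?q']) blast
qed

end

section \<open>Tensor products of linear forms\<close>

text \<open>The linear form on the monoid algebra with the value \<open>F f\<close> on the word \<open>f\<close>.\<close>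

definition pairing :: "('m \<Rightarrow> laurent) \<Rightarrow> ('m \<Rightarrow>\<^sub>0 laurent) \<Rightarrow> laurent" where
  "pairing F y = (\<Sum>f\<in>Poly_Mapping.keys y. Poly_Mapping.lookup y f * F f)"

lemma pairing_zero [simp]: "pairing F 0 = 0"
  by (simp add: pairing_def)

lemma pairing_single [simp]: "pairing F (Poly_Mapping.single k c) = c * F k"
  by (simp add: pairing_def)

lemma pairing_add: "pairing F (x + y) = pairing F x + pairing F y"
  unfolding pairing_def by (rule setsum_keys_plus_distrib) (simp_all add: distrib_right)

lemma pairing_diff: "pairing F (x - y) = pairing F x - pairing F y"
  using pairing_add[of F "x - y" y] by (simp add: algebra_simps)

lemma pairing_push: "pairing F (push h y) = pairing (F \<circ> h) y"
  by (rule poly_mapping_single_add_induct[of y]) (simp_all add: push_add pairing_add)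

text \<open>The value of $\bigotimes_{a \in S} \tau^a_{\mu_a}$ on a pure tensor of words.\<close>

definition tensor_weight ::
  "nat set \<Rightarrow> (nat \<Rightarrow> nat \<Rightarrow> falg set \<Rightarrow> laurent) \<Rightarrow> (nat \<Rightarrow> nat) \<Rightarrow> (nat \<Rightarrow> gen list) \<Rightarrow> laurent" where
  "tensor_weight S \<tau> \<mu> f = (\<Prod>a\<in>S. \<tau> a (\<mu> a) (ycls 1 (\<mu> a) (Poly_Mapping.single (f a) 1)))"

lemma tensor_form_eq: "tensor_form S \<tau> \<mu> z = the_elem (pairing (tensor_weight S \<tau> \<mu>) ` z)"
  by (simp add: tensor_form_def pairing_def tensor_weight_def)

lemma linear_form_zero: "linear_form d n f \<Longrightarrow> f \<zero>\<^bsub>YH d n\<^esub> = 0"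
proof -
  assume "linear_form d n f"
  then have "f (\<zero>\<^bsub>YH d n\<^esub> \<oplus>\<^bsub>YH d n\<^esub> \<zero>\<^bsub>YH d n\<^esub>) = f \<zero>\<^bsub>YH d n\<^esub> + f \<zero>\<^bsub>YH d n\<^esub>"
    unfolding linear_form_def by (metis Y.palg.zero_closed)
  then show ?thesis by simp
qed

lemma linear_form_add:
  "linear_form d n f \<Longrightarrow> x \<in> carrier (YH d n) \<Longrightarrow> y \<in> carrier (YH d n)
    \<Longrightarrow> f (x \<oplus>\<^bsub>YH d n\<^esub> y) = f x + f y"
  unfolding linear_form_def by blast

lemma linear_form_single:
  assumes "linear_form d n f" "w \<in> lists (gens n)"
  shows "f (ycls d n (Poly_Mapping.single w r)) = r * f (ycls d n (Poly_Mapping.single w 1))"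
proof -
  have "Poly_Mapping.single w r = scal r * Poly_Mapping.single w 1"
    by (simp add: scal_def mult_single)
  then have "ycls d n (Poly_Mapping.single w r) = ycls d n (scal r) \<otimes>\<^bsub>YH d n\<^esub> ycls d n (Poly_Mapping.single w 1)"
    using assms(2) by (simp add: Y.pcls_mult)
  moreover have "ycls d n (Poly_Mapping.single w 1) \<in> carrier (YH d n)"
    using assms(2) by (simp add: Y.pcls_closed)
  ultimately show ?thesis
    using assms(1) unfolding linear_form_def by metis
qed

text \<open>On a product of pure tensors the form is a product over the factors, so the factor \<open>e\<close> splits off
  from the others, and there the relator represents 0.\<close>

lemma pairing_relation:
  assumes S: "finite S" "e \<in> S" and lin: "linear_form 1 (\<mu> e) (\<tau> e (\<mu> e))"
    and fg: "f \<in> hwords \<mu>" "g \<in> hwords \<mu>" and q: "q \<in> yrel 1 (\<mu> e)"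
  shows "pairing (tensor_weight S \<tau> \<mu>)
    (Poly_Mapping.single f c * at_factor e q * Poly_Mapping.single g c') = 0"
proof -
  let ?F = "tensor_weight S \<tau> \<mu>" and ?t = "\<tau> e (\<mu> e)" and ?M = "lists (gens (\<mu> e))"
  let ?K = "c * c' * (\<Prod>a\<in>S - {e}. \<tau> a (\<mu> a) (ycls 1 (\<mu> a) (Poly_Mapping.single (f a @ g a) 1)))"
  let ?in = "\<lambda>x :: falg. Poly_Mapping.single (f e) 1 * x * Poly_Mapping.single (g e) 1"
  have fge: "f e \<in> ?M" "g e \<in> ?M" using fg unfolding hwords_def by blast+
  have q_closed: "q \<in> carrier (malg ?M)" using q yrel_closed by blast
  have in_closed: "?in x \<in> carrier (malg ?M)" if "x \<in> carrier (malg ?M)" for x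
    using that fge by simp
  let ?P = "\<lambda>x. x \<in> carrier (malg ?M) \<and>
      pairing ?F (Poly_Mapping.single f c * at_factor e x * Poly_Mapping.single g c')
      = ?K * ?t (ycls 1 (\<mu> e) (?in x))"
  have "?P q"
  proof (rule poly_mapping_single_add_induct[of q ?P])
    have "?t (ycls 1 (\<mu> e) 0) = 0"
      using linear_form_zero[OF lin] by (simp only: Y.pcls_zero)
    then show "?P 0" by (simp add: at_factor_eq_push)
  next
    fix y z assume y: "?P y" and z: "?P z"
    then have yz: "y \<in> carrier (malg ?M)" "z \<in> carrier (malg ?M)" by simp_all
    have "?in (y + z) = ?in y + ?in z" by (simp add: algebra_simps)
    then have "?t (ycls 1 (\<mu> e) (?in (y + z))) = ?t (ycls 1 (\<mu> e) (?in y)) + ?t (ycls 1 (\<mu> e) (?in z))"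
      using linear_form_add[OF lin Y.pcls_closed[OF in_closed[OF yz(1)]] Y.pcls_closed[OF in_closed[OF yz(2)]]]
      by (simp only: Y.pcls_add[OF in_closed[OF yz(1)] in_closed[OF yz(2)]])
    moreover have "Poly_Mapping.single f c * at_factor e (y + z) * Poly_Mapping.single g c'
        = Poly_Mapping.single f c * at_factor e y * Poly_Mapping.single g c'
        + Poly_Mapping.single f c * at_factor e z * Poly_Mapping.single g c'"
      by (simp add: at_factor_eq_push push_add algebra_simps)
    ultimately show "?P (y + z)"
      using y z yz by (simp only: pairing_add Y.malg_add distrib_left simp_thms)
  next
    fix k r assume "k \<in> Poly_Mapping.keys q"
    then have k: "k \<in> ?M" using q_closed unfolding Y.carrier_malg_iff by blast
    let ?w = "f + (\<lambda>_. [])(e := k) + g"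
    have w: "?w e = f e @ k @ g e" "a \<noteq> e \<Longrightarrow> ?w a = f a @ g a" for a
      by (simp_all add: plus_fun_def plus_list_def)
    have in_w: "?w e \<in> ?M" using fge k unfolding w(1) by (simp only: append_in_lists_conv simp_thms)
    have "?in (Poly_Mapping.single k r) = Poly_Mapping.single (?w e) r"
      unfolding w(1) by (simp only: mult_single plus_list_def mult_1_left mult_1_right append_assoc)
    then have 1: "?t (ycls 1 (\<mu> e) (?in (Poly_Mapping.single k r)))
        = r * ?t (ycls 1 (\<mu> e) (Poly_Mapping.single (?w e) 1))"
      using linear_form_single[OF lin in_w, of r] by (simp only:)
    have "?F ?w = ?t (ycls 1 (\<mu> e) (Poly_Mapping.single (?w e) 1)) *
        (\<Prod>a\<in>S - {e}. \<tau> a (\<mu> a) (ycls 1 (\<mu> a) (Poly_Mapping.single (?w a) 1)))"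
      unfolding tensor_weight_def by (rule prod.remove[OF S])
    also have "(\<Prod>a\<in>S - {e}. \<tau> a (\<mu> a) (ycls 1 (\<mu> a) (Poly_Mapping.single (?w a) 1)))
        = (\<Prod>a\<in>S - {e}. \<tau> a (\<mu> a) (ycls 1 (\<mu> a) (Poly_Mapping.single (f a @ g a) 1)))"
      by (rule prod.cong[OF refl]) (simp only: w(2) Diff_iff singleton_iff simp_thms)
    finally have 2: "?F ?w = ?t (ycls 1 (\<mu> e) (Poly_Mapping.single (?w e) 1)) *
        (\<Prod>a\<in>S - {e}. \<tau> a (\<mu> a) (ycls 1 (\<mu> a) (Poly_Mapping.single (f a @ g a) 1)))" .
    have "Poly_Mapping.single f c * at_factor e (Poly_Mapping.single k r) * Poly_Mapping.single g c'
        = Poly_Mapping.single ?w (c * r * c')"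
      by (simp add: at_factor_eq_push mult_single)
    then have "pairing ?F (Poly_Mapping.single f c * at_factor e (Poly_Mapping.single k r) * Poly_Mapping.single g c')
        = c * r * c' * ?F ?w" by (simp only: pairing_single)
    also have "\<dots> = ?K * ?t (ycls 1 (\<mu> e) (?in (Poly_Mapping.single k r)))"
      unfolding 1 2 by (simp only: mult_ac)
    finally show "?P (Poly_Mapping.single k r)"
      using Y.malg_single[OF k] by simp
  qed
  moreover have "Y.eqv (\<mu> e) 1 (?in q) (?in 0)"
    using q q_closed fge by (intro Y.eqv_mult Y.eqv_refl Y.eqv_relation) simp_all
  then have "?t (ycls 1 (\<mu> e) (?in q)) = 0"
    using linear_form_zero[OF lin] ycls_eq_of_eqv[of "\<mu> e" 1 "?in q" "?in 0"] by (simp add: Y.pcls_zero)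
  ultimately show ?thesis by simp
qed

text \<open>The elements all of whose two-sided multiples are annihilated by the form are an ideal. It
  contains the relators by \<open>pairing_relation\<close>, applied to words on either side.\<close>

lemma pairing_relators:
  assumes "finite S" "\<And>a. a \<in> S \<Longrightarrow> linear_form 1 (\<mu> a) (\<tau> a (\<mu> a))" "\<And>a. a \<notin> S \<Longrightarrow> \<mu> a = 0"
    and "y \<in> H.relators \<mu>"
  shows "pairing (tensor_weight S \<tau> \<mu>) y = 0"
proof -
  let ?F = "tensor_weight S \<tau> \<mu>" and ?C = "carrier (malg (hwords \<mu>))"
  let ?J = "{x \<in> ?C. \<forall>a\<in>?C. \<forall>b\<in>?C. pairing ?F (a * x * b) = 0}"
  have "ideal ?J (malg (hwords \<mu>))"
  proof (rule idealI[OF H.malg.ring_axioms])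
    show "subgroup ?J (add_monoid (malg (hwords \<mu>)))"
    proof (rule H.malg.add.subgroupI)
      have "0 \<in> ?J" by simp
      then show "?J \<noteq> {}" by blast
    next
      fix x assume x: "x \<in> ?J"
      then have "\<ominus>\<^bsub>malg (hwords \<mu>)\<^esub> x = - x"
        by (intro H.malg.minus_equality) simp_all
      moreover have "pairing ?F (a * (- x) * b) = - pairing ?F (a * x * b)" for a b
        using pairing_diff[of ?F 0 "a * x * b"] by simp
      ultimately show "\<ominus>\<^bsub>malg (hwords \<mu>)\<^esub> x \<in> ?J"
        using x by simp
    next
      fix x y assume "x \<in> ?J" "y \<in> ?J"
      then show "x \<oplus>\<^bsub>malg (hwords \<mu>)\<^esub> y \<in> ?J"
        by (simp add: distrib_left distrib_right pairing_add)
    qed auto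
  next
    fix x z assume x: "x \<in> ?J" and z: "z \<in> ?C"
    show "z \<otimes>\<^bsub>malg (hwords \<mu>)\<^esub> x \<in> ?J"
    proof -
      have "pairing ?F (a * (z * x) * b) = 0" if "a \<in> ?C" "b \<in> ?C" for a b
      proof -
        have "pairing ?F ((a * z) * x * b) = 0" using x z that by simp
        then show ?thesis by (simp only: mult.assoc)
      qed
      then show ?thesis using x z by simp
    qed
    show "x \<otimes>\<^bsub>malg (hwords \<mu>)\<^esub> z \<in> ?J"
    proof -
      have "pairing ?F (a * (x * z) * b) = 0" if "a \<in> ?C" "b \<in> ?C" for a b
      proof -
        have "pairing ?F (a * x * (z * b)) = 0" using x z that by simp
        then show ?thesis by (simp only: mult.assoc)
      qed
      then show ?thesis using x z by simp
    qed
  qed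
  moreover have "hrel \<mu> \<subseteq> ?J"
  proof
    fix x assume x: "x \<in> hrel \<mu>"
    then obtain e q where q: "q \<in> yrel 1 (\<mu> e)" "x = at_factor e q"
      unfolding hrel_def by blast
    have e: "e \<in> S" using q(1) assms(3)[of e] yrel_0 by (cases "e \<in> S") auto
    have "pairing ?F (a * x * b) = 0" if a: "a \<in> ?C" and b: "b \<in> ?C" for a b
    proof (rule poly_mapping_single_add_induct[of a "\<lambda>a. pairing ?F (a * x * b) = 0"])
      fix f c assume "f \<in> Poly_Mapping.keys a"
      then have f: "f \<in> hwords \<mu>" using a unfolding H.carrier_malg_iff by blast
      show "pairing ?F (Poly_Mapping.single f c * x * b) = 0"
      proof (rule poly_mapping_single_add_induct[of b "\<lambda>b. pairing ?F (Poly_Mapping.single f c * x * b) = 0"])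
        fix g c' assume "g \<in> Poly_Mapping.keys b"
        then have g: "g \<in> hwords \<mu>" using b unfolding H.carrier_malg_iff by blast
        show "pairing ?F (Poly_Mapping.single f c * x * Poly_Mapping.single g c') = 0"
          unfolding q(2) by (rule pairing_relation[where \<tau> = \<tau>, OF assms(1) e assms(2)[OF e] f g q(1)])
      qed (simp_all add: distrib_left pairing_add)
    qed (simp_all add: distrib_right pairing_add)
    then show "x \<in> ?J" using x H.Q_subset by blast
  qed
  ultimately have "H.relators \<mu> \<subseteq> ?J"
    by (rule H.malg.genideal_minimal)
  then have "y \<in> ?J" using assms(4) by blast
  then have "\<forall>a\<in>?C. \<forall>b\<in>?C. pairing ?F (a * y * b) = 0" by (rule CollectE) (rule conjunct2)
  from bspec[OF bspec[OF this H.malg_one] H.malg_one] show ?thesis by simp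
qed

text \<open>The value of \<open>tensor_form\<close> at a class is the common value of its representatives. For the class 0
  these are all the elements of the ideal of relators, and the value 0 is only known once all of
  them give 0.\<close>

lemma tensor_form_zero:
  assumes "finite S" "\<And>a. a \<in> S \<Longrightarrow> linear_form 1 (\<mu> a) (\<tau> a (\<mu> a))" "\<And>a. a \<notin> S \<Longrightarrow> \<mu> a = 0"
  shows "tensor_form S \<tau> \<mu> \<zero>\<^bsub>HH \<mu>\<^esub> = 0"
proof -
  have zero: "\<zero>\<^bsub>HH \<mu>\<^esub> = H.relators \<mu>" by (simp add: HH_def palg_def FactRing_def)
  have ne: "H.relators \<mu> \<noteq> {}"
    using additive_subgroup.zero_closed[OF ideal.axioms(1)[OF H.relators_ideal[of \<mu>]]] by blast
  have "pairing (tensor_weight S \<tau> \<mu>) ` H.relators \<mu> = (\<lambda>_. 0) ` H.relators \<mu>"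
    by (rule image_cong[OF refl], rule pairing_relators[where \<tau> = \<tau> and \<mu> = \<mu>, OF assms])
  also have "\<dots> = {0}" using ne by (simp only: image_constant_conv if_False)
  finally have "pairing (tensor_weight S \<tau> \<mu>) ` \<zero>\<^bsub>HH \<mu>\<^esub> = {0}"
    by (simp only: zero)
  then show ?thesis by (simp add: tensor_form_eq)
qed


section \<open>Basic invariants\<close>

text \<open>The compositions over which the basic trace of \<open>S\<close> is summed.\<close>

definition exact_comps :: "nat \<Rightarrow> nat \<Rightarrow> nat set \<Rightarrow> (nat \<Rightarrow> nat) set" where
  "exact_comps d n S = {\<mu> \<in> comps d n. \<forall>a\<in>{1..d}. \<mu> a \<noteq> 0 \<longleftrightarrow> a \<in> S}"

lemma exact_comps_iff:
  assumes "S \<subseteq> {1..d}"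
  shows "\<mu> \<in> exact_comps d n S \<longleftrightarrow> \<mu> \<in> comps d n \<and> (\<forall>a. \<mu> a \<noteq> 0 \<longleftrightarrow> a \<in> S)"
  using assms unfolding exact_comps_def comps_def by (auto simp del: atLeastAtMost_iff)

text \<open>A function that is invariant under \<open>b\<close> is constant on the orbits, so it factors through the set
  of orbits.\<close>

lemma fixed_chr_components:
  fixes b :: "nat \<Rightarrow> nat"
  assumes b: "b permutes {1..n}" and inv: "\<And>i. i \<in> {1..n} \<Longrightarrow> \<chi> (b i) = \<chi> i"
  shows "card (\<chi> ` {1..n}) \<le> card (orbit b ` {1..n})"
proof -
  have const: "\<chi> x = \<chi> i" if "x \<in> orbit b i" "i \<in> {1..n}" for x i
  proof -
    have "x \<in> {1..n} \<and> \<chi> x = \<chi> i"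
      using that(1)
    proof induction
      case base
      show ?case using inv[OF that(2)] permutes_in_image[OF b, of i] that(2) by simp
    next
      case (step y)
      then show ?case using inv[of y] permutes_in_image[OF b, of y] by simp
    qed
    then show ?thesis ..
  qed
  have "\<chi> i = \<chi> (SOME x. x \<in> orbit b i)" if "i \<in> {1..n}" for i
    using const[OF someI[of "\<lambda>x. x \<in> orbit b i", OF orbit.base] that] ..
  then have "\<chi> ` {1..n} = (\<lambda>A. \<chi> (SOME x. x \<in> A)) ` orbit b ` {1..n}"
    unfolding image_image by (rule image_cong[OF refl])
  then show ?thesis
    by (simp only:) (rule card_image_le, simp)
qed

text \<open>A fixed character takes at most as many values as \<open>b\<close> has cycles, and every $\xi_a$ with \<open>a \<in> S\<close>
  is one of its values.\<close>

lemma (in matrix_iso) card_support_le: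
  assumes "b permutes {1..n}" "\<mu> \<in> exact_comps d n S" "S \<subseteq> {1..d}" "\<chi> \<in> Irr_comp \<xi> d n \<mu>" "pull n b \<chi> = \<chi>"
  shows "card S \<le> card (orbit b ` {1..n})"
proof -
  have "\<chi> (b i) = \<chi> i" if "i \<in> {1..n}" for i
    using fun_cong[OF assms(5), of i] that by (simp add: pull_def)
  then have "card (\<chi> ` {1..n}) \<le> card (orbit b ` {1..n})"
    by (rule fixed_chr_components[OF assms(1)])
  moreover have "\<xi> ` S \<subseteq> \<chi> ` {1..n}"
  proof (rule image_subsetI)
    fix a assume a: "a \<in> S"
    then have "comp_of \<xi> d n \<chi> a \<noteq> 0"
      using assms(2,4) unfolding exact_comps_iff[OF assms(3)] Irr_comp_def by blast
    then have "card {j \<in> {1..n}. \<chi> j = \<xi> a} \<noteq> 0"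
      using a assms(3) unfolding comp_of_def by (auto simp del: card_0_eq split: if_splits)
    then have "{j \<in> {1..n}. \<chi> j = \<xi> a} \<noteq> {}" by (metis card.empty)
    then show "\<xi> a \<in> \<chi> ` {1..n}" by force
  qed
  then have "card (\<xi> ` S) \<le> card (\<chi> ` {1..n})"
    by (intro card_mono) simp_all
  moreover have "card (\<xi> ` S) = card S"
    by (rule card_image[OF inj_on_subset[OF bij_betw_imp_inj_on[OF bij_roots] assms(3)]])
  ultimately show ?thesis by simp
qed

context relabelling
begin

lemma tensor_form_relabel:
  assumes "S = p ` {1..k}"
  shows "tensor_form S \<tau> \<mu> z = tensor_form {1..k} (\<tau> \<circ> p) (\<mu> \<circ> p) (push permute_factors ` z)"
proof -
  have "tensor_weight S \<tau> \<mu> = tensor_weight {1..k} (\<tau> \<circ> p) (\<mu> \<circ> p) \<circ> permute_factors"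
    unfolding tensor_weight_def assms
    by (rule ext) (subst prod.reindex, auto simp: inj_on_def p_inj permute_factors_def)
  then show ?thesis
    by (simp add: tensor_form_eq image_image pairing_push)
qed

lemma exact_comps_supported:
  assumes "S = p ` {1..k}" "\<mu> \<in> exact_comps d n S"
  shows "supported \<mu>" "\<mu> \<circ> p \<in> exact_comps k n {1..k}"
proof -
  have S: "S \<subseteq> {1..d}" unfolding assms(1) using p_in by blast
  note ex = assms(2)[unfolded exact_comps_iff[OF S]]
  show supp: "supported \<mu>"
    unfolding supported_def assms(1)[symmetric] using ex by blast
  have "(\<mu> \<circ> p) b \<noteq> 0 \<longleftrightarrow> b \<in> {1..k}" for b
    using ex[THEN conjunct2, THEN spec, of "p b"] by (simp only: comp_apply assms(1) p_image_iff)
  then show "\<mu> \<circ> p \<in> exact_comps k n {1..k}"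
    using supported_comps[OF supp] unfolding exact_comps_iff[OF order_refl] by blast
qed

lemma exact_comps_unrelabel:
  assumes "S = p ` {1..k}" "\<nu> \<in> exact_comps k n {1..k}"
  shows "\<nu> \<circ> perm_inv p \<in> exact_comps d n S"
proof -
  have S: "S \<subseteq> {1..d}" unfolding assms(1) using p_in by blast
  have \<nu>: "\<nu> \<in> comps k n" "\<And>b. \<nu> b \<noteq> 0 \<longleftrightarrow> b \<in> {1..k}"
    using assms(2) unfolding exact_comps_iff[OF order_refl] by blast+
  have ex: "(\<nu> \<circ> perm_inv p) a \<noteq> 0 \<longleftrightarrow> a \<in> S" for a
    using \<nu>(2)[of "perm_inv p a"] p_image_iff[of "perm_inv p a" "{1..k}"]
    by (simp only: comp_apply assms(1) p_inv)
  have "(\<Sum>a=1..d. (\<nu> \<circ> perm_inv p) a) = (\<Sum>b=1..d. \<nu> b)"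
    using sum.permute[OF permutes_inv[OF p_permutes], of \<nu>] by simp
  also have "\<dots> = (\<Sum>b=1..k. \<nu> b)"
  proof (rule sum.mono_neutral_right)
    show "\<forall>b\<in>{1..d} - {1..k}. \<nu> b = 0" using \<nu>(2) by blast
  qed (use k_le in auto)
  also have "\<dots> = n" using \<nu>(1) by (simp add: comps_def)
  finally have "(\<Sum>a=1..d. (\<nu> \<circ> perm_inv p) a) = n" .
  moreover have "(\<nu> \<circ> perm_inv p) a = 0" if "a \<notin> {1..d}" for a
    using ex[of a] that S by blast
  ultimately have "\<nu> \<circ> perm_inv p \<in> comps d n"
    unfolding comps_def by blast
  then show ?thesis using ex unfolding exact_comps_iff[OF S] by blast
qed

text \<open>The diagonal entries correspond under relabelling: a character is fixed by the permutation of the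
  braid if and only if the relabelled character is.\<close>

lemma trace_relabel:
  assumes \<mu>: "supported \<mu>" and \<beta>: "\<beta> \<in> affine_words n"
  shows "push permute_factors ` finsum (HH \<mu>) (\<lambda>\<chi>. \<Psi> (delta d n \<beta>) \<mu> \<chi> \<chi>) (Irr_comp \<xi> d n \<mu>)
    = finsum (HH (\<mu> \<circ> p)) (\<lambda>\<chi>. \<Psi>' (delta k n \<beta>) (\<mu> \<circ> p) \<chi> \<chi>) (Irr_comp \<xi>' k n (\<mu> \<circ> p))"
proof -
  let ?I = "Irr_comp \<xi> d n \<mu>" and ?J = "Irr_comp \<xi>' k n (\<mu> \<circ> p)"
  interpret tr: algebra_transport "hwords \<mu>" "hrel \<mu>" "hwords (\<mu> \<circ> p)" "hrel (\<mu> \<circ> p)" permute_factors "\<lambda>f. f \<circ> perm_inv p"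
    by (rule transport)
  obtain q q' where q: "source.monomial (bword_perm \<beta>) q (delta d n \<beta>)"
    "target.monomial (bword_perm \<beta>) q' (delta k n \<beta>)"
    "\<forall>\<chi>. supported_chr \<chi> \<longrightarrow> push permute_factors ` q \<chi> = q' (relabel \<chi>)"
    using delta_relabel[OF \<beta>] by blast
  note m = source.monomialD[OF q(1)] and m' = target.monomialD[OF q(2)]
  have closed: "\<Psi> (delta d n \<beta>) \<mu> \<chi> \<chi> \<in> carrier (HH \<mu>)" if "\<chi> \<in> ?I" for \<chi>
    using source.Psi_closed[OF m(2) supportedD(1)[OF \<mu>] that that] .
  have closed': "\<Psi>' (delta k n \<beta>) (\<mu> \<circ> p) \<chi> \<chi> \<in> carrier (HH (\<mu> \<circ> p))" if "\<chi> \<in> ?J" for \<chi>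
    using target.Psi_closed[OF m'(2) supported_comps[OF \<mu>] that that] .
  have entry: "push permute_factors ` \<Psi> (delta d n \<beta>) \<mu> \<chi> \<chi> = \<Psi>' (delta k n \<beta>) (\<mu> \<circ> p) (relabel \<chi>) (relabel \<chi>)"
    if \<chi>: "\<chi> \<in> ?I" for \<chi>
  proof -
    have supp: "supported_chr \<chi>" by (rule supported_chrI[OF \<mu> \<chi>])
    have \<chi>': "\<chi> \<in> Irr d n" "\<mu> = comp_of \<xi> d n \<chi>" using source.Irr_compD[OF \<chi>] by simp_all
    have r: "relabel \<chi> \<in> ?J" using bij_betwE[OF bij_relabel[OF \<mu>]] \<chi> by blast
    have r': "relabel \<chi> \<in> Irr k n" "\<mu> \<circ> p = comp_of \<xi>' k n (relabel \<chi>)" using target.Irr_compD[OF r] by simp_all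
    have "\<chi> = pull n (bword_perm \<beta>) \<chi> \<longleftrightarrow> relabel \<chi> = pull n (bword_perm \<beta>) (relabel \<chi>)"
      unfolding relabel_pull[OF m(1), symmetric]
      by (rule relabel_inj[OF supp supported_chr_pull[OF supp m(1)], symmetric])
    then show ?thesis
      unfolding m(3)[OF \<chi>'(2,1) \<chi>] m'(3)[OF r'(2,1) r]
      using q(3) supp tr.transport_zero[folded HH_def] by simp
  qed
  have "push permute_factors ` finsum (HH \<mu>) (\<lambda>\<chi>. \<Psi> (delta d n \<beta>) \<mu> \<chi> \<chi>) ?I
      = finsum (HH (\<mu> \<circ> p)) (\<lambda>\<chi>. push permute_factors ` \<Psi> (delta d n \<beta>) \<mu> \<chi> \<chi>) ?I"
    using closed finite_Irr_comp[OF source.d_pos] by (rule tr.transport_finsum[folded HH_def, rotated])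
  also have "\<dots> = finsum (HH (\<mu> \<circ> p)) (\<lambda>\<chi>. \<Psi>' (delta k n \<beta>) (\<mu> \<circ> p) (relabel \<chi>) (relabel \<chi>)) ?I"
  proof (rule H.palg.finsum_cong'[OF refl])
    show "(\<lambda>\<chi>. \<Psi>' (delta k n \<beta>) (\<mu> \<circ> p) (relabel \<chi>) (relabel \<chi>)) \<in> ?I \<rightarrow> carrier (HH (\<mu> \<circ> p))"
      using closed' bij_betwE[OF bij_relabel[OF \<mu>]] by blast
  qed (rule entry)
  also have "\<dots> = finsum (HH (\<mu> \<circ> p)) (\<lambda>\<chi>. \<Psi>' (delta k n \<beta>) (\<mu> \<circ> p) \<chi> \<chi>) (relabel ` ?I)"
    using closed' bij_betw_imp_surj_on[OF bij_relabel[OF \<mu>]] bij_betw_imp_inj_on[OF bij_relabel[OF \<mu>]]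
    by (intro H.palg.finsum_reindex[symmetric]) blast+
  finally show ?thesis
    by (simp only: bij_betw_imp_surj_on[OF bij_relabel[OF \<mu>]])
qed

end

lemma basic_trace_eq:
  "basic_trace \<xi> \<Psi> d S \<tau> n x = (\<Sum>\<mu>\<in>exact_comps d n S.
     tensor_form S \<tau> \<mu> (finsum (HH \<mu>) (\<lambda>\<chi>. \<Psi> d n x \<mu> \<chi> \<chi>) (Irr_comp (\<xi> d) d n \<mu>)))"
  by (simp add: basic_trace_def exact_comps_def)

text \<open>The increasing enumeration of \<open>S\<close>, continued by any bijection from the remaining indices to the
  complement of \<open>S\<close>.\<close>

lemma increasing_permutation:
  assumes "S \<subseteq> {1..d}"
  obtains p where "p permutes {1..d}" "strict_mono_on {1..card S} p" "p ` {1..card S} = S"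
proof -
  let ?k = "card S"
  have fin: "finite S" using assms finite_subset by blast
  have k: "?k \<le> d" using card_mono[OF _ assms] by simp
  obtain f where f: "bij_betw f {..<?k} S" "strict_mono_on {..<?k} f"
    using ex_bij_betw_strict_mono_card[OF fin] .
  have "card {?k<..d} = card ({1..d} - S)"
    using card_Diff_subset[OF fin assms] by simp
  then obtain g where g: "bij_betw g {?k<..d} ({1..d} - S)"
    using finite_same_card_bij[of "{?k<..d}" "{1..d} - S"] by auto
  define p where "p b = (if b \<in> {1..?k} then f (b - 1) else if b \<in> {?k<..d} then g b else b)" for b
  have f': "bij_betw (\<lambda>b. f (b - 1)) {1..?k} S"
  proof -
    have "bij_betw (\<lambda>b. b - 1) {1..?k} {..<?k}"
      by (rule bij_betwI[of _ _ _ Suc]) auto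
    from bij_betw_trans[OF this f(1)] show ?thesis by (simp add: comp_def)
  qed
  have p1: "bij_betw p {1..?k} S"
    using f' by (rule bij_betw_cong[THEN iffD1, rotated]) (simp add: p_def)
  have p2: "bij_betw p {?k<..d} ({1..d} - S)"
    using g by (rule bij_betw_cong[THEN iffD1, rotated]) (simp add: p_def)
  have "bij_betw p ({1..?k} \<union> {?k<..d}) (S \<union> ({1..d} - S))"
    by (rule bij_betw_combine[OF p1 p2]) blast
  moreover have "{1..?k} \<union> {?k<..d} = {1..d}" using k by auto
  moreover have "S \<union> ({1..d} - S) = {1..d}" using assms by blast
  ultimately have "bij_betw p {1..d} {1..d}" by simp
  then have "p permutes {1..d}"
    by (rule bij_imp_permutes) (use k in \<open>auto simp: p_def\<close>)
  moreover have "strict_mono_on {1..?k} p"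
  proof (rule strict_mono_onI)
    fix b c assume "b \<in> {1..?k}" "c \<in> {1..?k}" "b < c"
    then show "p b < p c"
      using strict_mono_onD[OF f(2), of "b - 1" "c - 1"] by (simp add: p_def)
  qed
  moreover have "p ` {1..?k} = S" using p1 by (rule bij_betw_imp_surj_on)
  ultimately show thesis by (rule that)
qed

lemma uv_ring_sum:
  assumes "\<And>a. a \<in> K \<Longrightarrow> f a \<in> uv_ring"
  shows "(\<Sum>a\<in>K. f a) \<in> uv_ring"
proof -
  have "p + q \<in> uv_ring" if "p \<in> uv_ring" "q \<in> uv_ring" for p q
    using that keys_add[of p q] unfolding uv_ring_def by fastforce
  moreover have "0 \<in> uv_ring" by (simp add: uv_ring_def)
  ultimately show ?thesis
    using assms by (induction K rule: infinite_finite_induct) simp_all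
qed

locale all_matrix_isos =
  fixes \<xi> :: "nat \<Rightarrow> nat \<Rightarrow> complex" and \<Psi> :: "nat \<Rightarrow> nat \<Rightarrow> falg set \<Rightarrow> mats"
  assumes roots: "\<And>d. d \<ge> 1 \<Longrightarrow> bij_betw (\<xi> d) {1..d} {z. z ^ d = 1}"
    and isos: "\<And>d n. d \<ge> 1 \<Longrightarrow> n \<ge> 1 \<Longrightarrow> is_Psi (\<xi> d) d n (\<Psi> d n)"
begin

lemma iso: "d \<ge> 1 \<Longrightarrow> n \<ge> 1 \<Longrightarrow> matrix_iso (\<xi> d) d n (\<Psi> d n)"
  by (intro matrix_iso.intro root_enumeration.intro matrix_iso_axioms.intro roots isos)

lemma link_inv_relabel:
  assumes "S \<noteq> {}" "S \<subseteq> {1..d}" "p permutes {1..d}" "strict_mono_on {1..card S} p" "p ` {1..card S} = S"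
    and "n \<ge> 1" "\<beta> \<in> affine_words n"
  shows "link_inv d (basic_trace \<xi> \<Psi> d S \<tau>) (n, \<beta>)
    = link_inv (card S) (basic_trace \<xi> \<Psi> (card S) {1..card S} (\<tau> \<circ> p)) (n, \<beta>)"
proof -
  let ?k = "card S"
  have fin: "finite S" using assms(2) finite_subset by blast
  have d: "d \<ge> 1" using assms(1,2) by fastforce
  have k: "?k \<ge> 1" "?k \<le> d"
    using assms(1) fin card_mono[OF _ assms(2)] by (simp_all add: Suc_le_eq card_gt_0_iff)
  interpret relabelling "\<xi> d" d n "\<Psi> d n" "\<xi> ?k" ?k "\<Psi> ?k n" p
    by (intro relabelling.intro relabelling_axioms.intro iso d k assms)
  note S = assms(5)[symmetric]
  show ?thesis
    unfolding link_inv_def prod.case basic_trace_eq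
  proof (rule sum.reindex_bij_witness[where j = "\<lambda>\<mu>. \<mu> \<circ> p" and i = "\<lambda>\<nu>. \<nu> \<circ> perm_inv p"])
    fix \<mu> assume \<mu>: "\<mu> \<in> exact_comps d n S"
    show "(\<mu> \<circ> p) \<circ> perm_inv p = \<mu>" by (simp add: fun_eq_iff)
    show "\<mu> \<circ> p \<in> exact_comps ?k n {1..?k}" by (rule exact_comps_supported(2)[OF S \<mu>])
    show "tensor_form {1..?k} (\<tau> \<circ> p) (\<mu> \<circ> p) (finsum (HH (\<mu> \<circ> p))
          (\<lambda>\<chi>. \<Psi> ?k n (delta ?k n \<beta>) (\<mu> \<circ> p) \<chi> \<chi>) (Irr_comp (\<xi> ?k) ?k n (\<mu> \<circ> p))) =
        tensor_form S \<tau> \<mu> (finsum (HH \<mu>) (\<lambda>\<chi>. \<Psi> d n (delta d n \<beta>) \<mu> \<chi> \<chi>) (Irr_comp (\<xi> d) d n \<mu>))"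
      unfolding tensor_form_relabel[OF S] trace_relabel[OF exact_comps_supported(1)[OF S \<mu>] assms(7)] ..
  next
    fix \<nu> assume \<nu>: "\<nu> \<in> exact_comps ?k n {1..?k}"
    show "(\<nu> \<circ> perm_inv p) \<circ> p = \<nu>" by (simp add: fun_eq_iff)
    show "\<nu> \<circ> perm_inv p \<in> exact_comps d n S" by (rule exact_comps_unrelabel[OF S \<nu>])
  qed
qed

text \<open>The case of the trivial relabelling, \<open>k = d\<close> and \<open>p = id\<close>, of \<open>delta_relabel\<close>.\<close>

lemma delta_monomial:
  assumes "d \<ge> 1" "n \<ge> 1" "\<beta> \<in> affine_words n"
  obtains q where "matrix_iso.monomial (\<xi> d) d n (\<Psi> d n) (bword_perm \<beta>) q (delta d n \<beta>)"
proof -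
  interpret relabelling "\<xi> d" d n "\<Psi> d n" "\<xi> d" d "\<Psi> d n" id
    by (intro relabelling.intro relabelling_axioms.intro iso assms permutes_id)
      (simp_all add: strict_mono_on_def)
  show thesis using delta_relabel[OF assms(3)] that by blast
qed

text \<open>By \<open>card_support_le\<close> no character that counts for \<open>S\<close> is fixed by the permutation of the braid, so
  all the diagonal entries are 0.\<close>

lemma link_inv_vanish:
  assumes "S \<noteq> {}" "S \<subseteq> {1..d}" "\<forall>a\<in>S. markov_trace 1 (\<tau> a)"
    and "n \<ge> 1" "\<beta> \<in> affine_words n" "components n \<beta> < card S"
  shows "link_inv d (basic_trace \<xi> \<Psi> d S \<tau>) (n, \<beta>) = 0"
proof -
  have d: "d \<ge> 1" using assms(1,2) by fastforce
  interpret matrix_iso "\<xi> d" d n "\<Psi> d n" by (rule iso[OF d assms(4)])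
  obtain q where q: "monomial (bword_perm \<beta>) q (delta d n \<beta>)"
    using delta_monomial[OF d assms(4,5)] .
  have "tensor_form S \<tau> \<mu> (finsum (HH \<mu>) (\<lambda>\<chi>. \<Psi> d n (delta d n \<beta>) \<mu> \<chi> \<chi>) (Irr_comp (\<xi> d) d n \<mu>)) = 0"
    if \<mu>: "\<mu> \<in> exact_comps d n S" for \<mu>
  proof -
    have supp: "\<mu> a \<noteq> 0 \<longleftrightarrow> a \<in> S" for a
      using \<mu> unfolding exact_comps_iff[OF assms(2)] by blast
    have "\<Psi> d n (delta d n \<beta>) \<mu> \<chi> \<chi> = \<zero>\<^bsub>HH \<mu>\<^esub>" if \<chi>: "\<chi> \<in> Irr_comp (\<xi> d) d n \<mu>" for \<chi>
    proof -
      have "\<chi> \<noteq> pull n (bword_perm \<beta>) \<chi>"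
        using card_support_le[OF monomialD(1)[OF q] \<mu> assms(2) \<chi>] assms(6)
        unfolding components_def by fastforce
      then show ?thesis
        using monomialD(3)[OF q, of \<mu> \<chi> \<chi>] Irr_compD[OF \<chi>] \<chi> by simp
    qed
    then have "finsum (HH \<mu>) (\<lambda>\<chi>. \<Psi> d n (delta d n \<beta>) \<mu> \<chi> \<chi>) (Irr_comp (\<xi> d) d n \<mu>)
        = finsum (HH \<mu>) (\<lambda>\<chi>. \<zero>\<^bsub>HH \<mu>\<^esub>) (Irr_comp (\<xi> d) d n \<mu>)"
      by (intro H.palg.finsum_cong') auto
    also have "\<dots> = \<zero>\<^bsub>HH \<mu>\<^esub>" by (rule H.palg.finsum_zero)
    finally show ?thesis
    proof (simp only:, intro tensor_form_zero)
      show "finite S" using assms(2) finite_subset by blast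
      show "linear_form 1 (\<mu> a) (\<tau> a (\<mu> a))" if "a \<in> S" for a
        using assms(3) that supp[of a] unfolding markov_trace_def by (metis One_nat_def Suc_leI gr0I)
      show "\<mu> a = 0" if "a \<notin> S" for a
        using supp[of a] that by blast
    qed
  qed
  then show ?thesis
    unfolding link_inv_def prod.case basic_trace_eq by (rule sum.neutral[OF ballI])
qed

text \<open>Each basic trace in the combination either contributes 0 or one of the listed invariants. Different
  basic traces may lead to the same invariant, for instance when they differ only by the choice of \<open>S\<close>;
  the coefficient of an invariant is the sum over all basic traces that lead to it.\<close>

lemma lin_comb_basic:
  assumes "d \<ge> 1" "in_basic_span \<xi> \<Psi> d \<rho>"
  shows "lin_comb_on (affine_links N) (basic_invs \<xi> \<Psi> N) (link_inv d \<rho>)"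
proof -
  let ?B = "{case_prod (basic_trace \<xi> \<Psi> d S \<tau>) | S \<tau>.
          S \<noteq> {} \<and> S \<subseteq> {1..d} \<and> (\<forall>a\<in>S. markov_trace 1 (\<tau> a))}"
  obtain F c where F: "finite F" "F \<subseteq> ?B" "\<forall>b\<in>F. c b \<in> uv_ring"
    and eq: "\<forall>x\<in>{(n, x). n \<ge> 1 \<and> x \<in> carrier (YH d n)}. case_prod \<rho> x = (\<Sum>b\<in>F. c b * b x)"
    using assms(2) unfolding in_basic_span_def lin_comb_on_def by blast
  let ?val = "\<lambda>b L. case L of (n, \<beta>) \<Rightarrow> b (n, delta d n \<beta>)"
  have "(\<exists>g\<in>basic_invs \<xi> \<Psi> N. \<forall>L\<in>affine_links N. ?val b L = g L) \<or> (\<forall>L\<in>affine_links N. ?val b L = 0)"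
    if b: "b \<in> F" for b
  proof -
    obtain S \<tau> where b_eq: "b = case_prod (basic_trace \<xi> \<Psi> d S \<tau>)" and S: "S \<noteq> {}" "S \<subseteq> {1..d}"
      and \<tau>: "\<forall>a\<in>S. markov_trace 1 (\<tau> a)"
      using F(2) b by blast
    have val: "?val b (n, \<beta>) = link_inv d (basic_trace \<xi> \<Psi> d S \<tau>) (n, \<beta>)" for n \<beta>
      by (simp add: b_eq link_inv_def)
    show ?thesis
    proof (cases "card S \<le> N")
      case True
      obtain p where p: "p permutes {1..d}" "strict_mono_on {1..card S} p" "p ` {1..card S} = S"
        using increasing_permutation[OF S(2)] .
      let ?g = "link_inv (card S) (basic_trace \<xi> \<Psi> (card S) {1..card S} (\<tau> \<circ> p))"
      have "finite S" using S(2) finite_subset by blast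
      then have "1 \<le> card S" using S(1) by (simp add: Suc_le_eq card_gt_0_iff)
      moreover have "\<forall>a\<in>{1..card S}. markov_trace 1 ((\<tau> \<circ> p) a)"
        using \<tau> p(3) by auto
      ultimately have "?g \<in> basic_invs \<xi> \<Psi> N"
        using True unfolding basic_invs_def by blast
      moreover have "?val b L = ?g L" if L: "L \<in> affine_links N" for L
      proof -
        obtain n \<beta> where L_eq: "L = (n, \<beta>)" "n \<ge> 1" "\<beta> \<in> affine_words n"
          using L by (auto simp: affine_links_def)
        show ?thesis
          unfolding L_eq(1) val by (rule link_inv_relabel[OF S p L_eq(2,3)])
      qed
      ultimately show ?thesis by blast
    next
      case False
      have "?val b L = 0" if L: "L \<in> affine_links N" for L
      proof -
        obtain n \<beta> where L_eq: "L = (n, \<beta>)" "n \<ge> 1" "\<beta> \<in> affine_words n" "components n \<beta> = N"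
          using L by (auto simp: affine_links_def)
        show ?thesis
          unfolding L_eq(1) val by (rule link_inv_vanish[OF S \<tau> L_eq(2,3)]) (use False L_eq(4) in simp)
      qed
      then show ?thesis by blast
    qed
  qed
  note cases = this
  \<comment> \<open>The basic traces of the combination that yield one of the listed invariants; the others yield 0.\<close>
  define F' where "F' = {b \<in> F. \<exists>g\<in>basic_invs \<xi> \<Psi> N. \<forall>L\<in>affine_links N. ?val b L = g L}"
  have F': "finite F'" "F' \<subseteq> F" using F(1) by (simp_all add: F'_def)
  have "\<forall>b\<in>F'. \<exists>g. g \<in> basic_invs \<xi> \<Psi> N \<and> (\<forall>L\<in>affine_links N. ?val b L = g L)"
    unfolding F'_def by blast
  then obtain g where g: "\<And>b. b \<in> F' \<Longrightarrow> g b \<in> basic_invs \<xi> \<Psi> N"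
      "\<And>b L. b \<in> F' \<Longrightarrow> L \<in> affine_links N \<Longrightarrow> ?val b L = g b L"
    using bchoice[of F' "\<lambda>b g. g \<in> basic_invs \<xi> \<Psi> N \<and> (\<forall>L\<in>affine_links N. ?val b L = g L)"] by blast
  \<comment> \<open>The fibre of \<open>g\<close> over \<open>\<gamma>\<close> may have several elements.\<close>
  define c' where "c' \<gamma> = (\<Sum>b\<in>{b \<in> F'. g b = \<gamma>}. c b)" for \<gamma>
  have "link_inv d \<rho> L = (\<Sum>\<gamma>\<in>g ` F'. c' \<gamma> * \<gamma> L)" if L: "L \<in> affine_links N" for L
  proof -
    obtain n \<beta> where L_eq: "L = (n, \<beta>)" "n \<ge> 1" "\<beta> \<in> affine_words n"
      using L by (auto simp: affine_links_def)
    interpret matrix_iso "\<xi> d" d n "\<Psi> d n" by (rule iso[OF assms(1) L_eq(2)])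
    obtain q where q: "monomial (bword_perm \<beta>) q (delta d n \<beta>)"
      using delta_monomial[OF assms(1) L_eq(2,3)] .
    have "link_inv d \<rho> L = case_prod \<rho> (n, delta d n \<beta>)"
      by (simp add: link_inv_def L_eq(1))
    also have "\<dots> = (\<Sum>b\<in>F. c b * b (n, delta d n \<beta>))"
      by (rule bspec[OF eq]) (use L_eq(2) monomialD(2)[OF q] in simp)
    also have "\<dots> = (\<Sum>b\<in>F. c b * ?val b L)"
      by (simp add: L_eq(1))
    also have "\<dots> = (\<Sum>b\<in>F'. c b * ?val b L)"
    proof (rule sum.mono_neutral_right[OF F(1) F'(2)], rule ballI)
      fix b assume b: "b \<in> F - F'"
      then have "?val b L = 0" using cases[of b] L unfolding F'_def by blast
      then show "c b * ?val b L = 0" by (simp only: mult_zero_right)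
    qed
    also have "\<dots> = (\<Sum>b\<in>F'. c b * g b L)"
      using g(2) L by (intro sum.cong) simp_all
    also have "\<dots> = (\<Sum>\<gamma>\<in>g ` F'. \<Sum>b\<in>{b \<in> F'. g b = \<gamma>}. c b * g b L)"
      by (rule sum.image_gen[OF F'(1)])
    also have "\<dots> = (\<Sum>\<gamma>\<in>g ` F'. c' \<gamma> * \<gamma> L)"
      by (intro sum.cong refl) (simp add: c'_def sum_distrib_right)
    finally show ?thesis .
  qed
  moreover have "c' \<gamma> \<in> uv_ring" for \<gamma>
    unfolding c'_def using F(3) F'(2) by (intro uv_ring_sum) blast
  ultimately show ?thesis
    using F'(1) g(1) unfolding lin_comb_on_def
    by (intro exI[of _ "g ` F'"] exI[of _ c']) blast
qed

end

lemma lin_comb_on_subset: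
  "lin_comb_on D B f \<Longrightarrow> D' \<subseteq> D \<Longrightarrow> B \<subseteq> B' \<Longrightarrow> lin_comb_on D' B' f"
  unfolding lin_comb_on_def by (meson order_trans subsetD)

lemma classical_links_subset: "classical_links N \<subseteq> affine_links N"
proof -
  have "classical_words n \<subseteq> affine_words n" for n
    unfolding classical_words_def affine_words_def by (intro lists_mono Sigma_mono image_mono) auto
  then show ?thesis unfolding classical_links_def affine_links_def by blast
qed

lemma basic_trace_cong:
  "(\<And>a. a \<in> S \<Longrightarrow> \<tau> a = \<tau>' a) \<Longrightarrow> basic_trace \<xi> \<Psi> d S \<tau> = basic_trace \<xi> \<Psi> d S \<tau>'"
proof -
  assume "\<And>a. a \<in> S \<Longrightarrow> \<tau> a = \<tau>' a"
  then have "tensor_weight S \<tau> \<mu> = tensor_weight S \<tau>' \<mu>" for \<mu>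
    unfolding tensor_weight_def by simp
  then show ?thesis
    by (intro ext) (simp only: basic_trace_eq tensor_form_eq)
qed

text \<open>For \<open>k = 1\<close> the invariant only involves the value of the family \<open>\<tau>\<close> at 1, so \<open>\<tau>\<close> may be replaced
  by a constant family.\<close>

lemma basic_invs_1:
  "basic_invs \<xi> \<Psi> 1 \<subseteq> {link_inv 1 (basic_trace \<xi> \<Psi> 1 {1} (\<lambda>_. \<tau>)) | \<tau>. markov_trace 1 \<tau>}"
proof
  fix f assume "f \<in> basic_invs \<xi> \<Psi> 1"
  then obtain k \<tau> where "1 \<le> k" "k \<le> 1" and f: "f = link_inv k (basic_trace \<xi> \<Psi> k {1..k} \<tau>)"
    and \<tau>: "\<forall>a\<in>{1..k}. markov_trace 1 (\<tau> a)"
    unfolding basic_invs_def by blast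
  then have k: "k = 1" by simp
  have "basic_trace \<xi> \<Psi> 1 {1} \<tau> = basic_trace \<xi> \<Psi> 1 {1} (\<lambda>_. \<tau> 1)"
    by (rule basic_trace_cong) simp
  then have "f = link_inv 1 (basic_trace \<xi> \<Psi> 1 {1} (\<lambda>_. \<tau> 1))"
    by (simp only: f k atLeastAtMost_singleton)
  moreover have "markov_trace 1 (\<tau> 1)" using \<tau> k by simp
  ultimately show "f \<in> {link_inv 1 (basic_trace \<xi> \<Psi> 1 {1} (\<lambda>_. \<tau>)) | \<tau>. markov_trace 1 \<tau>}"
    by blast
qed

theorem corollary6p5:
  fixes N :: nat
    and \<xi> :: "nat \<Rightarrow> nat \<Rightarrow> complex"
    and \<Psi> :: "nat \<Rightarrow> nat \<Rightarrow> falg set \<Rightarrow> mats"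
  assumes "N \<ge> 1"
    and "\<And>d. d \<ge> 1 \<Longrightarrow> bij_betw (\<xi> d) {1..d} {z. z ^ d = 1}"
    and "\<And>d n. d \<ge> 1 \<Longrightarrow> n \<ge> 1 \<Longrightarrow> is_Psi (\<xi> d) d n (\<Psi> d n)"
  shows
    "(\<forall>d \<rho>. d \<ge> 1 \<and> markov_trace d \<rho> \<and> in_basic_span \<xi> \<Psi> d \<rho> \<longrightarrow>
        lin_comb_on (affine_links N) (basic_invs \<xi> \<Psi> N) (link_inv d \<rho>) \<and>
        lin_comb_on (classical_links N) (basic_invs \<xi> \<Psi> N) (link_inv d \<rho>)) \<and>
     (\<forall>d \<rho>. d \<ge> 1 \<and> markov_trace d \<rho> \<and> in_basic_span \<xi> \<Psi> d \<rho> \<longrightarrow>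
        lin_comb_on (affine_links 1)
          {link_inv 1 (basic_trace \<xi> \<Psi> 1 {1} (\<lambda>_. \<tau>)) | \<tau>. markov_trace 1 \<tau>} (link_inv d \<rho>) \<and>
        lin_comb_on (classical_links 1)
          {link_inv 1 (basic_trace \<xi> \<Psi> 1 {1} (\<lambda>_. \<tau>)) | \<tau>. markov_trace 1 \<tau>} (link_inv d \<rho>))"
proof -
  interpret all_matrix_isos \<xi> \<Psi>
    by (rule all_matrix_isos.intro) (fact assms(2,3))+
  show ?thesis
    using lin_comb_basic lin_comb_on_subset[OF lin_comb_basic classical_links_subset order_refl]
      lin_comb_on_subset[OF lin_comb_basic order_refl basic_invs_1]
      lin_comb_on_subset[OF lin_comb_basic classical_links_subset basic_invs_1]
    by (intro conjI allI impI; elim conjE) blast+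
qed

end
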